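(* Let $F$ be a piecewise linear function $$F(x)=ax+b+\sum_{i=1}^n a_i|x-x_i|+\sum_{i=1}^n b_i\,\mathrm{sgn}(x-x_i),$$ with $a,b,a_i,b_i,x_i\in\mathbb R$, $(a_i^2+b_i^2)x_i\neq 0$ for $i=1,\dots,n$ and $x_1<x_2<\dots<x_n$. Put $$a_l=a-\sum_{i=1}^n a_i,\quad b_l=b+\sum_{i=1}^n(a_ix_i-b_i),\quad a_r=a+\sum_{i=1}^n a_i,\quad b_r=b+\sum_{i=1}^n(-a_ix_i+b_i),$$ and assume $a_r\ge 0$. Consider the planar system $\dot x=F(x)-y,\ \dot y=x$. Then the dynamics of the system near infinity is completely determined by the outermost slopes $a_l$ and $a_r$, except in the case where $F(x)\equiv F(-x)$ for $x>\max\{|x_1|,|x_n|\}$ but $F(x)\not\equiv F(-x)$ for $x>0$. More precisely, the following statements hold. (A) If it is not the case that both $0\le a_r<2$ and $-2<a_l<2$, then the equilibria at infinity on the Poincaré disc are exactly the following, with the following locations and topological structures. For each of the 14 combinations of one range of $a_r$ and one range of $a_l$ below (other than the excluded one), there is a corresponding phase portrait near infinity on the Poincaré disc, which has exactly these equilibria on the equator. In the right half plane (endpoints at infinity of half-lines $y=kx$, $x\to+\infty$): - if $a_r>2$: two, namely a stable node at the end of $y=\frac{a_r-\sqrt{a_r^2-4}}{2}\,x$ and a saddle at the end of $y=\frac{a_r+\sqrt{a_r^2-4}}{2}\,x$; - if $a_r=2$: one, a saddle--node at the end of $y=x$; - if $0\le a_r<2$: none. In the left half plane (endpoints at infinity of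 half-lines $y=kx$, $x\to-\infty$): - if $a_l>2$: two, namely a stable node at the end of $y=\frac{a_l+\sqrt{a_l^2-4}}{2}\,x$ and a saddle at the end of $y=\frac{a_l-\sqrt{a_l^2-4}}{2}\,x$; - if $a_l=2$: one, a saddle--node at the end of $y=x$; - if $-2<a_l<2$: none; - if $a_l=-2$: one, a saddle--node at the end of $y=-x$; - if $a_l<-2$: two, namely an unstable node at the end of $y=\frac{a_l+\sqrt{a_l^2-4}}{2}\,x$ and a saddle at the end of $y=\frac{a_l-\sqrt{a_l^2-4}}{2}\,x$. There are no other equilibria at infinity. (B) If $0\le a_r<2$ and $-2<a_l<2$, then the system has no equilibria at infinity. Furthermore: - if $F(x)\equiv F(-x)$ for $x>0$, then the infinity is a center; - if $F(x)\not\equiv F(-x)$ for $x>0$ (and, as excepted above, it is not the case that $F(x)\equiv F(-x)$ for $x>\max\{|x_1|,|x_n|\}$), then the infinity is a focus; moreover, any orbit sufficiently close to infinity is positively bounded if $a_l+a_r<0$, or if $a_l+a_r=0$ and $b_r<b_l$; and any orbit sufficiently close to infinity is negatively bounded if $a_l+a_r>0$, or if $a_l+a_r=0$ and $b_r>b_l$.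
   Context: $\mathrm{sgn}$ is the sign function. For $x<x_1$ one has $F(x)=a_lx+b_l$, and for $x>x_n$ one has $F(x)=a_rx+b_r$. The lines $x=x_i$ are the switching lines of the (possibly discontinuous) system. Poincaré disc: $\mathbb R^2$ is identified with the interior of the closed unit disc and the system is extended to the boundary circle $\mathbb S^1$ (the equator, representing infinity). Away from the ends of the $y$-axis one uses coordinates $(v,z)$ with $x=1/z$, $y=v/z$, in which the system becomes $\dot v=1-vzF(1/z)+v^2$, $\dot z=-z^2F(1/z)+zv$, infinity being $z=0$; here $zF(1/z)=a_r+b_rz$ as $z\to0^+$ (right half plane) and $zF(1/z)=a_l+b_lz$ as $z\to0^-$ (left half plane). The point $(v,z)=(k,0)$, approached with $z\to0^+$ (resp. $z\to0^-$), is the endpoint at infinity of $y=kx$, $x\to+\infty$ (resp. $x\to-\infty$). Near the ends of the $y$-axis one uses $x=u/z$, $y=1/z$. Assume that $\mathbb S^1$ is either a closed orbit or a heteroclinic loop formed by finitely many equilibria at infinity, each of which possesses hyperbolic sectors separated by $\mathbb S^1$. Then the infinity is called a center (resp. a focus) if all orbits in an inner neighborhood of $\mathbb S^1$ are periodic (resp. spiral around $\mathbb S^1$ without being closed). An orbit $\Gamma$ is positively (resp. negatively) bounded if its positive (resp. negative) semi-orbit $\{\varphi_t(\mathbf x):t\ge0\}$ (resp. $\{\varphi_t(\mathbf x):t\le0\}$), where $\varphi_t$ is the flow and $\mathbf x\in\Gamma$, lies in a bounded subset of $\mathbb R^2$.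
   Formalization: For a_l>2 the two types are interchanged: the stable node is at the end of y=(a_l-sqrt(a_l^2-4))x/2 and the saddle at the end of y=(a_l+sqrt(a_l^2-4))x/2, since the eigenvalues at slope k are 2k-a_l and k-a_l; as printed the claim is false (e.g. a_l=5/2). *)

theory Defs
  imports "HOL-Analysis.Analysis"
begin

section \<open>Trajectories of the system \<open>x' = F x - y, y' = x\<close>\<close>

text \<open>
  The function \<open>F\<close> may jump, so solutions are taken in the sense of Filippov: \<open>F (x t)\<close> is
  replaced by a selection of the segment spanned by the two one-sided limits of \<open>F\<close> at \<open>x t\<close>
  (a single point wherever \<open>F\<close> is continuous).  The differential inclusion is written in
  integrated form, which amounts to absolute continuity together with the inclusion almost
  everywhere.  Where the switching lines are crossed transversally (in particular near infinity)
  this is the usual concatenation of classical solutions.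
\<close>

definition filippov_set :: "(real \<Rightarrow> real) \<Rightarrow> real \<Rightarrow> real set" where
  "filippov_set F x = closed_segment (Lim (at_left x) F) (Lim (at_right x) F)"

definition trajectory :: "(real \<Rightarrow> real) \<Rightarrow> (real \<Rightarrow> real \<times> real) \<Rightarrow> bool" where
  "trajectory F \<gamma> \<longleftrightarrow>
     (\<exists>g. (\<forall>t. g t \<in> filippov_set F (fst (\<gamma> t))) \<and>
          (\<forall>s t. s \<le> t \<longrightarrow>
             ((\<lambda>\<tau>. (g \<tau> - snd (\<gamma> \<tau>), fst (\<gamma> \<tau>))) has_integral (\<gamma> t - \<gamma> s)) {s..t}))"

definition closed_orbit :: "(real \<Rightarrow> real \<times> real) \<Rightarrow> bool" where
  "closed_orbit \<gamma> \<longleftrightarrow> (\<exists>T>0. \<forall>t. \<gamma> (t + T) = \<gamma> t) \<and> (\<exists>t. \<gamma> t \<noteq> \<gamma> 0)"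

definition positively_bounded :: "(real \<Rightarrow> real \<times> real) \<Rightarrow> bool" where
  "positively_bounded \<gamma> \<longleftrightarrow> bounded (\<gamma> ` {0..})"

definition negatively_bounded :: "(real \<Rightarrow> real \<times> real) \<Rightarrow> bool" where
  "negatively_bounded \<gamma> \<longleftrightarrow> bounded (\<gamma> ` {..0})"


section \<open>The Poincare disc near the equator\<close>

text \<open>
  The plane is identified with the open unit disc by \<open>(x, y) \<mapsto> (x, y) / sqrt (1 + x\<^sup>2 + y\<^sup>2)\<close>, so
  points at infinity are points \<open>p\<close> of the unit circle.  If \<open>fst p \<noteq> 0\<close>, then \<open>x = 1/z, y = v/z\<close>
  are coordinates of the closed disc near \<open>p\<close>; the point \<open>p\<close> itself is \<open>(v, z) = (snd p / fst p, 0)\<close>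
  and the disc is the closed half plane of those \<open>(v, z)\<close> in which \<open>z\<close> is zero or has the sign of
  \<open>fst p\<close>.  For the two remaining points, the ends of the \<open>y\<close>-axis, the coordinates are
  \<open>x = u/z, y = 1/z\<close>, and \<open>z\<close> is zero or has the sign of \<open>snd p\<close>.
  In either case \<open>half_line \<sigma>\<close>, for \<open>\<sigma> \<noteq> 0\<close>, is the range of \<open>z\<close>, and
  the vector field is extended to \<open>z = 0\<close> by one-sided limits in \<open>z\<close>.
\<close>

definition half_line :: "real \<Rightarrow> real set" where
  "half_line \<sigma> = {z. 0 \<le> \<sigma> * z}"

definition scaled :: "(real \<Rightarrow> real) \<Rightarrow> real \<Rightarrow> real \<Rightarrow> real \<Rightarrow> real" where
  "scaled F \<sigma> u z =
     (if z = 0 then Lim (at 0 within half_line \<sigma>) (\<lambda>w. w * F (u / w)) else z * F (u / z))"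

definition field_vz :: "(real \<Rightarrow> real) \<Rightarrow> real \<Rightarrow> real \<times> real \<Rightarrow> real \<times> real" where
  "field_vz F \<sigma> = (\<lambda>(v, z). (1 - v * scaled F \<sigma> 1 z + v\<^sup>2, - z * scaled F \<sigma> 1 z + z * v))"

definition field_uz :: "(real \<Rightarrow> real) \<Rightarrow> real \<Rightarrow> real \<times> real \<Rightarrow> real \<times> real" where
  "field_uz F \<sigma> = (\<lambda>(u, z). (scaled F \<sigma> u z - 1 - u\<^sup>2, - u * z))"

definition equilibria_at_infinity :: "(real \<Rightarrow> real) \<Rightarrow> (real \<times> real) set" where
  "equilibria_at_infinity F =
     {p \<in> sphere 0 1. if fst p \<noteq> 0 then field_vz F (fst p) (snd p / fst p, 0) = 0
                       else field_uz F (snd p) (0, 0) = 0}"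

text \<open>
  The images on the unit circle of the ends of the half-lines \<open>y = k x, x \<rightarrow> \<infinity>\<close> and
  \<open>y = k x, x \<rightarrow> -\<infinity>\<close>.
\<close>

definition right_end :: "real \<Rightarrow> real \<times> real" where
  "right_end k = (1 / sqrt (1 + k\<^sup>2), k / sqrt (1 + k\<^sup>2))"

definition left_end :: "real \<Rightarrow> real \<times> real" where
  "left_end k = (- 1 / sqrt (1 + k\<^sup>2), - k / sqrt (1 + k\<^sup>2))"


section \<open>Topological structure of an equilibrium at infinity\<close>

text \<open>
  \<open>maps_orbits h S G T N\<close>: the map \<open>h\<close> sends arcs of orbits of \<open>G\<close> lying in \<open>S\<close> to arcs of orbits
  of \<open>N\<close> lying in \<open>T\<close>, preserving their orientation; \<open>\<tau>\<close> is the change of time.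
\<close>

definition solution_on ::
  "(real \<times> real \<Rightarrow> real \<times> real) \<Rightarrow> real set \<Rightarrow> (real \<Rightarrow> real \<times> real) \<Rightarrow> bool" where
  "solution_on G I \<gamma> \<longleftrightarrow>
     is_interval I \<and> (\<forall>t\<in>I. (\<gamma> has_vector_derivative G (\<gamma> t)) (at t within I))"

definition maps_orbits ::
  "(real \<times> real \<Rightarrow> real \<times> real) \<Rightarrow> (real \<times> real) set \<Rightarrow> (real \<times> real \<Rightarrow> real \<times> real) \<Rightarrow>
   (real \<times> real) set \<Rightarrow> (real \<times> real \<Rightarrow> real \<times> real) \<Rightarrow> bool" where
  "maps_orbits h S G T N \<longleftrightarrow>
     (\<forall>I \<gamma>. solution_on G I \<gamma> \<and> \<gamma> ` I \<subseteq> S \<longrightarrow>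
        (\<exists>\<tau> \<delta>. continuous_on I \<tau> \<and> strict_mono_on I \<tau> \<and>
               solution_on N (\<tau> ` I) \<delta> \<and> \<delta> ` \<tau> ` I \<subseteq> T \<and>
               (\<forall>t\<in>I. h (\<gamma> t) = \<delta> (\<tau> t))))"

text \<open>Local topological equivalence of \<open>G\<close> on \<open>S\<close> at \<open>p\<close> and \<open>N\<close> on \<open>T\<close> at \<open>q\<close>.\<close>

definition locally_equivalent ::
  "(real \<times> real \<Rightarrow> real \<times> real) \<Rightarrow> (real \<times> real) set \<Rightarrow> real \<times> real \<Rightarrow>
   (real \<times> real \<Rightarrow> real \<times> real) \<Rightarrow> (real \<times> real) set \<Rightarrow> real \<times> real \<Rightarrow> bool" where
  "locally_equivalent G S p N T q \<longleftrightarrow>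
     (\<exists>U V h g. open U \<and> p \<in> U \<and> open V \<and> q \<in> V \<and>
        homeomorphism (U \<inter> S) (V \<inter> T) h g \<and> h p = q \<and>
        maps_orbits h (U \<inter> S) G (V \<inter> T) N \<and> maps_orbits g (V \<inter> T) N (U \<inter> S) G)"

text \<open>
  An equilibrium at infinity lies on the boundary of the disc, and the boundary is invariant.
  Its type is therefore given by a normal form \<open>N\<close> at the origin of the closed half plane
  \<open>w \<ge> 0\<close> with invariant boundary \<open>w = 0\<close>.  (Because the boundary is invariant, orbits cannot
  wind around the equilibrium, so topological equivalence does not confuse nodes with foci.)
  Only points with \<open>fst p \<noteq> 0\<close> are considered: at the ends of the \<open>y\<close>-axis one has \<open>u' = -1\<close>
  for the functions \<open>F\<close> in question, so these are regular points.
\<close>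

definition has_normal_form ::
  "(real \<Rightarrow> real) \<Rightarrow> real \<times> real \<Rightarrow> (real \<times> real \<Rightarrow> real \<times> real) \<Rightarrow> bool" where
  "has_normal_form F p N \<longleftrightarrow>
     p \<in> equilibria_at_infinity F \<and> fst p \<noteq> 0 \<and>
     locally_equivalent (field_vz F (fst p)) (UNIV \<times> half_line (fst p)) (snd p / fst p, 0)
                        N (UNIV \<times> {0..}) (0, 0)"

definition stable_node :: "(real \<Rightarrow> real) \<Rightarrow> real \<times> real \<Rightarrow> bool" where
  "stable_node F p \<longleftrightarrow> has_normal_form F p (\<lambda>(u, w). (- u, - w))"

definition unstable_node :: "(real \<Rightarrow> real) \<Rightarrow> real \<times> real \<Rightarrow> bool" where
  "unstable_node F p \<longleftrightarrow> has_normal_form F p (\<lambda>(u, w). (u, w))"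

text \<open>
  The half of a saddle in \<open>w \<ge> 0\<close>, where the boundary consists of two unstable or of two stable
  separatrices.
\<close>

definition saddle :: "(real \<Rightarrow> real) \<Rightarrow> real \<times> real \<Rightarrow> bool" where
  "saddle F p \<longleftrightarrow>
     has_normal_form F p (\<lambda>(u, w). (u, - w)) \<or> has_normal_form F p (\<lambda>(u, w). (- u, w))"

text \<open>
  The half of a saddle-node in \<open>w \<ge> 0\<close> that has both a parabolic (nodal) and a hyperbolic
  sector; the boundary is the direction of the zero eigenvalue.  The sign of \<open>u\<^sup>2\<close> is immaterial,
  by the reflection \<open>u \<mapsto> - u\<close>.
\<close>

definition saddle_node :: "(real \<Rightarrow> real) \<Rightarrow> real \<times> real \<Rightarrow> bool" where
  "saddle_node F p \<longleftrightarrow>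
     has_normal_form F p (\<lambda>(u, w). (u\<^sup>2, - w)) \<or> has_normal_form F p (\<lambda>(u, w). (u\<^sup>2, w))"


section \<open>Center and focus at infinity\<close>

text \<open>
  The equator is a closed orbit if it carries no equilibrium.  It is a heteroclinic loop of the
  relevant kind if it carries finitely many, each of which has in the disc exactly one hyperbolic
  sector, bounded on both sides by the equator; this is the normal form \<open>(u\<^sup>2 + w\<^sup>2, 0)\<close>.
  The equator then has the same direction on both sides of each equilibrium, hence throughout.
\<close>

definition equator_closed_or_loop :: "(real \<Rightarrow> real) \<Rightarrow> bool" where
  "equator_closed_or_loop F \<longleftrightarrow>
     finite (equilibria_at_infinity F) \<and>
     (\<forall>p \<in> equilibria_at_infinity F. has_normal_form F p (\<lambda>(u, w). (u\<^sup>2 + w\<^sup>2, 0)))"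

text \<open>
  An inner neighbourhood of the equator is, up to shrinking, the exterior of a disc of radius \<open>R\<close>
  in the plane; since trajectories are invariant under time shifts, an orbit meets it iff it has a
  parametrization with \<open>norm (\<gamma> 0) > R\<close>.
\<close>

definition near_infinity ::
  "(real \<Rightarrow> real) \<Rightarrow> ((real \<Rightarrow> real \<times> real) \<Rightarrow> bool) \<Rightarrow> bool" where
  "near_infinity F P \<longleftrightarrow> (\<exists>R>0. \<forall>\<gamma>. trajectory F \<gamma> \<and> norm (\<gamma> 0) > R \<longrightarrow> P \<gamma>)"

definition center_at_infinity :: "(real \<Rightarrow> real) \<Rightarrow> bool" where
  "center_at_infinity F \<longleftrightarrow> equator_closed_or_loop F \<and> near_infinity F closed_orbit"

text \<open>
  As \<open>t \<rightarrow> \<infinity>\<close> the curve approaches the equator and a continuous polar angle \<open>\<theta>\<close> along it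
  diverges to \<open>\<infinity>\<close> or to \<open>-\<infinity>\<close>.
\<close>

definition spirals_to_equator :: "(real \<Rightarrow> real \<times> real) \<Rightarrow> bool" where
  "spirals_to_equator \<gamma> \<longleftrightarrow>
     filterlim (\<lambda>t. norm (\<gamma> t)) at_top at_top \<and>
     (\<exists>\<theta> T. continuous_on {T..} \<theta> \<and>
        (\<forall>t\<ge>T. \<gamma> t = norm (\<gamma> t) *\<^sub>R (cos (\<theta> t), sin (\<theta> t))) \<and>
        (filterlim \<theta> at_top at_top \<or> filterlim \<theta> at_bot at_top))"

definition focus_at_infinity :: "(real \<Rightarrow> real) \<Rightarrow> bool" where
  "focus_at_infinity F \<longleftrightarrow>
     equator_closed_or_loop F \<and>
     near_infinity F (\<lambda>\<gamma>. \<not> closed_orbit \<gamma> \<and>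
        (spirals_to_equator \<gamma> \<or> spirals_to_equator (\<lambda>t. \<gamma> (- t))))"

end

theory Submission
  imports Defs
begin

text \<open>
  Beyond the outermost switching lines the system is affine, and after a shift of \<open>y\<close> it is linear.
  In projective coordinates a linear system is again explicitly solvable, so each equilibrium at
  infinity can be conjugated to its normal form by hand: with the eigenvector slopes \<open>k\<close> and \<open>k'\<close> the
  coordinates \<open>(V - k) / (V - k')\<close> and \<open>z / (V - k')\<close>, where \<open>V = (y - b) / x\<close> and \<open>z = 1 / x\<close>,
  satisfy uncoupled linear equations, and at a double slope the orbits are matched explicitly.

  If there are no equilibria at infinity, orbits near infinity rotate with angular speed bounded
  below, and they cross the strip of switching lines transversally, so that they are unique as long
  as they stay there.  If \<open>F\<close> is even, the reversal \<open>(x, y, t) \<mapsto> (-x, y, -t)\<close> maps an orbit to the orbit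
  through the same point of the \<open>y\<close>-axis, and two consecutive intersections with this axis give a period.
  Otherwise an explicit function, comparable to the distance from the origin, grows along the orbits
  at a positive rate near infinity (up to this reversal); it is built from the complex coordinate
  \<open>w\<close> with \<open>w' = \<lambda> w\<close> of the linear system in either half plane.
\<close>

section \<open>Local topological equivalence\<close>

text \<open>Write g_l and g_r for the growth of ln |w| per radian in the two half planes. Composing
  the two linear half turns from the positive y-axis back to itself multiplies y by exp(\<pi> (g_l +
  g_r)) to leading order, and g_l + g_r has the sign of al + ar. If al + ar = 0, the composition is
  the translation by (br - bl) (1 + exp(\<pi> g_r)), a drift of bounded size. The influence of the
  switching strip must then be shown to fade at infinity, which dictates the shape of the Lyapunov
  function: a weighted modulus plus a multiple of the angle. If the drift vanishes as well, the
  tails of F are mirror images of each other and the strip decides; this is the excluded case. A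
  second obstacle is that trajectories are differentiable only between crossings of switching lines,
  whose number is not known in advance. Differential inequalities are therefore propagated by real
  induction, from each time to a short interval after it. At the equilibria, equivalence is demanded
  of every solution arc and in both directions; explicit solutions provide the changes of
  time.\<close>

lemma solution_on_iff_components:
  "solution_on G I \<gamma> \<longleftrightarrow> is_interval I \<and>
     (\<forall>t\<in>I. ((\<lambda>t. fst (\<gamma> t)) has_real_derivative fst (G (\<gamma> t))) (at t within I) \<and>
            ((\<lambda>t. snd (\<gamma> t)) has_real_derivative snd (G (\<gamma> t))) (at t within I))"
proof -
  have "(\<gamma> has_vector_derivative G (\<gamma> t)) (at t within I) \<longleftrightarrow>
      ((\<lambda>t. fst (\<gamma> t)) has_real_derivative fst (G (\<gamma> t))) (at t within I) \<and>
      ((\<lambda>t. snd (\<gamma> t)) has_real_derivative snd (G (\<gamma> t))) (at t within I)" (is "?L \<longleftrightarrow> ?R") for t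
  proof
    assume ?L
    from bounded_linear.has_vector_derivative[OF bounded_linear_fst this]
      bounded_linear.has_vector_derivative[OF bounded_linear_snd this]
    show ?R by (simp add: has_real_derivative_iff_has_vector_derivative)
  next
    assume ?R
    then have "((\<lambda>t. (fst (\<gamma> t), snd (\<gamma> t))) has_vector_derivative (fst (G (\<gamma> t)), snd (G (\<gamma> t)))) (at t within I)"
      by (intro has_vector_derivative_Pair) (auto simp: has_real_derivative_iff_has_vector_derivative)
    then show ?L by simp
  qed
  then show ?thesis by (auto simp: solution_on_def)
qed

lemma solution_on_PairI:
  assumes "is_interval I"
    and "\<And>t. t \<in> I \<Longrightarrow> (u has_real_derivative fst (G (u t, w t))) (at t within I)"
    and "\<And>t. t \<in> I \<Longrightarrow> (w has_real_derivative snd (G (u t, w t))) (at t within I)"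
  shows "solution_on G I (\<lambda>t. (u t, w t))"
  using assms by (simp add: solution_on_iff_components)

lemma maps_orbitsE:
  assumes "maps_orbits h S G T N" "solution_on G I \<gamma>" "\<gamma> ` I \<subseteq> S"
  obtains \<tau> \<delta> where "continuous_on I \<tau>" "strict_mono_on I \<tau>" "solution_on N (\<tau> ` I) \<delta>"
    "\<delta> ` \<tau> ` I \<subseteq> T" "\<forall>t\<in>I. h (\<gamma> t) = \<delta> (\<tau> t)"
proof -
  have "solution_on G I \<gamma> \<and> \<gamma> ` I \<subseteq> S" using assms(2,3) by (rule conjI)
  from assms(1)[unfolded maps_orbits_def, THEN spec, THEN spec, THEN mp, OF this]
  show thesis by (elim exE conjE) (rule that)
qed

text \<open>The new arc stays in \<open>T\<close> because its points are images under
  \<open>h\<close> of points of \<open>S\<close>; each use has only to produce the change of time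
  and the solution.\<close>

lemma maps_orbitsI:
  assumes "\<And>I \<gamma>. solution_on G I \<gamma> \<Longrightarrow> \<gamma> ` I \<subseteq> S \<Longrightarrow>
     \<exists>\<tau> \<delta>. continuous_on I \<tau> \<and> strict_mono_on I \<tau> \<and> solution_on N (\<tau> ` I) \<delta> \<and>
       (\<forall>t\<in>I. h (\<gamma> t) = \<delta> (\<tau> t))"
    and "h ` S \<subseteq> T"
  shows "maps_orbits h S G T N"
  unfolding maps_orbits_def
proof (intro allI impI, elim conjE)
  fix I \<gamma> assume A: "solution_on G I \<gamma>" "\<gamma> ` I \<subseteq> S"
  obtain \<tau> \<delta> where *: "continuous_on I \<tau>" "strict_mono_on I \<tau>" "solution_on N (\<tau> ` I) \<delta>"
     "\<And>t. t \<in> I \<Longrightarrow> h (\<gamma> t) = \<delta> (\<tau> t)"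
    using assms(1)[OF A] by blast
  have "\<delta> (\<tau> t) \<in> T" if "t \<in> I" for t
    using *(4)[OF that] A(2) assms(2) that by (metis image_subset_iff)
  then have "\<delta> ` \<tau> ` I \<subseteq> T" by blast
  with * show "\<exists>\<tau> \<delta>. continuous_on I \<tau> \<and> strict_mono_on I \<tau> \<and> solution_on N (\<tau> ` I) \<delta> \<and>
     \<delta> ` \<tau> ` I \<subseteq> T \<and> (\<forall>t\<in>I. h (\<gamma> t) = \<delta> (\<tau> t))" by blast
qed

lemma maps_orbits_subset:
  assumes "maps_orbits h S G T N" "S' \<subseteq> S" "h ` S' \<subseteq> T'"
  shows "maps_orbits h S' G T' N"
proof (rule maps_orbitsI)
  fix I \<gamma> assume 1: "solution_on G I \<gamma>" "\<gamma> ` I \<subseteq> S'"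
  show "\<exists>\<tau> \<delta>. continuous_on I \<tau> \<and> strict_mono_on I \<tau> \<and> solution_on N (\<tau> ` I) \<delta> \<and>
       (\<forall>t\<in>I. h (\<gamma> t) = \<delta> (\<tau> t))"
    by (rule maps_orbitsE[OF assms(1) 1(1) subset_trans[OF 1(2) assms(2)]]) (intro exI conjI)
qed fact

lemma maps_orbits_compose:
  assumes 1: "maps_orbits h S G T N" and 2: "maps_orbits k T N R M" and im: "(k \<circ> h) ` S \<subseteq> R"
  shows "maps_orbits (k \<circ> h) S G R M"
proof (rule maps_orbitsI)
  fix I \<gamma> assume A: "solution_on G I \<gamma>" "\<gamma> ` I \<subseteq> S"
  obtain \<tau> \<delta> where *: "continuous_on I \<tau>" "strict_mono_on I \<tau>" "solution_on N (\<tau> ` I) \<delta>"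
     "\<delta> ` \<tau> ` I \<subseteq> T" "\<forall>t\<in>I. h (\<gamma> t) = \<delta> (\<tau> t)"
    by (rule maps_orbitsE[OF 1 A])
  obtain \<tau>' \<delta>' where **: "continuous_on (\<tau> ` I) \<tau>'" "strict_mono_on (\<tau> ` I) \<tau>'"
     "solution_on M (\<tau>' ` \<tau> ` I) \<delta>'" "\<delta>' ` \<tau>' ` \<tau> ` I \<subseteq> R"
     "\<forall>t\<in>\<tau> ` I. k (\<delta> t) = \<delta>' (\<tau>' t)"
    by (rule maps_orbitsE[OF 2 *(3,4)])
  have "continuous_on I (\<tau>' \<circ> \<tau>)" using *(1) **(1) by (intro continuous_on_compose)
  moreover have "strict_mono_on I (\<tau>' \<circ> \<tau>)"
    using *(2) **(2) by (auto simp: strict_mono_on_def)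
  moreover have "(\<tau>' \<circ> \<tau>) ` I = \<tau>' ` \<tau> ` I" by auto
  ultimately show "\<exists>\<tau> \<delta>. continuous_on I \<tau> \<and> strict_mono_on I \<tau> \<and> solution_on M (\<tau> ` I) \<delta> \<and>
     (\<forall>t\<in>I. (k \<circ> h) (\<gamma> t) = \<delta> (\<tau> t))"
    using *(5) **(3,5) by (intro exI[of _ "\<tau>' \<circ> \<tau>"] exI[of _ \<delta>']) simp
qed (use im in auto)

lemma solution_on_field_cong:
  assumes "\<gamma> ` I \<subseteq> S" "\<And>p. p \<in> S \<Longrightarrow> G' p = G p"
  shows "solution_on G' I \<gamma> \<longleftrightarrow> solution_on G I \<gamma>"
  using assms unfolding solution_on_def by (metis image_subset_iff)

text \<open>A conjugacy respects time, so the identity serves as \<open>\<tau>\<close>. This covers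
  the hyperbolic equilibria; the normal form of the saddle-node calls for a genuine change of
  time.\<close>

lemma maps_orbits_conjugacy:
  assumes "\<And>I \<gamma>. solution_on G I \<gamma> \<Longrightarrow> \<gamma> ` I \<subseteq> S \<Longrightarrow> solution_on N I (h \<circ> \<gamma>)" "h ` S \<subseteq> T"
  shows "maps_orbits h S G T N"
proof (rule maps_orbitsI)
  fix I \<gamma> assume "solution_on G I \<gamma>" "\<gamma> ` I \<subseteq> S"
  then show "\<exists>\<tau> \<delta>. continuous_on I \<tau> \<and> strict_mono_on I \<tau> \<and> solution_on N (\<tau> ` I) \<delta> \<and>
      (\<forall>t\<in>I. h (\<gamma> t) = \<delta> (\<tau> t))"
    using assms by (intro exI[of _ "\<lambda>t. t"] exI[of _ "h \<circ> \<gamma>"]) (auto simp: strict_mono_on_def)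
qed fact

text \<open>A homeomorphism maps relatively open sets to relatively open sets, so the image of
  \<open>U' \<inter> S\<close> is again of the form \<open>V' \<inter> T\<close>. This is what
  allows equivalences to be composed and fields to be altered away from the point.\<close>

lemma orbit_homeomorphism_shrink:
  assumes hom: "homeomorphism (U \<inter> S) (V \<inter> T) h g"
    and m1: "maps_orbits h (U \<inter> S) G (V \<inter> T) N" and m2: "maps_orbits g (V \<inter> T) N (U \<inter> S) G"
    and "open V" "open U'" "U' \<subseteq> U"
  obtains V' where "open V'" "V' \<subseteq> V" "homeomorphism (U' \<inter> S) (V' \<inter> T) h g"
    "maps_orbits h (U' \<inter> S) G (V' \<inter> T) N" "maps_orbits g (V' \<inter> T) N (U' \<inter> S) G"
proof -
  have "openin (top_of_set (U \<inter> S)) (U' \<inter> S)"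
    using assms(5,6) by (auto simp: openin_open)
  then have "openin (top_of_set (V \<inter> T)) (h ` (U' \<inter> S))"
    by (rule homeomorphism_imp_open_map[OF hom])
  then obtain W where W: "open W" "h ` (U' \<inter> S) = V \<inter> T \<inter> W" by (auto simp: openin_open)
  define V' where "V' = V \<inter> W"
  have im: "h ` (U' \<inter> S) = V' \<inter> T" using W by (auto simp: V'_def)
  have hom': "homeomorphism (U' \<inter> S) (V' \<inter> T) h g"
    by (rule homeomorphism_of_subsets[OF hom, where T''="V' \<inter> T"]) (use im assms(6) in \<open>auto simp: V'_def\<close>)
  show ?thesis
  proof
    show "open V'" using W(1) assms(4) by (auto simp: V'_def)
    show "V' \<subseteq> V" by (simp add: V'_def)
    show "homeomorphism (U' \<inter> S) (V' \<inter> T) h g" by fact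
    show "maps_orbits h (U' \<inter> S) G (V' \<inter> T) N"
      by (rule maps_orbits_subset[OF m1]) (use assms(6) in blast, simp only: im order_refl)
    show "maps_orbits g (V' \<inter> T) N (U' \<inter> S) G"
      by (rule maps_orbits_subset[OF m2]) (simp only: V'_def, blast, simp only: homeomorphism_image2[OF hom'] order_refl)
  qed
qed

lemma locally_equivalentI:
  assumes "open U" "p \<in> U" "open V" "q \<in> V" "homeomorphism (U \<inter> S) (V \<inter> T) h g" "h p = q"
    "maps_orbits h (U \<inter> S) G (V \<inter> T) N" "maps_orbits g (V \<inter> T) N (U \<inter> S) G"
  shows "locally_equivalent G S p N T q"
  unfolding locally_equivalent_def
  by (rule exI[of _ U], rule exI[of _ V], rule exI[of _ h], rule exI[of _ g]) (intro conjI assms)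

lemma locally_equivalentE:
  assumes "locally_equivalent G S p N T q"
  obtains U V h g where "open U" "p \<in> U" "open V" "q \<in> V"
    "homeomorphism (U \<inter> S) (V \<inter> T) h g" "h p = q"
    "maps_orbits h (U \<inter> S) G (V \<inter> T) N" "maps_orbits g (V \<inter> T) N (U \<inter> S) G"
  using assms unfolding locally_equivalent_def by (elim exE conjE) (rule that)

lemma locally_equivalent_trans:
  assumes "locally_equivalent G S p N T q" "locally_equivalent N T q M R r"
    and "p \<in> S"
  shows "locally_equivalent G S p M R r"
proof -
  obtain U V h g where 1: "open U" "p \<in> U" "open V" "q \<in> V"
     "homeomorphism (U \<inter> S) (V \<inter> T) h g" "h p = q"
     "maps_orbits h (U \<inter> S) G (V \<inter> T) N" "maps_orbits g (V \<inter> T) N (U \<inter> S) G"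
    by (rule locally_equivalentE[OF assms(1)])
  obtain U' V' h' g' where 2: "open U'" "q \<in> U'" "open V'" "r \<in> V'"
     "homeomorphism (U' \<inter> T) (V' \<inter> R) h' g'" "h' q = r"
     "maps_orbits h' (U' \<inter> T) N (V' \<inter> R) M" "maps_orbits g' (V' \<inter> R) M (U' \<inter> T) N"
    by (rule locally_equivalentE[OF assms(2)])
  \<comment> \<open>The two equivalences come with different neighbourhoods of \<open>q\<close>.
    Both are cut down to the intersection: the second one directly, the first one through its
    inverse.\<close>
  have "open (V \<inter> U')" using 1(3) 2(1) by (rule open_Int)
  obtain V2 where V2: "open V2" "V2 \<subseteq> V'" "homeomorphism ((V \<inter> U') \<inter> T) (V2 \<inter> R) h' g'"
    "maps_orbits h' ((V \<inter> U') \<inter> T) N (V2 \<inter> R) M" "maps_orbits g' (V2 \<inter> R) M ((V \<inter> U') \<inter> T) N"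
    by (rule orbit_homeomorphism_shrink[OF 2(5,7,8,3) \<open>open (V \<inter> U')\<close> Int_lower2])
  obtain U2 where U2: "open U2" "U2 \<subseteq> U" "homeomorphism ((V \<inter> U') \<inter> T) (U2 \<inter> S) g h"
    "maps_orbits g ((V \<inter> U') \<inter> T) N (U2 \<inter> S) G" "maps_orbits h (U2 \<inter> S) G ((V \<inter> U') \<inter> T) N"
    by (rule orbit_homeomorphism_shrink[OF homeomorphism_symD[OF 1(5)] 1(8,7,1) \<open>open (V \<inter> U')\<close> Int_lower1])
  have pS: "p \<in> U \<inter> S" using 1(2) assms(3) by simp
  have "g (h p) = p" by (rule homeomorphism_apply1[OF 1(5) pS])
  then have gq: "g q = p" by (simp only: 1(6))
  have "h p \<in> V \<inter> T" using imageI[OF pS, of h] by (simp only: homeomorphism_image1[OF 1(5)])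
  then have qV: "q \<in> V \<inter> U' \<inter> T" using 2(2) unfolding 1(6) by simp
  have p: "p \<in> U2" using imageI[OF qV, of g] unfolding homeomorphism_image1[OF U2(3)] gq by simp
  have r: "r \<in> V2" using imageI[OF qV, of h'] unfolding homeomorphism_image1[OF V2(3)] 2(6) by simp
  have hom: "homeomorphism (U2 \<inter> S) (V2 \<inter> R) (h' \<circ> h) (g \<circ> g')"
    by (rule homeomorphism_compose[OF homeomorphism_symD[OF U2(3)] V2(3)])
  have "maps_orbits (h' \<circ> h) (U2 \<inter> S) G (V2 \<inter> R) M"
    by (rule maps_orbits_compose[OF U2(5) V2(4)]) (simp only: homeomorphism_image1[OF hom] order_refl)
  moreover have "maps_orbits (g \<circ> g') (V2 \<inter> R) M (U2 \<inter> S) G"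
    by (rule maps_orbits_compose[OF V2(5) U2(4)]) (simp only: homeomorphism_image2[OF hom] order_refl)
  moreover have "(h' \<circ> h) p = r" using 1(6) 2(6) by simp
  ultimately show ?thesis using U2(1) V2(1) p r hom by (intro locally_equivalentI)
qed

text \<open>Only the field near \<open>p\<close> matters. In this way \<open>field_vz\<close>, which
  is affine in the sense of \<open>affine_field_vz\<close> for small z only, inherits the types
  found for the latter.\<close>

lemma locally_equivalent_field_cong:
  assumes "locally_equivalent G S p N T q" "open W" "p \<in> W" "p \<in> S"
    and eq: "\<And>x. x \<in> W \<inter> S \<Longrightarrow> G' x = G x"
  shows "locally_equivalent G' S p N T q"
proof -
  obtain U V h g where 1: "open U" "p \<in> U" "open V" "q \<in> V"
     "homeomorphism (U \<inter> S) (V \<inter> T) h g" "h p = q"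
     "maps_orbits h (U \<inter> S) G (V \<inter> T) N" "maps_orbits g (V \<inter> T) N (U \<inter> S) G"
    by (rule locally_equivalentE[OF assms(1)])
  obtain V' where V': "open V'" "V' \<subseteq> V" "homeomorphism ((U \<inter> W) \<inter> S) (V' \<inter> T) h g"
    "maps_orbits h ((U \<inter> W) \<inter> S) G (V' \<inter> T) N" "maps_orbits g (V' \<inter> T) N ((U \<inter> W) \<inter> S) G"
    by (rule orbit_homeomorphism_shrink[OF 1(5,7,8,3) open_Int[OF 1(1) assms(2)] Int_lower1])
  have sol: "solution_on G' I \<gamma> \<longleftrightarrow> solution_on G I \<gamma>" if "\<gamma> ` I \<subseteq> (U \<inter> W) \<inter> S" for I \<gamma>
    by (rule solution_on_field_cong[OF that]) (rule eq, simp)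
  have "maps_orbits h ((U \<inter> W) \<inter> S) G' (V' \<inter> T) N"
  proof (rule maps_orbitsI)
    fix I \<gamma> assume *: "solution_on G' I \<gamma>" "\<gamma> ` I \<subseteq> U \<inter> W \<inter> S"
    show "\<exists>\<tau> \<delta>. continuous_on I \<tau> \<and> strict_mono_on I \<tau> \<and> solution_on N (\<tau> ` I) \<delta> \<and>
       (\<forall>t\<in>I. h (\<gamma> t) = \<delta> (\<tau> t))"
      by (rule maps_orbitsE[OF V'(4) iffD1[OF sol[OF *(2)] *(1)] *(2)]) blast
  qed (simp only: homeomorphism_image1[OF V'(3)] homeomorphism_image2[OF V'(3)] order_refl)
  moreover have "maps_orbits g (V' \<inter> T) N ((U \<inter> W) \<inter> S) G'"
  proof (rule maps_orbitsI)
    fix I \<gamma> assume A: "solution_on N I \<gamma>" "\<gamma> ` I \<subseteq> V' \<inter> T"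
    obtain \<tau> \<delta> where *: "continuous_on I \<tau>" "strict_mono_on I \<tau>" "solution_on G (\<tau> ` I) \<delta>"
      "\<delta> ` \<tau> ` I \<subseteq> U \<inter> W \<inter> S" "\<forall>t\<in>I. g (\<gamma> t) = \<delta> (\<tau> t)"
      by (rule maps_orbitsE[OF V'(5) A])
    from *(1,2,5) iffD2[OF sol[OF *(4)] *(3)]
    show "\<exists>\<tau> \<delta>. continuous_on I \<tau> \<and> strict_mono_on I \<tau> \<and> solution_on G' (\<tau> ` I) \<delta> \<and>
       (\<forall>t\<in>I. g (\<gamma> t) = \<delta> (\<tau> t))" by blast
  qed (simp only: homeomorphism_image1[OF V'(3)] homeomorphism_image2[OF V'(3)] order_refl)
  moreover
  have "h p \<in> h ` ((U \<inter> W) \<inter> S)" using 1(2) assms(3,4) by simp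
  then have "q \<in> V'" unfolding homeomorphism_image1[OF V'(3)] 1(6) by simp
  moreover
  have "open (U \<inter> W)" "p \<in> U \<inter> W" using 1(1,2) assms(2,3) by auto
  ultimately show ?thesis using V'(1,3) 1(6) by (intro locally_equivalentI)
qed

section \<open>Nodes and saddles\<close>

lemma linear_ode_solution:
  fixes f :: "real \<Rightarrow> real"
  assumes "is_interval I" "t0 \<in> I" "t \<in> I"
    and "\<And>t. t \<in> I \<Longrightarrow> (f has_real_derivative k * f t) (at t within I)"
  shows "f t = f t0 * exp (k * (t - t0))"
proof -
  have "((\<lambda>t. f t * exp (- k * t)) has_real_derivative 0) (at t within I)" if "t \<in> I" for t
    by (rule derivative_eq_intros assms(4)[OF that] refl)+ (simp add: algebra_simps)
  then obtain c where "\<And>t. t \<in> I \<Longrightarrow> f t * exp (- k * t) = c"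
    using has_field_derivative_zero_constant[of I "\<lambda>t. f t * exp (- k * t)"] assms(1)
    by (auto simp: is_interval_convex)
  then have "f t * exp (- k * t) = f t0 * exp (- k * t0)" using assms(2,3) by simp
  then have "f t * exp (- k * t) * exp (k * t) = f t0 * exp (- k * t0) * exp (k * t)" by simp
  then show ?thesis by (simp add: mult.assoc flip: exp_add) (simp add: algebra_simps)
qed

lemma has_real_derivative_transform_within_set:
  fixes f g :: "real \<Rightarrow> real"
  assumes "(f has_real_derivative D) (at t within I)" "t \<in> I" "\<And>s. s \<in> I \<Longrightarrow> g s = f s"
  shows "(g has_real_derivative D) (at t within I)"
  using assms unfolding has_field_derivative_def by (metis has_derivative_transform)

text \<open>This is sgn x |x|^c, for c > 0 a homeomorphism of the line that turns solutions of u' =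
  k u into solutions of u' = c k u. The positive and the negative part are kept apart so that
  \<open>powr\<close> sees nonnegative bases only.\<close>

definition signed_powr :: "real \<Rightarrow> real \<Rightarrow> real" where
  "signed_powr c x = max x 0 powr c - max (- x) 0 powr c"

lemma signed_powr_simps [simp]:
  "x \<ge> 0 \<Longrightarrow> signed_powr c x = x powr c" "x \<le> 0 \<Longrightarrow> signed_powr c x = - ((- x) powr c)"
  by (auto simp: signed_powr_def)

lemma signed_powr_inverse:
  assumes "c > 0" shows "signed_powr (1 / c) (signed_powr c x) = x"
  using assms by (cases "x \<ge> 0") (auto simp: powr_powr)

lemma signed_powr_exp_mult: "signed_powr c (x * exp y) = signed_powr c x * exp (c * y)"
proof (cases "x \<ge> 0")
  case False
  then have "x * exp y \<le> 0" by (simp add: mult_nonpos_nonneg)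
  moreover have "(- x * exp y) powr c = (- x) powr c * exp (c * y)"
    using False by (subst powr_mult) (auto simp: exp_powr_real mult.commute)
  ultimately show ?thesis using False by simp
qed (simp add: powr_mult exp_powr_real mult.commute)

lemma continuous_on_signed_powr [continuous_intros]:
  assumes "c > 0" "continuous_on A f" shows "continuous_on A (\<lambda>x. signed_powr c (f x))"
  unfolding signed_powr_def using assms by (intro continuous_intros continuous_on_powr') auto

lemma signed_powr_linear_ode:
  assumes "is_interval I" "t \<in> I" "\<And>t. t \<in> I \<Longrightarrow> (f has_real_derivative k * f t) (at t within I)"
  shows "((\<lambda>t. signed_powr c (f t)) has_real_derivative c * k * signed_powr c (f t)) (at t within I)"
proof (rule has_real_derivative_transform_within_set)
  show "signed_powr c (f s) = signed_powr c (f t) * exp (c * (k * (s - t)))" if "s \<in> I" for s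
    using linear_ode_solution[OF assms(1,2) that assms(3)] by (simp add: signed_powr_exp_mult)
  show "((\<lambda>s. signed_powr c (f t) * exp (c * (k * (s - t)))) has_real_derivative
      c * k * signed_powr c (f t)) (at t within I)"
    by (rule derivative_eq_intros refl)+ simp
qed fact

lemma signed_powr_maps_orbits:
  assumes "c > 0" "d > 0"
  shows "maps_orbits (\<lambda>(u, w). (signed_powr c u, signed_powr d w)) (UNIV \<times> {0..}) (\<lambda>(u, w). (l * u, m * w))
     (UNIV \<times> {0..}) (\<lambda>(u, w). (c * l * u, d * m * w))"
proof (rule maps_orbits_conjugacy)
  fix I \<gamma> assume "solution_on (\<lambda>(u, w). (l * u, m * w)) I \<gamma>"
  then show "solution_on (\<lambda>(u, w). (c * l * u, d * m * w)) I ((\<lambda>(u, w). (signed_powr c u, signed_powr d w)) \<circ> \<gamma>)"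
    by (auto simp: solution_on_iff_components case_prod_beta intro!: signed_powr_linear_ode)
qed auto

text \<open>The topological type depends on the signs of the eigenvalues alone: independent powers
  of the two coordinates multiply them by arbitrary positive factors.\<close>

lemma diagonal_field_rescale:
  assumes "c > 0" "d > 0" "l' = c * l" "m' = d * m"
  shows "locally_equivalent (\<lambda>(u, w). (l * u, m * w)) (UNIV \<times> {0..}) (0, 0)
     (\<lambda>(u, w). (l' * u, m' * w)) (UNIV \<times> {0..}) (0, 0)"
proof (rule locally_equivalentI[where U = UNIV and V = UNIV])
  let ?h = "\<lambda>c d (u, w). (signed_powr c u, signed_powr d w)"
  show "homeomorphism (UNIV \<inter> UNIV \<times> {0..}) (UNIV \<inter> UNIV \<times> {0..}) (?h c d) (?h (1/c) (1/d))"
  proof (rule homeomorphismI)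
    have "continuous_on A (\<lambda>p. (signed_powr c (fst p), signed_powr d (snd p)))" if "c > 0" "d > 0" for c d A
      using that by (intro continuous_intros)
    then show "continuous_on (UNIV \<inter> UNIV \<times> {0..}) (?h c d)"
      "continuous_on (UNIV \<inter> UNIV \<times> {0..}) (?h (1/c) (1/d))"
      using assms by (simp_all add: case_prod_unfold)
    show "?h (1/c) (1/d) (?h c d x) = x" for x
      using signed_powr_inverse assms by (auto simp: case_prod_unfold)
    show "?h c d (?h (1/c) (1/d) x) = x" for x
      using signed_powr_inverse[of "1/c"] signed_powr_inverse[of "1/d"] assms by (auto simp: case_prod_unfold)
  qed auto
  show "maps_orbits (?h c d) (UNIV \<inter> UNIV \<times> {0..}) (\<lambda>(u, w). (l * u, m * w)) (UNIV \<inter> UNIV \<times> {0..})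
     (\<lambda>(u, w). (l' * u, m' * w))"
    using signed_powr_maps_orbits[OF assms(1,2)] assms(3,4) by simp
  show "maps_orbits (?h (1/c) (1/d)) (UNIV \<inter> UNIV \<times> {0..}) (\<lambda>(u, w). (l' * u, m' * w)) (UNIV \<inter> UNIV \<times> {0..})
     (\<lambda>(u, w). (l * u, m * w))"
    using signed_powr_maps_orbits[of "1/c" "1/d" l' m'] assms by simp
qed (use assms in auto)

text \<open>
  The field \<open>field_vz\<close> of an affine function \<open>F x = a * x + b\<close> near \<open>z = 0\<close>.
\<close>

definition affine_field_vz :: "real \<Rightarrow> real \<Rightarrow> real \<times> real \<Rightarrow> real \<times> real" where
  "affine_field_vz a b = (\<lambda>(v, z). (1 - v * (a + b * z) + v\<^sup>2, - z * (a + b * z) + z * v))"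

text \<open>With Q = v - b z one has Q' = (Q - k) (Q - k') and z' = z (Q - k - k'). The Moebius map
  P = (Q - k)/(Q - k') straightens the first equation to P' = (k - k') P. As 1 - P = (k - k')/(Q -
  k'), the logarithmic derivative of z (1 - P) is Q - k - k' - (Q - k) = - k'.\<close>

lemma affine_field_vz_hyperbolic:
  assumes k: "k \<noteq> k'" "k * k' = 1" and \<sigma>: "\<sigma> = 1 \<or> \<sigma> = -1"
  shows "locally_equivalent (affine_field_vz (k + k') b) (UNIV \<times> half_line \<sigma>) (k, 0)
     (\<lambda>(u, w). ((k - k') * u, - k' * w)) (UNIV \<times> {0..}) (0, 0)"
proof (rule locally_equivalentI)
  define G where "G = affine_field_vz (k + k') b"
  \<comment> \<open>The side of the line Q = k' that contains the equilibrium. There 1 - P > 0, so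
    the second coordinate of \<open>h\<close> has the sign of \<sigma> z, and the image is the part
    P < 1 of the half plane.\<close>
  define U where "U = {p. (fst p - b * snd p - k') * (k - k') > (0::real)}"
  define V where "V = {p :: real \<times> real. fst p < 1}"
  define P where "P p = (fst p - b * snd p - k) / (fst p - b * snd p - k')" for p :: "real \<times> real"
  define h where "h p = (P p, \<sigma> * snd p * (1 - P p))" for p
  define q where "q p = (k - k' * fst p) / (1 - fst p)" for p :: "real \<times> real"
  define Z where "Z p = \<sigma> * snd p / (1 - fst p)" for p :: "real \<times> real"
  define g where "g p = (q p + b * Z p, Z p)" for p
  let ?S = "UNIV \<times> half_line \<sigma>" and ?T = "(UNIV \<times> {0..}) :: (real \<times> real) set"
  have \<sigma>\<sigma>: "\<sigma> * (\<sigma> * x) = x" for x using \<sigma> by auto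
  have U: "fst p - b * snd p - k' \<noteq> 0" if "p \<in> U" for p using that by (auto simp: U_def)
  have P1: "1 - P p = (k - k') / (fst p - b * snd p - k')" if "p \<in> U" for p
    using U[OF that] by (simp add: P_def field_simps)
  have P2: "1 - P p > 0" if "p \<in> U" for p
    using that unfolding P1[OF that] U_def by (simp add: zero_less_divide_iff zero_less_mult_iff) linarith
  have hUS: "h p \<in> V \<inter> ?T" if "p \<in> U \<inter> ?S" for p
    using that P2[of p] by (auto simp: V_def h_def half_line_def zero_le_mult_iff)
  have q1: "q p - k' = (k - k') / (1 - fst p)" if "p \<in> V" for p
    using that by (simp add: q_def V_def field_simps)
  have gVT: "g p \<in> U \<inter> ?S" if "p \<in> V \<inter> ?T" for p
  proof -
    have "(q p - k') * (k - k') = (k - k')\<^sup>2 / (1 - fst p)" using that q1 by (simp add: power2_eq_square)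
    then have "(q p - k') * (k - k') > 0" using that k by (simp add: V_def)
    moreover have "\<sigma> * Z p = snd p / (1 - fst p)" by (simp add: Z_def \<sigma>\<sigma>)
    then have "\<sigma> * Z p \<ge> 0" using that by (auto simp: V_def)
    ultimately show ?thesis by (auto simp: g_def U_def half_line_def)
  qed
  have gh: "g (h p) = p" if "p \<in> U" for p
  proof -
    have 1: "1 - P p \<noteq> 0" using P2[OF that] by simp
    have "Z (h p) = snd p" using 1 \<sigma> by (auto simp: Z_def h_def)
    moreover have "q (h p) = fst p - b * snd p"
    proof -
      have "k - k' * P p = (k - k') * (fst p - b * snd p) / (fst p - b * snd p - k')"
        using U[OF that] by (simp add: P_def field_simps)
      then have "(k - k' * P p) = (fst p - b * snd p) * (1 - P p)" using P1[OF that] by simp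
      then show ?thesis using 1 by (simp add: q_def h_def)
    qed
    ultimately show ?thesis by (simp add: g_def prod_eq_iff)
  qed
  have hg: "h (g p) = p" if "p \<in> V" for p
  proof -
    have 1: "1 - fst p \<noteq> 0" using that by (simp add: V_def)
    have "P (g p) = (q p - k) / (q p - k')" by (simp add: P_def g_def)
    also have "q p - k = (k - k') * fst p / (1 - fst p)" using 1 by (simp add: q_def field_simps)
    also have "\<dots> / (q p - k') = fst p" using 1 k by (simp add: q1[OF that])
    finally show ?thesis using 1 \<sigma> by (auto simp: h_def prod_eq_iff g_def Z_def)
  qed
  have hUS': "h ` (U \<inter> ?S) \<subseteq> V \<inter> ?T" and gVT': "g ` (V \<inter> ?T) \<subseteq> U \<inter> ?S"
    using hUS gVT by (simp_all only: image_subset_iff) blast+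
  show "open U" unfolding U_def by (intro open_Collect_less continuous_intros)
  show "open V" unfolding V_def by (intro open_Collect_less continuous_intros)
  show "(k, 0) \<in> U" using k by (simp add: U_def flip: power2_eq_square)
  show "(0, 0) \<in> V" by (simp add: V_def)
  show "h (k, 0) = (0, 0)" by (simp add: h_def P_def)
  show "homeomorphism (U \<inter> ?S) (V \<inter> ?T) h g"
  proof (rule homeomorphismI)
    show "continuous_on (U \<inter> ?S) h" unfolding h_def P_def by (intro continuous_intros) (use U in auto)
    show "continuous_on (V \<inter> ?T) g" unfolding g_def Z_def q_def
      by (intro continuous_intros) (auto simp: V_def)
  qed (use hUS' gVT' gh hg in simp_all)
  show "maps_orbits h (U \<inter> ?S) (affine_field_vz (k + k') b) (V \<inter> ?T) (\<lambda>(u, w). ((k - k') * u, - k' * w))"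
  proof (rule maps_orbits_conjugacy)
    fix I \<gamma> assume sol: "solution_on (affine_field_vz (k + k') b) I \<gamma>" and \<gamma>: "\<gamma> ` I \<subseteq> U \<inter> ?S"
    have \<gamma>U: "\<gamma> t \<in> U" if "t \<in> I" for t using \<gamma> that by blast
    define v where "v = (\<lambda>t. fst (\<gamma> t))"
    define z where "z = (\<lambda>t. snd (\<gamma> t))"
    have I: "is_interval I" using sol by (simp add: solution_on_def)
    have dv: "(v has_real_derivative 1 - v t * (k + k' + b * z t) + (v t)\<^sup>2) (at t within I)"
      and dz: "(z has_real_derivative - z t * (k + k' + b * z t) + z t * v t) (at t within I)" if "t \<in> I" for t
      using sol that by (auto simp: solution_on_iff_components v_def z_def affine_field_vz_def case_prod_unfold)
    have dP: "((\<lambda>t. P (\<gamma> t)) has_real_derivative (k - k') * P (\<gamma> t)) (at t within I)" if "t \<in> I" for t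
    proof -
      have 0: "v t - b * z t - k' \<noteq> 0" using U[OF \<gamma>U[OF that]] by (simp add: v_def z_def)
      define Q where "Q = v t - b * z t"
      have D: "((\<lambda>t. v t - b * z t) has_real_derivative (Q - k) * (Q - k')) (at t within I)"
        by (rule derivative_eq_intros dv[OF that] dz[OF that] refl)+
          (use k(2) in \<open>simp add: Q_def power2_eq_square algebra_simps\<close>)
      have "((\<lambda>t. (v t - b * z t - k) / (v t - b * z t - k')) has_real_derivative
          ((Q - k) * (Q - k') * (Q - k') - (Q - k) * ((Q - k) * (Q - k'))) / ((Q - k') * (Q - k'))) (at t within I)"
        by (rule derivative_eq_intros D refl 0)+ (simp add: Q_def)
      also have "((Q - k) * (Q - k') * (Q - k') - (Q - k) * ((Q - k) * (Q - k'))) / ((Q - k') * (Q - k'))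
          = (k - k') * ((Q - k) / (Q - k'))"
        using 0 by (simp add: Q_def[symmetric] divide_simps) (simp add: algebra_simps)
      finally show ?thesis by (simp add: P_def v_def z_def Q_def)
    qed
    have "((\<lambda>t. \<sigma> * z t * (1 - P (\<gamma> t))) has_real_derivative - k' * (\<sigma> * z t * (1 - P (\<gamma> t)))) (at t within I)"
      if "t \<in> I" for t
    proof -
      have 0: "v t - b * z t - k' \<noteq> 0" using U[OF \<gamma>U[OF that]] by (simp add: v_def z_def)
      define Q where "Q = v t - b * z t"
      have "P (\<gamma> t) = (Q - k) / (Q - k')" by (simp add: P_def Q_def v_def z_def)
      then have Q: "P (\<gamma> t) * (Q - k') = Q - k" using 0 by (simp add: Q_def)
      show ?thesis
      proof (rule derivative_eq_intros dz[OF that] dP[OF that] refl)+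
        have "(- z t * (k + k' + b * z t) + z t * v t) * (1 - P (\<gamma> t)) + (0 - (k - k') * P (\<gamma> t)) * z t
           = z t * ((Q - k - k') * (1 - P (\<gamma> t)) - (k - k') * P (\<gamma> t))"
          by (simp add: Q_def algebra_simps)
        also have "(Q - k - k') * (1 - P (\<gamma> t)) - (k - k') * P (\<gamma> t) = - k' * (1 - P (\<gamma> t))"
          using Q by (simp add: algebra_simps)
        finally show "(0 * z t + (- z t * (k + k' + b * z t) + z t * v t) * \<sigma>) * (1 - P (\<gamma> t)) +
           (0 - (k - k') * P (\<gamma> t)) * (\<sigma> * z t) = - k' * (\<sigma> * z t * (1 - P (\<gamma> t)))"
          by algebra
      qed
    qed
    with dP I show "solution_on (\<lambda>(u, w). ((k - k') * u, - k' * w)) I (h \<circ> \<gamma>)"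
      by (simp add: solution_on_iff_components h_def z_def)
  qed (rule hUS')
  show "maps_orbits g (V \<inter> ?T) (\<lambda>(u, w). ((k - k') * u, - k' * w)) (U \<inter> ?S) (affine_field_vz (k + k') b)"
  proof (rule maps_orbits_conjugacy)
    fix I \<gamma> assume sol: "solution_on (\<lambda>(u, w). ((k - k') * u, - k' * w)) I \<gamma>" and \<gamma>: "\<gamma> ` I \<subseteq> V \<inter> ?T"
    have \<gamma>V: "\<gamma> t \<in> V" if "t \<in> I" for t using \<gamma> that by blast
    define u where "u = (\<lambda>t. fst (\<gamma> t))"
    define w where "w = (\<lambda>t. snd (\<gamma> t))"
    have I: "is_interval I" using sol by (simp add: solution_on_def)
    have du: "(u has_real_derivative (k - k') * u t) (at t within I)"
      and dw: "(w has_real_derivative - k' * w t) (at t within I)" if "t \<in> I" for t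
      using sol that by (auto simp: solution_on_iff_components u_def w_def case_prod_unfold)
    have 0: "1 - u t \<noteq> 0" if "t \<in> I" for t using \<gamma>V[OF that] by (simp add: V_def u_def)
    have dq: "((\<lambda>t. q (\<gamma> t)) has_real_derivative (q (\<gamma> t) - k) * (q (\<gamma> t) - k')) (at t within I)" if "t \<in> I" for t
    proof -
      have "((\<lambda>t. (k - k' * u t) / (1 - u t)) has_real_derivative
         ((- k' * ((k - k') * u t)) * (1 - u t) - (k - k' * u t) * (- ((k - k') * u t))) / ((1 - u t) * (1 - u t))) (at t within I)"
        by (rule derivative_eq_intros du[OF that] refl 0[OF that])+ (simp add: algebra_simps)
      also have "((- k' * ((k - k') * u t)) * (1 - u t) - (k - k' * u t) * (- ((k - k') * u t))) / ((1 - u t) * (1 - u t))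
        = ((k - k' * u t) / (1 - u t) - k) * ((k - k' * u t) / (1 - u t) - k')"
        using 0[OF that] by (simp add: divide_simps) (simp add: algebra_simps)
      finally show ?thesis by (simp add: q_def u_def)
    qed
    have dZ: "((\<lambda>t. Z (\<gamma> t)) has_real_derivative Z (\<gamma> t) * (q (\<gamma> t) - k - k')) (at t within I)" if "t \<in> I" for t
    proof -
      have "((\<lambda>t. \<sigma> * w t / (1 - u t)) has_real_derivative
         (\<sigma> * (- k' * w t) * (1 - u t) - (\<sigma> * w t) * (- ((k - k') * u t))) / ((1 - u t) * (1 - u t))) (at t within I)"
        by (rule derivative_eq_intros du[OF that] dw[OF that] refl 0[OF that])+ (simp add: algebra_simps)
      also have "(\<sigma> * (- k' * w t) * (1 - u t) - (\<sigma> * w t) * (- ((k - k') * u t))) / ((1 - u t) * (1 - u t))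
        = \<sigma> * w t / (1 - u t) * ((k - k' * u t) / (1 - u t) - k - k')"
        using 0[OF that] by (simp add: divide_simps) (simp add: algebra_simps)
      finally show ?thesis by (simp add: q_def u_def Z_def w_def)
    qed
    have dv: "((\<lambda>t. q (\<gamma> t) + b * Z (\<gamma> t)) has_real_derivative 1 - (q (\<gamma> t) + b * Z (\<gamma> t)) * (k + k' + b * Z (\<gamma> t))
         + (q (\<gamma> t) + b * Z (\<gamma> t))\<^sup>2) (at t within I)" if "t \<in> I" for t
      by (rule derivative_eq_intros dq[OF that] dZ[OF that] refl)+ (use k(2) in \<open>simp add: power2_eq_square algebra_simps\<close>)
    have dz: "((\<lambda>t. Z (\<gamma> t)) has_real_derivative - Z (\<gamma> t) * (k + k' + b * Z (\<gamma> t)) +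
         Z (\<gamma> t) * (q (\<gamma> t) + b * Z (\<gamma> t))) (at t within I)" if "t \<in> I" for t
      using dZ[OF that] by (simp add: algebra_simps)
    show "solution_on (affine_field_vz (k + k') b) I (g \<circ> \<gamma>)"
      using dv dz I by (simp add: solution_on_iff_components g_def affine_field_vz_def)
  qed (rule gVT')
qed

section \<open>Saddle-nodes\<close>

lemma mvt_on_interval:
  fixes f :: "real \<Rightarrow> real"
  assumes "is_interval I" "a \<in> I" "b \<in> I" "a < b"
    and "\<And>t. t \<in> I \<Longrightarrow> (f has_real_derivative f' t) (at t within I)"
  obtains x where "x \<in> I" "f b - f a = f' x * (b - a)"
proof -
  have sub: "{a..b} \<subseteq> I"
    using mem_is_interval_1_I[OF assms(1-3)] by (simp add: subset_iff)
  have "(f has_derivative (\<lambda>h. f' x * h)) (at x within {a..b})" if "x \<in> {a..b}" for x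
  proof -
    have "x \<in> I" using that sub by (simp add: subset_iff)
    from assms(5)[OF this] have "(f has_derivative (\<lambda>h. f' x * h)) (at x within I)"
      by (simp only: has_field_derivative_def)
    then show ?thesis by (rule has_derivative_subset[OF _ sub])
  qed
  then have "\<exists>x\<in>{a<..<b}. f b - f a = (\<lambda>h. f' x * h) (b - a)"
    by (intro mvt_simple[OF assms(4)]) simp
  then obtain x where x: "x \<in> {a<..<b}" "f b - f a = f' x * (b - a)" by blast
  have "x \<in> I" using x(1) sub by (simp add: subset_iff)
  from that[OF this x(2)] show thesis .
qed

lemma strict_mono_on_pos_deriv:
  fixes f :: "real \<Rightarrow> real"
  assumes "is_interval I" "\<And>t. t \<in> I \<Longrightarrow> (f has_real_derivative f' t) (at t within I)"
    and "\<And>t. t \<in> I \<Longrightarrow> f' t > 0"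
  shows "strict_mono_on I f"
proof (rule strict_mono_onI)
  fix a b assume "a \<in> I" "b \<in> I" "a < b"
  with mvt_on_interval[OF assms(1) this assms(2)] obtain x where "x \<in> I" "f b - f a = f' x * (b - a)" by blast
  moreover from this have "f' x * (b - a) > 0" using assms(3) \<open>a < b\<close> by simp
  ultimately show "f a < f b" by simp
qed

text \<open>Gronwall's argument: f^2 exp(- 2 C t) does not increase and f^2 exp(2 C t) does not
  decrease. Taken with \<open>k = f\<close> it shows that a bounded solution of q' = q^2 with one
  zero vanishes identically.\<close>

lemma linear_ode_zero:
  fixes f :: "real \<Rightarrow> real"
  assumes I: "is_interval I" "t0 \<in> I" "t \<in> I"
    and d: "\<And>t. t \<in> I \<Longrightarrow> (f has_real_derivative k t * f t) (at t within I)"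
    and k: "\<And>t. t \<in> I \<Longrightarrow> \<bar>k t\<bar> \<le> C" and "f t0 = 0"
  shows "f t = 0"
proof -
  define g where "g c s = (f s)\<^sup>2 * exp (c * s)" for c s
  have dg: "(g c has_real_derivative (2 * k s + c) * g c s) (at s within I)" if "s \<in> I" for c s
    unfolding g_def by (rule derivative_eq_intros d[OF that] refl)+ (simp add: power2_eq_square algebra_simps)
  have g0: "g c t0 = 0" for c by (simp add: g_def assms(6))
  have gp: "g c s \<ge> 0" for c s by (simp add: g_def)
  have "\<exists>c. g c t \<le> 0"
  proof (cases t0 t rule: linorder_cases)
    case less
    obtain x where "x \<in> I" "g (-2*C) t - g (-2*C) t0 = (2 * k x + (-2*C)) * g (-2*C) x * (t - t0)"
      by (rule mvt_on_interval[OF I less dg])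
    moreover have "(2 * k x + (-2*C)) * g (-2*C) x * (t - t0) \<le> 0"
      using k[OF \<open>x \<in> I\<close>] gp[of "-2*C" x] less by (intro mult_nonpos_nonneg) auto
    ultimately show ?thesis using g0[of "-2*C"] by (intro exI[of _ "-2*C"]) simp
  next
    case greater
    obtain x where "x \<in> I" "g (2*C) t0 - g (2*C) t = (2 * k x + 2*C) * g (2*C) x * (t0 - t)"
      by (rule mvt_on_interval[OF I(1,3,2) greater dg])
    moreover have "(2 * k x + 2*C) * g (2*C) x * (t0 - t) \<ge> 0"
      using k[OF \<open>x \<in> I\<close>] gp[of "2*C" x] greater by (intro mult_nonneg_nonneg) auto
    ultimately show ?thesis using g0[of "2*C"] by (intro exI[of _ "2*C"]) simp
  qed (use g0 in auto)
  then show ?thesis by (auto simp: g_def mult_le_0_iff not_le)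
qed

lemma constant_on_interval:
  fixes f :: "real \<Rightarrow> real"
  assumes "is_interval I" "\<And>t. t \<in> I \<Longrightarrow> (f has_real_derivative 0) (at t within I)"
  obtains c where "\<And>t. t \<in> I \<Longrightarrow> f t = c"
  using has_field_derivative_zero_constant[of I f] assms by (auto simp: is_interval_convex)

text \<open>Passing through ln (q^2) / 2 treats both signs of \<open>q\<close> at once.\<close>

lemma DERIV_ln_abs_within [derivative_intros]:
  fixes q :: "real \<Rightarrow> real"
  assumes "(q has_real_derivative D) (at t within I)" "q t \<noteq> 0"
  shows "((\<lambda>t. ln \<bar>q t\<bar>) has_real_derivative D / q t) (at t within I)"
proof -
  have "((\<lambda>t. ln ((q t)\<^sup>2) / 2) has_real_derivative D / q t) (at t within I)"
  proof -
    have "((\<lambda>t. (q t)\<^sup>2) has_real_derivative 2 * q t * D) (at t within I)"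
      by (rule derivative_eq_intros assms(1) refl)+ simp
    from DERIV_cdivide[OF DERIV_chain2[OF DERIV_ln_divide this], of 2]
    have "((\<lambda>t. ln ((q t)\<^sup>2) / 2) has_real_derivative 1 / (q t)\<^sup>2 * (2 * q t * D) / 2) (at t within I)"
      using assms(2) by simp
    moreover have "1 / (q t)\<^sup>2 * (2 * q t * D) / 2 = D / q t"
      using assms(2) by (simp add: power2_eq_square)
    ultimately show ?thesis by simp
  qed
  moreover have "ln ((q t)\<^sup>2) / 2 = ln \<bar>q t\<bar>" for t
  proof -
    have "ln (\<bar>q t\<bar> ^ 2) = 2 * ln \<bar>q t\<bar>" using ln_realpow[of "\<bar>q t\<bar>" 2] by (simp only: of_nat_numeral)
    then show ?thesis unfolding power2_abs by linarith
  qed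
  ultimately show ?thesis by simp
qed

lemma is_interval_continuous_image:
  fixes f :: "real \<Rightarrow> real"
  assumes "is_interval I" "continuous_on I f" shows "is_interval (f ` I)"
  using assms by (simp add: is_interval_connected_1 connected_continuous_image)

text \<open>Both bounds come from |ln x| \<le> 1/x - 1 on (0, 1), the second one with x = sqrt |q|.
  The first keeps the denominator of \<open>sn_map\<close> positive for |q| < 1, the second makes q
  ln |q| continuous at 0.\<close>

lemma abs_mult_ln_abs:
  assumes "q \<noteq> 0" "\<bar>q\<bar> < (1::real)"
  shows "\<bar>ln \<bar>q\<bar>\<bar> \<le> 1 / \<bar>q\<bar> - 1" "\<bar>q * ln \<bar>q\<bar>\<bar> \<le> 2 * sqrt \<bar>q\<bar>"
proof -
  have *: "\<bar>ln x\<bar> \<le> 1 / x - 1" if "0 < x" "x < 1" for x :: real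
    using that ln_le_minus_one[of "1 / x"] by (simp add: ln_div)
  show "\<bar>ln \<bar>q\<bar>\<bar> \<le> 1 / \<bar>q\<bar> - 1" using assms by (intro *) auto
  define s where "s = sqrt \<bar>q\<bar>"
  have s: "0 < s" "s < 1" "s\<^sup>2 = \<bar>q\<bar>" using assms by (auto simp: s_def)
  have "\<bar>q * ln \<bar>q\<bar>\<bar> = s\<^sup>2 * (2 * \<bar>ln s\<bar>)" 
    using s by (simp add: abs_mult ln_realpow flip: s(3))
  also have "\<dots> \<le> s\<^sup>2 * (2 * (1 / s))" using *[OF s(1,2)] s by (intro mult_left_mono) auto
  also have "\<dots> = 2 * s" using s(1) by (simp add: power2_eq_square)
  finally show "\<bar>q * ln \<bar>q\<bar>\<bar> \<le> 2 * sqrt \<bar>q\<bar>" by (simp add: s_def)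
qed

text \<open>
  The field \<open>(q\<^sup>2, w (q - \<epsilon>))\<close>, divided by \<open>1 - \<epsilon> q\<close>, has the first component \<open>q\<^sup>2 / (1 - \<epsilon> q)\<close>
  and the second \<open>- \<epsilon> w\<close>.  Integrating \<open>dq (1 - \<epsilon> q) / q\<^sup>2 = du / u\<^sup>2\<close> gives
  \<open>1 / u = 1 / q + \<epsilon> ln \<bar>q\<bar>\<close>.
\<close>

definition sn_map :: "real \<Rightarrow> real \<Rightarrow> real" where
  "sn_map \<epsilon> q = q / (1 + \<epsilon> * (q * ln \<bar>q\<bar>))"

context
  fixes \<epsilon> :: real assumes \<epsilon>: "\<epsilon> = 1 \<or> \<epsilon> = -1"
begin

lemma sn_map_denominator: "\<bar>q\<bar> < 1 \<Longrightarrow> 1 + \<epsilon> * (q * ln \<bar>q\<bar>) > 0"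
proof (cases "q = 0")
  case False
  assume q: "\<bar>q\<bar> < 1"
  have "\<bar>q * ln \<bar>q\<bar>\<bar> \<le> \<bar>q\<bar> * (1 / \<bar>q\<bar> - 1)"
    unfolding abs_mult using abs_mult_ln_abs[OF False q] by (intro mult_left_mono) auto
  also have "\<dots> < 1" using False by (simp add: algebra_simps)
  finally show ?thesis using \<epsilon> by auto
qed simp

lemma sn_map_0 [simp]: "sn_map \<epsilon> 0 = 0"
  by (simp add: sn_map_def)

lemma sn_map_eq_0_iff: "\<bar>q\<bar> < 1 \<Longrightarrow> sn_map \<epsilon> q = 0 \<longleftrightarrow> q = 0"
  using sn_map_denominator[of q] by (auto simp: sn_map_def)

lemma sn_map_sign: "\<bar>q\<bar> < 1 \<Longrightarrow> sgn (sn_map \<epsilon> q) = sgn q"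
  using sn_map_denominator[of q] by (simp add: sn_map_def sgn_divide)

lemma inverse_sn_map:
  assumes "\<bar>q\<bar> < 1" "q \<noteq> 0"
  shows "1 / sn_map \<epsilon> q = 1 / q + \<epsilon> * ln \<bar>q\<bar>"
  using sn_map_denominator[OF assms(1)] assms(2) by (simp add: sn_map_def add_divide_distrib)

text \<open>The reciprocal of \<open>sn_map \<epsilon> q\<close> has modulus at least 1/|q| - |ln
  |q||, hence at least 1. This supplies the constant \<open>C = 1\<close> when
  \<open>linear_ode_zero\<close> is applied to u' = u^2 in the image coordinate.\<close>

lemma abs_sn_map_le: "\<bar>q\<bar> < 1 \<Longrightarrow> \<bar>sn_map \<epsilon> q\<bar> \<le> 1"
proof (cases "q = 0")
  case False
  assume q: "\<bar>q\<bar> < 1"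
  have "\<bar>1 / q + \<epsilon> * ln \<bar>q\<bar>\<bar> \<ge> \<bar>1 / q\<bar> - \<bar>\<epsilon> * ln \<bar>q\<bar>\<bar>" by linarith
  also have "\<bar>\<epsilon> * ln \<bar>q\<bar>\<bar> = \<bar>ln \<bar>q\<bar>\<bar>" using \<epsilon> by auto
  finally have "\<bar>1 / sn_map \<epsilon> q\<bar> \<ge> 1" using abs_mult_ln_abs(1)[OF False q] inverse_sn_map[OF q False] by simp
  moreover have "\<bar>sn_map \<epsilon> q\<bar> > 0" using False sn_map_eq_0_iff[OF q] by simp
  ultimately show ?thesis by (simp add: abs_divide)
qed simp

text \<open>On either side of 0 the function - 1/q - \<epsilon> ln |q| has the derivative (1 -
  \<epsilon> q)/q^2, which is positive for |q| < 1. Across 0 the reciprocals jump, hence the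
  condition on the product.\<close>

lemma sn_map_reciprocal_mono:
  assumes "0 < a * b" "\<bar>a\<bar> < 1" "\<bar>b\<bar> < 1"
  shows "a < b \<longleftrightarrow> - 1 / sn_map \<epsilon> a < - 1 / sn_map \<epsilon> b"
proof -
  have less: "- 1 / sn_map \<epsilon> a < - 1 / sn_map \<epsilon> b" if "0 < a * b" "\<bar>a\<bar> < 1" "\<bar>b\<bar> < 1" "a < b" for a b
  proof -
    have ab: "a \<noteq> 0" "b \<noteq> 0" using that(1) by auto
    let ?f = "\<lambda>q. - 1 / q - \<epsilon> * ln \<bar>q\<bar>"
    have "strict_mono_on {a..b} ?f"
    proof (rule strict_mono_on_pos_deriv)
      fix t assume t: "t \<in> {a..b}"
      have t0: "t \<noteq> 0" "\<bar>t\<bar> < 1" using t that by (auto simp: zero_less_mult_iff)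
      show "(?f has_real_derivative 1 / t\<^sup>2 - \<epsilon> * (1 / t)) (at t within {a..b})"
        by (rule derivative_eq_intros DERIV_ln_abs_within refl t0)+ (simp add: power2_eq_square)
      have "\<epsilon> * t < 1" using \<epsilon> t0 by auto
      then have "0 < (1 - \<epsilon> * t) / t\<^sup>2" using t0 by simp
      also have "\<dots> = 1 / t\<^sup>2 - \<epsilon> * (1 / t)" using t0 by (simp add: field_simps power2_eq_square)
      finally show "0 < 1 / t\<^sup>2 - \<epsilon> * (1 / t)" .
    qed (simp add: is_interval_cc)
    then have "?f a < ?f b" using that(4) by (auto simp: strict_mono_on_def)
    then show ?thesis using inverse_sn_map[OF that(2) ab(1)] inverse_sn_map[OF that(3) ab(2)] by simp
  qed
  consider "a < b" | "a = b" | "b < a" by linarith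
  then show ?thesis
  proof cases
    case 1
    with less[OF assms 1] show ?thesis by simp
  next
    case 3
    with less[of b a] assms have "- 1 / sn_map \<epsilon> b < - 1 / sn_map \<epsilon> a" by (simp add: mult.commute)
    with 3 show ?thesis by simp
  qed simp
qed

lemma inj_on_sn_map: "inj_on (sn_map \<epsilon>) {-1<..<1}"
proof (rule inj_onI)
  fix a b assume ab: "a \<in> {-1<..<1::real}" "b \<in> {-1<..<1}" and eq: "sn_map \<epsilon> a = sn_map \<epsilon> b"
  then have *: "\<bar>a\<bar> < 1" "\<bar>b\<bar> < 1" by auto
  then have sg: "sgn a = sgn b" using sn_map_sign eq by metis
  show "a = b"
  proof (cases "a = 0")
    case False
    then have "0 < a * b" using sg by (auto simp: sgn_if zero_less_mult_iff split: if_splits)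
    then have "\<not> a < b" "\<not> b < a"
      using sn_map_reciprocal_mono[of a b] sn_map_reciprocal_mono[of b a] * eq by (simp_all add: mult.commute)
    then show ?thesis by simp
  qed (use sg in \<open>simp add: sgn_0_0\<close>)
qed

lemma continuous_on_sn_map: "continuous_on {-1<..<1} (sn_map \<epsilon>)"
proof -
  have "isCont (\<lambda>q::real. q * ln \<bar>q\<bar>) q" if "\<bar>q\<bar> < 1" for q
  proof (cases "q = 0")
    case True
    have lim: "((\<lambda>q::real. 2 * sqrt \<bar>q\<bar>) \<longlongrightarrow> 0) (at 0)" by (rule tendsto_eq_intros refl)+ simp
    have "\<forall>\<^sub>F q::real in at 0. norm (q * ln \<bar>q\<bar>) \<le> 2 * sqrt \<bar>q\<bar>"
      unfolding eventually_at by (rule exI[of _ 1]) (auto simp: abs_mult_ln_abs(2))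
    from tendsto_0_le[OF lim, of "\<lambda>q. q * ln \<bar>q\<bar>" 1] this
    have "((\<lambda>q::real. q * ln \<bar>q\<bar>) \<longlongrightarrow> 0) (at 0)" by (simp add: eventually_mono)
    then show ?thesis using True by (simp add: isCont_def)
  qed (auto intro!: continuous_intros)
  then have "continuous_on {-1<..<1::real} (\<lambda>q. q * ln \<bar>q\<bar>)" by (intro continuous_at_imp_continuous_on) auto
  then have "continuous_on {-1<..<1} (\<lambda>q. q / (1 + \<epsilon> * (q * ln \<bar>q\<bar>)))"
  proof (intro continuous_on_divide continuous_on_add continuous_on_mult_left continuous_on_id continuous_on_const ballI)
    fix q :: real assume "q \<in> {-1<..<1}"
    then have "\<bar>q\<bar> < 1" by auto
    from sn_map_denominator[OF this] show "1 + \<epsilon> * (q * ln \<bar>q\<bar>) \<noteq> 0" by linarith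
  qed
  then show ?thesis by (simp add: sn_map_def[abs_def])
qed

end

text \<open>For k = k' = \<epsilon> the Moebius coordinate degenerates, but q = v - b z - \<epsilon>
  already satisfies q' = q^2, and z' = z (q - \<epsilon>). This change of coordinates is affine, so
  both neighbourhoods are the whole plane.\<close>

lemma affine_field_vz_saddle_node:
  assumes \<epsilon>: "\<epsilon> = 1 \<or> \<epsilon> = -1" and \<sigma>: "\<sigma> = 1 \<or> \<sigma> = -1"
  shows "locally_equivalent (affine_field_vz (2 * \<epsilon>) b) (UNIV \<times> half_line \<sigma>) (\<epsilon>, 0)
     (\<lambda>(q, w). (q\<^sup>2, w * (q - \<epsilon>))) (UNIV \<times> {0..}) (0, 0)"
proof (rule locally_equivalentI[where U = UNIV and V = UNIV])
  define h where "h p = (fst p - b * snd p - \<epsilon>, \<sigma> * snd p)" for p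
  define g where "g p = (fst p + \<epsilon> + b * (\<sigma> * snd p), \<sigma> * snd p)" for p
  let ?S = "UNIV \<inter> UNIV \<times> half_line \<sigma>" and ?T = "UNIV \<inter> (UNIV \<times> {0..}) :: (real \<times> real) set"
  have \<sigma>\<sigma>: "\<sigma> * (\<sigma> * x) = x" for x using \<sigma> by auto
  have \<epsilon>2: "\<epsilon> * \<epsilon> = 1" using \<epsilon> by auto
  have hS: "h ` ?S \<subseteq> ?T" by (rule image_subsetI) (auto simp: h_def half_line_def)
  have gT: "g ` ?T \<subseteq> ?S" by (rule image_subsetI) (auto simp: g_def half_line_def \<sigma>\<sigma>)
  show "homeomorphism ?S ?T h g"
  proof (rule homeomorphismI)
    show "continuous_on ?S h" unfolding h_def by (intro continuous_intros)
    show "continuous_on ?T g" unfolding g_def by (intro continuous_intros)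
    show "g (h p) = p" "h (g p) = p" for p by (simp_all add: g_def h_def \<sigma>\<sigma>)
  qed (fact hS gT)+
  show "maps_orbits h ?S (affine_field_vz (2 * \<epsilon>) b) ?T (\<lambda>(q, w). (q\<^sup>2, w * (q - \<epsilon>)))"
  proof (rule maps_orbits_conjugacy)
    fix I \<gamma> assume sol: "solution_on (affine_field_vz (2 * \<epsilon>) b) I \<gamma>"
    have dv: "((\<lambda>t. fst (\<gamma> t)) has_real_derivative
          1 - fst (\<gamma> t) * (2 * \<epsilon> + b * snd (\<gamma> t)) + (fst (\<gamma> t))\<^sup>2) (at t within I)"
      and dz: "((\<lambda>t. snd (\<gamma> t)) has_real_derivative
          - snd (\<gamma> t) * (2 * \<epsilon> + b * snd (\<gamma> t)) + snd (\<gamma> t) * fst (\<gamma> t)) (at t within I)" if "t \<in> I" for t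
      using sol that by (auto simp: solution_on_iff_components affine_field_vz_def case_prod_unfold)
    have "((\<lambda>t. fst (\<gamma> t) - b * snd (\<gamma> t) - \<epsilon>) has_real_derivative
          (fst (\<gamma> t) - b * snd (\<gamma> t) - \<epsilon>)\<^sup>2) (at t within I)" if "t \<in> I" for t
      by (rule derivative_eq_intros dv[OF that] dz[OF that] refl)+
        (use \<epsilon>2 in \<open>simp add: power2_eq_square algebra_simps\<close>)
    moreover have "((\<lambda>t. \<sigma> * snd (\<gamma> t)) has_real_derivative
          \<sigma> * snd (\<gamma> t) * (fst (\<gamma> t) - b * snd (\<gamma> t) - \<epsilon> - \<epsilon>)) (at t within I)" if "t \<in> I" for t
      by (rule derivative_eq_intros dz[OF that] refl)+ (simp add: algebra_simps)
    ultimately show "solution_on (\<lambda>(q, w). (q\<^sup>2, w * (q - \<epsilon>))) I (h \<circ> \<gamma>)"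
      using sol by (simp add: solution_on_iff_components h_def)
  qed (fact hS)
  show "maps_orbits g ?T (\<lambda>(q, w). (q\<^sup>2, w * (q - \<epsilon>))) ?S (affine_field_vz (2 * \<epsilon>) b)"
  proof (rule maps_orbits_conjugacy)
    fix I \<gamma> assume sol: "solution_on (\<lambda>(q, w). (q\<^sup>2, w * (q - \<epsilon>))) I \<gamma>"
    define u where "u = (\<lambda>t. fst (\<gamma> t))"
    define w where "w = (\<lambda>t. snd (\<gamma> t))"
    have du: "(u has_real_derivative (u t)\<^sup>2) (at t within I)"
      and dw: "(w has_real_derivative w t * (u t - \<epsilon>)) (at t within I)" if "t \<in> I" for t
      using sol that by (auto simp: solution_on_iff_components case_prod_unfold u_def w_def)
    have "((\<lambda>t. u t + \<epsilon> + b * (\<sigma> * w t)) has_real_derivative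
         1 - (u t + \<epsilon> + b * (\<sigma> * w t)) * (2 * \<epsilon> + b * (\<sigma> * w t)) + (u t + \<epsilon> + b * (\<sigma> * w t))\<^sup>2) (at t within I)"
      if "t \<in> I" for t
    proof -
      define c where "c = b * (\<sigma> * w t)"
      have "(u t)\<^sup>2 + c * (u t - \<epsilon>) = 1 - (u t + \<epsilon> + c) * (2 * \<epsilon> + c) + (u t + \<epsilon> + c)\<^sup>2"
        using \<epsilon>2 by (simp add: power2_eq_square algebra_simps)
      moreover have "((\<lambda>t. u t + \<epsilon> + b * (\<sigma> * w t)) has_real_derivative (u t)\<^sup>2 + c * (u t - \<epsilon>)) (at t within I)"
        by (rule derivative_eq_intros du[OF that] dw[OF that] refl)+ (simp add: c_def algebra_simps)
      ultimately show ?thesis by (simp add: c_def)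
    qed
    moreover have "((\<lambda>t. \<sigma> * w t) has_real_derivative
        - (\<sigma> * w t) * (2 * \<epsilon> + b * (\<sigma> * w t)) + \<sigma> * w t * (u t + \<epsilon> + b * (\<sigma> * w t))) (at t within I)" if "t \<in> I" for t
      by (rule derivative_eq_intros dw[OF that] refl)+ (simp add: algebra_simps)
    ultimately show "solution_on (affine_field_vz (2 * \<epsilon>) b) I (g \<circ> \<gamma>)"
      using sol by (simp add: solution_on_iff_components g_def affine_field_vz_def u_def w_def)
  qed (fact gT)
  show "h (\<epsilon>, 0) = (0, 0)" by (simp add: h_def)
qed auto

section \<open>Matching the orbits at a double slope with the normal form\<close>

context
  fixes \<epsilon> :: real assumes \<epsilon>: "\<epsilon> = 1 \<or> \<epsilon> = -1"
begin

text \<open>In the time \<open>\<tau>\<close> with d\<tau>/dt = 1 - \<epsilon> q the second equation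
  becomes w' = - \<epsilon> w, since q - \<epsilon> = - \<epsilon> (1 - \<epsilon> q), and the first
  becomes u' = u^2 for u = \<open>sn_map \<epsilon> q\<close>. Arcs on the invariant line q = 0,
  where the logarithm breaks down, are matched in the original time.\<close>

lemma sn_map_maps_orbits:
  "maps_orbits (\<lambda>p. (sn_map \<epsilon> (fst p), snd p)) ({-1<..<1} \<times> {0..}) (\<lambda>(q, w). (q\<^sup>2, w * (q - \<epsilon>)))
     (sn_map \<epsilon> ` {-1<..<1} \<times> {0..}) (\<lambda>(u, w). (u\<^sup>2, - \<epsilon> * w))"
proof (rule maps_orbitsI)
  fix I \<gamma> assume sol: "solution_on (\<lambda>(q, w). (q\<^sup>2, w * (q - \<epsilon>))) I \<gamma>"
    and im: "\<gamma> ` I \<subseteq> {-1<..<1} \<times> {0..}"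
  define q where "q = (\<lambda>t. fst (\<gamma> t))"
  define w where "w = (\<lambda>t. snd (\<gamma> t))"
  have I: "is_interval I" using sol by (simp add: solution_on_def)
  have dq: "(q has_real_derivative q t * q t) (at t within I)"
    and dw: "(w has_real_derivative w t * (q t - \<epsilon>)) (at t within I)" if "t \<in> I" for t
    using sol that by (auto simp: solution_on_iff_components case_prod_unfold q_def w_def power2_eq_square)
  have q1: "\<bar>q t\<bar> < 1" if "t \<in> I" for t
  proof -
    have "\<gamma> t \<in> {-1<..<1} \<times> {0..}" using im that by (simp add: image_subset_iff)
    then show ?thesis by (auto simp: q_def mem_Times_iff)
  qed
  show "\<exists>\<tau> \<delta>. continuous_on I \<tau> \<and> strict_mono_on I \<tau> \<and> solution_on (\<lambda>(u, w). (u\<^sup>2, - \<epsilon> * w)) (\<tau> ` I) \<delta> \<and>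
      (\<forall>t\<in>I. (sn_map \<epsilon> (fst (\<gamma> t)), snd (\<gamma> t)) = \<delta> (\<tau> t))"
  proof (cases "\<exists>t0\<in>I. q t0 = 0")
    case True
    then obtain t0 where t0: "t0 \<in> I" "q t0 = 0" by blast
    have q0: "q t = 0" if "t \<in> I" for t
      by (rule linear_ode_zero[OF I t0(1) that dq less_imp_le[OF q1] t0(2)])
    have "solution_on (\<lambda>(u, w). (u\<^sup>2, - \<epsilon> * w)) I (\<lambda>t. (0, w t))"
      using dw q0 by (intro solution_on_PairI I) (auto simp: mult.commute)
    moreover have "(sn_map \<epsilon> (fst (\<gamma> t)), snd (\<gamma> t)) = (0, w t)" if "t \<in> I" for t
      using q0[OF that] by (simp add: q_def w_def sn_map_0[OF \<epsilon>])
    ultimately show ?thesis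
      by (intro exI[of _ "\<lambda>t. t"] exI[of _ "\<lambda>t. (0, w t)"]) (simp add: strict_mono_on_def)
  next
    case False
    then have q0: "q t \<noteq> 0" if "t \<in> I" for t using that by blast
    have "((\<lambda>t. - 1 / q t - t) has_real_derivative 0) (at t within I)" if "t \<in> I" for t
      by (rule derivative_eq_intros dq[OF that] q0[OF that] refl)+ (use q0[OF that] in simp)
    from constant_on_interval[OF I this] obtain c where c: "\<And>t. t \<in> I \<Longrightarrow> - 1 / q t - t = c" by blast
    \<comment> \<open>From - 1/q = t + c one gets \<tau> + c = - 1/q - \<epsilon> ln |q| = - 1/u, so
      u is explicit in the new time. The speed 1 - \<epsilon> q is positive because |q| < 1.\<close>
    define \<tau> where "\<tau> t = t - \<epsilon> * ln \<bar>q t\<bar>" for t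
    have d\<tau>: "(\<tau> has_real_derivative 1 - \<epsilon> * q t) (at t within I)" if "t \<in> I" for t
      unfolding \<tau>_def[abs_def]
      by (rule derivative_eq_intros DERIV_ln_abs_within[OF dq[OF that] q0[OF that]] refl)+ (use q0[OF that] in simp)
    have dl: "((\<lambda>t. ln \<bar>q t\<bar> - \<epsilon> * t) has_real_derivative q t - \<epsilon>) (at t within I)" if "t \<in> I" for t
      by (rule derivative_eq_intros DERIV_ln_abs_within[OF dq[OF that] q0[OF that]] refl)+ (use q0[OF that] in simp)
    have "((\<lambda>t. w t * exp (- (ln \<bar>q t\<bar> - \<epsilon> * t))) has_real_derivative 0) (at t within I)" if "t \<in> I" for t
      by (rule dw[OF that] dl[OF that] derivative_eq_intros refl)+ (simp add: algebra_simps)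
    from constant_on_interval[OF I this] obtain K where
      K: "\<And>t. t \<in> I \<Longrightarrow> w t * exp (- (ln \<bar>q t\<bar> - \<epsilon> * t)) = K" by blast
    have w: "w t = K * exp (- \<epsilon> * \<tau> t)" if "t \<in> I" for t
    proof -
      have "\<epsilon> * \<tau> t = - (ln \<bar>q t\<bar> - \<epsilon> * t)" using \<epsilon> by (auto simp: \<tau>_def)
      then have "K = w t * exp (\<epsilon> * \<tau> t)" using K[OF that] by simp
      then show ?thesis by (simp add: mult.assoc flip: exp_add)
    qed
    have u: "sn_map \<epsilon> (q t) = - 1 / (\<tau> t + c)" "\<tau> t + c \<noteq> 0" if "t \<in> I" for t
    proof -
      have "1 / sn_map \<epsilon> (q t) = - (\<tau> t + c)"
        using inverse_sn_map[OF \<epsilon> q1[OF that] q0[OF that]] c[OF that] by (simp add: \<tau>_def)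
      moreover have "1 / sn_map \<epsilon> (q t) \<noteq> 0" using sn_map_eq_0_iff[OF \<epsilon> q1[OF that]] q0[OF that] by simp
      ultimately show "\<tau> t + c \<noteq> 0" by linarith
      have "sn_map \<epsilon> (q t) = 1 / (1 / sn_map \<epsilon> (q t))" by simp
      also have "\<dots> = - 1 / (\<tau> t + c)" unfolding \<open>1 / sn_map \<epsilon> (q t) = - (\<tau> t + c)\<close>
        by (metis minus_divide_left minus_divide_right)
      finally show "sn_map \<epsilon> (q t) = - 1 / (\<tau> t + c)" .
    qed
    have cont: "continuous_on I \<tau>"
      by (rule DERIV_continuous_on) (rule d\<tau>)
    have mono: "strict_mono_on I \<tau>"
    proof (rule strict_mono_on_pos_deriv[OF I d\<tau>])
      show "0 < 1 - \<epsilon> * q t" if "t \<in> I" for t using q1[OF that] \<epsilon> by auto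
    qed
    define \<delta> where "\<delta> s = (- 1 / (s + c), K * exp (- \<epsilon> * s))" for s
    have "solution_on (\<lambda>(u, w). (u\<^sup>2, - \<epsilon> * w)) (\<tau> ` I) \<delta>"
      unfolding \<delta>_def[abs_def]
    proof (rule solution_on_PairI)
      show "is_interval (\<tau> ` I)" by (rule is_interval_continuous_image[OF I cont])
      fix s assume "s \<in> \<tau> ` I"
      then have s: "s + c \<noteq> 0" using u(2) by blast
      show "((\<lambda>s. - 1 / (s + c)) has_real_derivative
         fst (case (- 1 / (s + c), K * exp (- \<epsilon> * s)) of (u, w) \<Rightarrow> (u\<^sup>2, - \<epsilon> * w))) (at s within \<tau> ` I)"
        by (rule derivative_eq_intros refl s)+ (simp add: power2_eq_square)
      show "((\<lambda>s. K * exp (- \<epsilon> * s)) has_real_derivative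
         snd (case (- 1 / (s + c), K * exp (- \<epsilon> * s)) of (u, w) \<Rightarrow> (u\<^sup>2, - \<epsilon> * w))) (at s within \<tau> ` I)"
        by (rule derivative_eq_intros refl)+ simp
    qed
    moreover have "(sn_map \<epsilon> (fst (\<gamma> t)), snd (\<gamma> t)) = \<delta> (\<tau> t)" if "t \<in> I" for t
      using u(1)[OF that] w[OF that] by (simp add: \<delta>_def q_def w_def)
    ultimately show ?thesis using cont mono by blast
  qed
next
  show "(\<lambda>p. (sn_map \<epsilon> (fst p), snd p)) ` ({-1<..<1} \<times> {0::real..}) \<subseteq> sn_map \<epsilon> ` {-1<..<1} \<times> {0..}"
    by auto
qed

text \<open>Differentiating the inverse \<open>g\<close> is avoided. The arc q = - 1/s, w = K exp(-
  \<epsilon> s - ln |s|) solves the target system, and \<tau> = - 1/q is its time. It is enough that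
  \<open>\<tau>\<close> is continuous and strictly increasing, which follows from \<open>hom\<close>
  and \<open>sn_map_reciprocal_mono\<close>.\<close>

lemma sn_map_inverse_maps_orbits:
  assumes hom: "homeomorphism {-1<..<1} (sn_map \<epsilon> ` {-1<..<1}) (sn_map \<epsilon>) g"
  shows "maps_orbits (\<lambda>p. (g (fst p), snd p)) (sn_map \<epsilon> ` {-1<..<1} \<times> {0..}) (\<lambda>(u, w). (u\<^sup>2, - \<epsilon> * w))
     ({-1<..<1} \<times> {0..}) (\<lambda>(q, w). (q\<^sup>2, w * (q - \<epsilon>)))"
proof (rule maps_orbitsI)
  fix I \<gamma> assume sol: "solution_on (\<lambda>(u, w). (u\<^sup>2, - \<epsilon> * w)) I \<gamma>"
    and im: "\<gamma> ` I \<subseteq> sn_map \<epsilon> ` {-1<..<1} \<times> {0..}"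
  define u where "u = (\<lambda>t. fst (\<gamma> t))"
  define w where "w = (\<lambda>t. snd (\<gamma> t))"
  have I: "is_interval I" using sol by (simp add: solution_on_def)
  have du: "(u has_real_derivative u t * u t) (at t within I)"
    and dw: "(w has_real_derivative - \<epsilon> * w t) (at t within I)" if "t \<in> I" for t
    using sol that by (auto simp: solution_on_iff_components case_prod_unfold u_def w_def power2_eq_square)
  define q where "q t = g (u t)" for t
  have uJ: "u t \<in> sn_map \<epsilon> ` {-1<..<1}" if "t \<in> I" for t
  proof -
    have "\<gamma> t \<in> sn_map \<epsilon> ` {-1<..<1} \<times> {0..}" using im that by (simp only: image_subset_iff)
    then show ?thesis by (simp add: u_def mem_Times_iff)
  qed
  have uq: "u t = sn_map \<epsilon> (q t)" if "t \<in> I" for t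
    using homeomorphism_apply2[OF hom uJ[OF that]] by (simp add: q_def)
  have q1: "\<bar>q t\<bar> < 1" if "t \<in> I" for t
  proof -
    have "g (u t) \<in> {-1<..<1}" using imageI[OF uJ[OF that], of g] by (simp only: homeomorphism_image2[OF hom])
    then show ?thesis by (auto simp: q_def)
  qed
  show "\<exists>\<tau> \<delta>. continuous_on I \<tau> \<and> strict_mono_on I \<tau> \<and> solution_on (\<lambda>(q, w). (q\<^sup>2, w * (q - \<epsilon>))) (\<tau> ` I) \<delta> \<and>
      (\<forall>t\<in>I. (g (fst (\<gamma> t)), snd (\<gamma> t)) = \<delta> (\<tau> t))"
  proof (cases "\<exists>t0\<in>I. u t0 = 0")
    case True
    then obtain t0 where t0: "t0 \<in> I" "u t0 = 0" by blast
    have u1: "\<bar>u t\<bar> \<le> 1" if "t \<in> I" for t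
      using abs_sn_map_le[OF \<epsilon> q1[OF that]] uq[OF that] by simp
    have u0: "u t = 0" if "t \<in> I" for t
      by (rule linear_ode_zero[OF I t0(1) that du u1 t0(2)])
    have q0: "q t = 0" if "t \<in> I" for t
      using u0[OF that] uq[OF that] sn_map_eq_0_iff[OF \<epsilon> q1[OF that]] by simp
    have "solution_on (\<lambda>(q, w). (q\<^sup>2, w * (q - \<epsilon>))) I (\<lambda>t. (0, w t))"
      using dw by (intro solution_on_PairI I) (auto simp: mult.commute)
    moreover have "(g (fst (\<gamma> t)), snd (\<gamma> t)) = (0, w t)" if "t \<in> I" for t
      using q0[OF that] by (simp add: q_def w_def u_def)
    ultimately show ?thesis
      by (intro exI[of _ "\<lambda>t. t"] exI[of _ "\<lambda>t. (0, w t)"]) (simp add: strict_mono_on_def)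
  next
    case False
    then have u0: "u t \<noteq> 0" if "t \<in> I" for t using that by blast
    have q0: "q t \<noteq> 0" if "t \<in> I" for t
      using u0[OF that] uq[OF that] by (auto simp: sn_map_0[OF \<epsilon>])
    have "((\<lambda>t. - 1 / u t - t) has_real_derivative 0) (at t within I)" if "t \<in> I" for t
      by (rule derivative_eq_intros du[OF that] u0[OF that] refl)+ (use u0[OF that] in simp)
    from constant_on_interval[OF I this] obtain c where c: "\<And>t. t \<in> I \<Longrightarrow> - 1 / u t - t = c" by blast
    have "((\<lambda>t. w t * exp (\<epsilon> * t)) has_real_derivative 0) (at t within I)" if "t \<in> I" for t
      by (rule dw[OF that] derivative_eq_intros refl)+ simp
    from constant_on_interval[OF I this] obtain C where C: "\<And>t. t \<in> I \<Longrightarrow> w t * exp (\<epsilon> * t) = C" by blast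
    have cont_u: "continuous_on I u" by (rule DERIV_continuous_on) (rule du)
    have cont_q: "continuous_on I q"
      unfolding q_def[abs_def] using uJ by (intro continuous_on_compose2[OF homeomorphism_cont2[OF hom] cont_u]) blast
    define \<tau> where "\<tau> t = - 1 / q t" for t
    have cont: "continuous_on I \<tau>" unfolding \<tau>_def[abs_def]
      using cont_q q0 by (intro continuous_intros) auto
    \<comment> \<open>\<open>sn_map_reciprocal_mono\<close> compares points on one side of 0 only.
      If q changed sign along the arc, it would pass through 0.\<close>
    have same_sign: "0 < q s * q t" if "s \<in> I" "t \<in> I" for s t
    proof (rule ccontr)
      assume neg: "\<not> 0 < q s * q t"
      have iq: "is_interval (q ` I)" by (rule is_interval_continuous_image[OF I cont_q])
      have "0 \<in> q ` I"
      proof (cases "q s \<le> 0")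
        case True
        then have "q t \<ge> 0" using neg q0 that by (smt (verit) mult_neg_neg)
        then show ?thesis using mem_is_interval_1_I[OF iq, of "q s" "q t" 0] True that by blast
      next
        case False
        then have "q t \<le> 0" using neg by (smt (verit) mult_pos_pos)
        then show ?thesis using mem_is_interval_1_I[OF iq, of "q t" "q s" 0] False that by simp
      qed
      then show False using q0 by force
    qed
    have mono: "strict_mono_on I \<tau>"
    proof (rule strict_mono_onI)
      fix s t assume st: "s \<in> I" "t \<in> I" "s < t"
      have "- 1 / u s < - 1 / u t" using c[OF st(1)] c[OF st(2)] st(3) by linarith
      then have "q s < q t"
        using sn_map_reciprocal_mono[OF \<epsilon> same_sign[OF st(1,2)] q1[OF st(1)] q1[OF st(2)]] uq st by simp
      then show "\<tau> s < \<tau> t" using same_sign[OF st(1,2)] by (auto simp: \<tau>_def field_simps zero_less_mult_iff)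
    qed
    \<comment> \<open>Since t = \<tau> - \<epsilon> ln |q| - c, expressing C exp(- \<epsilon> t) in
      the time \<tau> leaves the constant factor exp(\<epsilon> c).\<close>
    define K where "K = C * exp (\<epsilon> * c)"
    have w: "w t = K * exp (- \<epsilon> * \<tau> t - ln \<bar>\<tau> t\<bar>)" if "t \<in> I" for t
    proof -
      have "ln \<bar>\<tau> t\<bar> = - ln \<bar>q t\<bar>" using q0[OF that] by (simp add: \<tau>_def ln_div abs_divide)
      moreover have "t = \<tau> t - \<epsilon> * ln \<bar>q t\<bar> - c"
        using c[OF that] inverse_sn_map[OF \<epsilon> q1[OF that] q0[OF that]] uq[OF that] by (simp add: \<tau>_def)
      then have "\<epsilon> * t = \<epsilon> * (\<tau> t - \<epsilon> * ln \<bar>q t\<bar> - c)" by simp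
      then have "\<epsilon> * t = \<epsilon> * \<tau> t - ln \<bar>q t\<bar> - \<epsilon> * c" using \<epsilon> by auto
      ultimately have "- (\<epsilon> * t) = \<epsilon> * c + (- \<epsilon> * \<tau> t - ln \<bar>\<tau> t\<bar>)" by simp
      moreover have "w t = C * exp (- (\<epsilon> * t))" using C[OF that] by (auto simp: exp_minus field_simps)
      ultimately show ?thesis by (simp only: K_def exp_add mult.assoc)
    qed
    define \<delta> where "\<delta> s = (- 1 / s, K * exp (- \<epsilon> * s - ln \<bar>s\<bar>))" for s
    have "solution_on (\<lambda>(q, w). (q\<^sup>2, w * (q - \<epsilon>))) (\<tau> ` I) \<delta>"
      unfolding \<delta>_def[abs_def]
    proof (rule solution_on_PairI)
      show "is_interval (\<tau> ` I)" by (rule is_interval_continuous_image[OF I cont])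
      fix s assume "s \<in> \<tau> ` I"
      then have s: "s \<noteq> 0" using q0 by (auto simp: \<tau>_def)
      show "((\<lambda>s. - 1 / s) has_real_derivative
         fst (case (- 1 / s, K * exp (- \<epsilon> * s - ln \<bar>s\<bar>)) of (q, w) \<Rightarrow> (q\<^sup>2, w * (q - \<epsilon>)))) (at s within \<tau> ` I)"
        by (rule derivative_eq_intros refl s)+ (simp add: power2_eq_square)
      have dl: "((\<lambda>s. ln \<bar>s\<bar>) has_real_derivative 1 / s) (at s within \<tau> ` I)"
        by (rule DERIV_ln_abs_within[OF DERIV_ident s])
      show "((\<lambda>s. K * exp (- \<epsilon> * s - ln \<bar>s\<bar>)) has_real_derivative
         snd (case (- 1 / s, K * exp (- \<epsilon> * s - ln \<bar>s\<bar>)) of (q, w) \<Rightarrow> (q\<^sup>2, w * (q - \<epsilon>)))) (at s within \<tau> ` I)"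
        by (rule dl derivative_eq_intros refl)+ (simp add: algebra_simps)
    qed
    moreover have "(g (fst (\<gamma> t)), snd (\<gamma> t)) = \<delta> (\<tau> t)" if "t \<in> I" for t
      using w[OF that] by (simp add: \<delta>_def q_def w_def u_def \<tau>_def)
    ultimately show ?thesis using cont mono by blast
  qed
next
  have "g x \<in> {-1<..<1}" if "x \<in> sn_map \<epsilon> ` {-1<..<1}" for x
    using imageI[OF that, of g] by (simp only: homeomorphism_image2[OF hom])
  then show "(\<lambda>p. (g (fst p), snd p)) ` (sn_map \<epsilon> ` {-1<..<1} \<times> {0::real..}) \<subseteq> {-1<..<1} \<times> {0..}"
    by (intro image_subsetI) (simp add: mem_Times_iff)
qed

text \<open>A continuous injective function on an open interval is a homeomorphism onto an open
  image. This replaces a formula for the inverse of \<open>sn_map\<close>.\<close>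

lemma saddle_node_normal_form:
  "locally_equivalent (\<lambda>(q, w). (q\<^sup>2, w * (q - \<epsilon>))) (UNIV \<times> {0..}) (0, 0)
     (\<lambda>(u, w). (u\<^sup>2, - \<epsilon> * w)) (UNIV \<times> {0..}) (0, 0)"
proof -
  let ?J = "sn_map \<epsilon> ` {-1<..<1}"
  obtain g where hom: "homeomorphism {-1<..<1} ?J (sn_map \<epsilon>) g"
    using injective_into_1d_eq_homeomorphism[OF continuous_on_sn_map[OF \<epsilon>]] inj_on_sn_map[OF \<epsilon>]
    by (auto simp: convex_imp_path_connected)
  have J: "open ?J"
    by (rule injective_into_1d_imp_open_map_UNIV[OF open_greaterThanLessThan continuous_on_sn_map[OF \<epsilon>]
        inj_on_sn_map[OF \<epsilon>] order_refl])
  have eq: "({-1<..<1} \<times> UNIV) \<inter> (UNIV \<times> {0..}) = {-1<..<1::real} \<times> {0::real..}"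
    "(?J \<times> UNIV) \<inter> (UNIV \<times> {0..}) = ?J \<times> {0::real..}" by auto
  show ?thesis
  proof (rule locally_equivalentI[where U = "{-1<..<1} \<times> UNIV" and V = "?J \<times> UNIV"
        and h = "\<lambda>p. (sn_map \<epsilon> (fst p), snd p)" and g = "\<lambda>p. (g (fst p), snd p)"], unfold eq)
    show "open ({-1<..<1::real} \<times> (UNIV :: real set))" "open (?J \<times> (UNIV :: real set))"
      using J by (auto intro!: open_Times)
    show "(0, 0) \<in> {-1<..<1::real} \<times> (UNIV :: real set)" by simp
    show "(0, 0) \<in> ?J \<times> (UNIV :: real set)"
      using imageI[of 0 "{-1<..<1}" "sn_map \<epsilon>"] by (simp add: sn_map_0[OF \<epsilon>])
    show "(sn_map \<epsilon> (fst (0, 0)), snd (0, 0)) = (0, 0)" by (simp add: sn_map_0[OF \<epsilon>])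
    show "homeomorphism ({-1<..<1} \<times> {0::real..}) (?J \<times> {0::real..}) (\<lambda>p. (sn_map \<epsilon> (fst p), snd p)) (\<lambda>p. (g (fst p), snd p))"
    proof (rule homeomorphismI)
      show "continuous_on ({-1<..<1} \<times> {0::real..}) (\<lambda>p. (sn_map \<epsilon> (fst p), snd p))"
        by (intro continuous_on_Pair continuous_on_compose2[OF continuous_on_sn_map[OF \<epsilon>]] continuous_intros) auto
      show "continuous_on (?J \<times> {0::real..}) (\<lambda>p. (g (fst p), snd p))"
        by (intro continuous_on_Pair continuous_on_compose2[OF homeomorphism_cont2[OF hom]] continuous_intros) auto
      show "(\<lambda>p. (sn_map \<epsilon> (fst p), snd p)) ` ({-1<..<1} \<times> {0::real..}) \<subseteq> ?J \<times> {0..}" by auto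
      have "g x \<in> {-1<..<1}" if "x \<in> ?J" for x
        using imageI[OF that, of g] by (simp only: homeomorphism_image2[OF hom])
      then show "(\<lambda>p. (g (fst p), snd p)) ` (?J \<times> {0::real..}) \<subseteq> {-1<..<1} \<times> {0..}"
        by (intro image_subsetI) (simp add: mem_Times_iff)
    qed (use homeomorphism_apply1[OF hom] homeomorphism_apply2[OF hom] in \<open>simp_all add: mem_Times_iff prod_eq_iff\<close>)
  qed (fact sn_map_maps_orbits sn_map_inverse_maps_orbits[OF hom])+
qed

end

section \<open>The equilibria at infinity\<close>

lemma half_line_sgn: "half_line (sgn x) = half_line x"
  by (cases x "0::real" rule: linorder_cases) (auto simp: half_line_def zero_le_mult_iff sgn_if)

lemma at_within_half_line_neq_bot:
  assumes "\<sigma> \<noteq> 0" shows "at 0 within half_line \<sigma> \<noteq> bot"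
proof -
  have "at 0 within half_line \<sigma> = (if \<sigma> > 0 then at_right 0 else at_left 0)"
    by (cases "\<sigma> > 0") (use assms in \<open>auto simp: at_within_def half_line_def zero_le_mult_iff
       intro!: arg_cong[where f = "\<lambda>S. inf (nhds 0) (principal S)"]\<close>)
  then show ?thesis by simp
qed

text \<open>Half-plane \<open>\<sigma> = 1\<close> is the right one, \<open>\<sigma> = -1\<close> the left one.\<close>

definition end_at :: "real \<Rightarrow> real \<Rightarrow> real \<times> real" where
  "end_at \<sigma> k = (\<sigma> / sqrt (1 + k\<^sup>2), \<sigma> * k / sqrt (1 + k\<^sup>2))"

lemma end_at_eqs: "end_at 1 k = right_end k" "end_at (-1) k = left_end k"
  by (simp_all add: end_at_def right_end_def left_end_def)

locale affine_tail =
  fixes F :: "real \<Rightarrow> real" and \<sigma> a b X :: real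
  assumes \<sigma>: "\<sigma> = 1 \<or> \<sigma> = -1" and X: "X > 0" and tail: "\<And>x. \<sigma> * x > X \<Longrightarrow> F x = a * x + b"
begin

lemma z_times_F:
  assumes "z \<noteq> 0" "\<bar>z\<bar> < 1 / X" "0 \<le> \<sigma> * z"
  shows "z * F (1 / z) = a + b * z"
proof -
  have "\<sigma> * (1 / z) = 1 / \<bar>z\<bar>" using assms(1,3) \<sigma> by auto
  moreover have "X < 1 / \<bar>z\<bar>" using assms X by (simp add: field_simps)
  ultimately have "F (1 / z) = a * (1 / z) + b" using tail[of "1 / z"] by simp
  then show ?thesis using assms(1) by (simp add: field_simps)
qed

lemma scaled_at_0:
  assumes "sgn s = \<sigma>" shows "scaled F s 1 0 = a"
proof -
  have s: "s \<noteq> 0" and hl: "half_line s = half_line \<sigma>" using assms \<sigma> half_line_sgn[of s] by auto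
  have ev: "\<forall>\<^sub>F w in at 0 within half_line s. a + b * w = w * F (1 / w)"
    unfolding eventually_at hl using X z_times_F
    by (intro exI[of _ "1 / X"]) (auto simp: half_line_def)
  have "((\<lambda>w. a + b * w) \<longlongrightarrow> a + b * 0) (at 0 within half_line s)"
    by (intro tendsto_intros)
  from Lim_transform_eventually[OF this ev]
  have "((\<lambda>w. w * F (1 / w)) \<longlongrightarrow> a) (at 0 within half_line s)" by simp
  then show ?thesis using tendsto_Lim[OF at_within_half_line_neq_bot[OF s]] by (simp add: scaled_def)
qed

text \<open>On the equator the field is defined by a limit. It agrees there with the affine formula,
  so a single polynomial field describes the system on both the boundary and a neighbourhood of it
  inside the disc.\<close>

lemma field_vz_affine:
  assumes "sgn s = \<sigma>" "z \<in> half_line s" "\<bar>z\<bar> < 1 / X"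
  shows "field_vz F s (v, z) = affine_field_vz a b (v, z)"
proof -
  have "z \<in> half_line \<sigma>" using assms half_line_sgn[of s] by auto
  then have "scaled F s 1 z = a + b * z"
    using scaled_at_0[OF assms(1)] z_times_F[of z] assms(3)
    by (cases "z = 0") (auto simp: scaled_def half_line_def)
  then show ?thesis by (simp add: field_vz_def affine_field_vz_def)
qed

lemma end_at_simps:
  "sgn (fst (end_at \<sigma> k)) = \<sigma>" "fst (end_at \<sigma> k) \<noteq> 0" "snd (end_at \<sigma> k) / fst (end_at \<sigma> k) = k"
  "norm (end_at \<sigma> k) = 1"
proof -
  have pos: "1 + k\<^sup>2 > 0" by (rule add_pos_nonneg) simp_all
  show "sgn (fst (end_at \<sigma> k)) = \<sigma>" "fst (end_at \<sigma> k) \<noteq> 0" "snd (end_at \<sigma> k) / fst (end_at \<sigma> k) = k"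
    using pos \<sigma> by (auto simp: end_at_def sgn_divide)
  have "(\<sigma> / sqrt (1 + k\<^sup>2))\<^sup>2 + (\<sigma> * k / sqrt (1 + k\<^sup>2))\<^sup>2 = (1 + k\<^sup>2) / (1 + k\<^sup>2)"
    using pos \<sigma> by (auto simp: power_divide simp flip: add_divide_distrib)
  then show "norm (end_at \<sigma> k) = 1" using pos
    by (simp only: end_at_def norm_Pair real_norm_def power2_abs) simp
qed

lemma end_at_slope:
  assumes "norm p = 1" "sgn (fst p) = \<sigma>" shows "p = end_at \<sigma> (snd p / fst p)"
proof -
  obtain x y where p: "p = (x, y)" by fastforce
  have x: "x \<noteq> 0" "\<bar>x\<bar> = \<sigma> * x" using assms \<sigma> by (auto simp: p sgn_if split: if_splits)
  have "x\<^sup>2 + y\<^sup>2 = 1" using assms(1) by (simp add: p norm_Pair)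
  then have "1 + (y / x)\<^sup>2 = (1 / x)\<^sup>2" using x by (simp add: field_simps)
  then have "sqrt (1 + (y / x)\<^sup>2) = 1 / (\<sigma> * x)" using x by simp
  then show ?thesis using x(1) \<sigma> by (auto simp: p end_at_def)
qed

lemma end_at_equilibrium_iff:
  "end_at \<sigma> k \<in> equilibria_at_infinity F \<longleftrightarrow> 1 - k * a + k\<^sup>2 = 0"
proof -
  have "field_vz F (fst (end_at \<sigma> k)) (k, 0) = affine_field_vz a b (k, 0)"
    using X by (intro field_vz_affine end_at_simps) (auto simp: half_line_def)
  moreover have "affine_field_vz a b (k, 0) = 0 \<longleftrightarrow> 1 - k * a + k\<^sup>2 = 0"
    by (simp add: affine_field_vz_def zero_prod_def)
  ultimately show ?thesis by (simp add: equilibria_at_infinity_def end_at_simps)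
qed

lemma equilibria_eq:
  "{p \<in> equilibria_at_infinity F. sgn (fst p) = \<sigma>} = end_at \<sigma> ` {k. 1 - k * a + k\<^sup>2 = 0}" (is "?L = ?R")
proof (intro equalityI subsetI)
  fix p :: "real \<times> real" assume p: "p \<in> ?L"
  then have "norm p = 1" by (auto simp: equilibria_at_infinity_def)
  then have "p = end_at \<sigma> (snd p / fst p)" using p end_at_slope by simp
  then show "p \<in> ?R" using p end_at_equilibrium_iff[of "snd p / fst p"] by auto
next
  fix p :: "real \<times> real" assume "p \<in> ?R"
  then obtain k where "p = end_at \<sigma> k" "1 - k * a + k\<^sup>2 = 0" by blast
  then show "p \<in> ?L" using end_at_equilibrium_iff[of k] end_at_simps(1)[of k] by simp
qed

lemma normal_form_end_at:
  assumes k: "1 - k * a + k\<^sup>2 = 0"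
    and eq: "locally_equivalent (affine_field_vz a b) (UNIV \<times> half_line \<sigma>) (k, 0) N (UNIV \<times> {0..}) (0, 0)"
  shows "has_normal_form F (end_at \<sigma> k) N"
proof -
  let ?s = "fst (end_at \<sigma> k)"
  have hl: "half_line ?s = half_line \<sigma>" using half_line_sgn[of ?s] end_at_simps(1) by simp
  have "locally_equivalent (field_vz F ?s) (UNIV \<times> half_line \<sigma>) (k, 0) N (UNIV \<times> {0..}) (0, 0)"
  \<comment> \<open>On the side of \<open>\<sigma>\<close>, |z| < 1/X with z not 0 means \<sigma> x
    > X, where F is affine.\<close>
  proof (rule locally_equivalent_field_cong[OF eq, where W = "UNIV \<times> {- (1 / X)<..<1 / X}"])
    fix p :: "real \<times> real" assume p: "p \<in> (UNIV \<times> {- (1 / X)<..<1 / X}) \<inter> (UNIV \<times> half_line \<sigma>)"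
    have "\<bar>snd p\<bar> < 1 / X" "snd p \<in> half_line ?s" using p by (auto simp: mem_Times_iff hl)
    from field_vz_affine[OF end_at_simps(1) this(2,1), of "fst p"]
    show "field_vz F ?s p = affine_field_vz a b p" by simp
  qed (use X in \<open>auto intro!: open_Times simp: half_line_def\<close>)
  then show ?thesis
    unfolding has_normal_form_def using k end_at_equilibrium_iff end_at_simps(2,3) hl by simp
qed

lemma normal_form_hyperbolic:
  assumes "k \<noteq> k'" "k * k' = 1" "k + k' = a"
  shows "has_normal_form F (end_at \<sigma> k) (\<lambda>(u, w). (sgn (k - k') * u, sgn (- k') * w))"
proof (rule normal_form_end_at)
  have "k' \<noteq> 0" using assms by auto
  then have "locally_equivalent (\<lambda>(u, w). ((k - k') * u, - k' * w)) (UNIV \<times> {0..}) (0, 0)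
     (\<lambda>(u, w). (sgn (k - k') * u, sgn (- k') * w)) (UNIV \<times> {0..}) (0, 0)"
    using assms(1) by (intro diagonal_field_rescale[of "1 / \<bar>k - k'\<bar>" "1 / \<bar>k'\<bar>"]) (simp_all add: real_sgn_eq)
  then show "locally_equivalent (affine_field_vz a b) (UNIV \<times> half_line \<sigma>) (k, 0)
     (\<lambda>(u, w). (sgn (k - k') * u, sgn (- k') * w)) (UNIV \<times> {0..}) (0, 0)"
    using locally_equivalent_trans[OF affine_field_vz_hyperbolic[OF assms(1,2) \<sigma>]] assms(3)
    by (simp add: half_line_def)
  have "1 - k * (k + k') + k\<^sup>2 = 1 - k * k'" by (simp add: power2_eq_square algebra_simps)
  then show "1 - k * a + k\<^sup>2 = 0" using assms by simp
qed

text \<open>At slope k the eigenvalue along the equator is k - k' and the transversal one is - k'.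
  Neither depends on the side \<open>\<sigma>\<close>: for positive slopes the node is at the
  smaller one in both half planes, for negative slopes at the larger one.\<close>

lemma node_saddle:
  assumes "k < k'" "k * k' = 1" "k + k' = a"
  shows "k > 0 \<and> k' > 0 \<Longrightarrow> stable_node F (end_at \<sigma> k) \<and> saddle F (end_at \<sigma> k')"
    and "k < 0 \<and> k' < 0 \<Longrightarrow> unstable_node F (end_at \<sigma> k') \<and> saddle F (end_at \<sigma> k)"
proof -
  have n1: "has_normal_form F (end_at \<sigma> k) (\<lambda>(u, w). (sgn (k - k') * u, sgn (- k') * w))"
    by (rule normal_form_hyperbolic) (use assms in simp_all)
  have n2: "has_normal_form F (end_at \<sigma> k') (\<lambda>(u, w). (sgn (k' - k) * u, sgn (- k) * w))"
    by (rule normal_form_hyperbolic) (use assms in \<open>simp_all add: mult.commute add.commute\<close>)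
  show "stable_node F (end_at \<sigma> k) \<and> saddle F (end_at \<sigma> k')" if "k > 0 \<and> k' > 0"
    using n1 n2 assms(1) that unfolding stable_node_def saddle_def by simp
  show "unstable_node F (end_at \<sigma> k') \<and> saddle F (end_at \<sigma> k)" if "k < 0 \<and> k' < 0"
    using n1 n2 assms(1) that unfolding unstable_node_def saddle_def by simp
qed

section \<open>Two distinct real slopes\<close>

context
  assumes a: "\<bar>a\<bar> > 2"
begin

abbreviation "k\<^sub>1 \<equiv> (a - sqrt (a\<^sup>2 - 4)) / 2"
abbreviation "k\<^sub>2 \<equiv> (a + sqrt (a\<^sup>2 - 4)) / 2"

lemma discriminant_pos: "a\<^sup>2 - 4 > 0"
  using a abs_le_square_iff[of a 2] by simp

lemma root_facts: "k\<^sub>1 < k\<^sub>2" "k\<^sub>1 * k\<^sub>2 = 1" "k\<^sub>1 + k\<^sub>2 = a"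
proof -
  show "k\<^sub>1 < k\<^sub>2" "k\<^sub>1 + k\<^sub>2 = a" using discriminant_pos by (auto simp: field_simps)
  have "(a - s) / 2 * ((a + s) / 2) = (a\<^sup>2 - s\<^sup>2) / 4" for s by (simp add: power2_eq_square field_simps)
  then show "k\<^sub>1 * k\<^sub>2 = 1" using discriminant_pos by simp
qed

lemma root_signs: "a > 2 \<Longrightarrow> k\<^sub>1 > 0 \<and> k\<^sub>2 > 0" "a < -2 \<Longrightarrow> k\<^sub>1 < 0 \<and> k\<^sub>2 < 0"
proof -
  have p: "k\<^sub>1 * k\<^sub>2 > 0" using root_facts(2) by simp
  assume "a > 2"
  then have "k\<^sub>2 > 0" using discriminant_pos by (simp add: add_pos_nonneg)
  then show "k\<^sub>1 > 0 \<and> k\<^sub>2 > 0" using p zero_less_mult_pos2 by blast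
next
  have p: "k\<^sub>1 * k\<^sub>2 > 0" using root_facts(2) by simp
  assume "a < -2"
  then have "a - sqrt (a\<^sup>2 - 4) < 0" using real_sqrt_gt_zero[OF discriminant_pos] by linarith
  then have "k\<^sub>1 < 0" by simp
  then show "k\<^sub>1 < 0 \<and> k\<^sub>2 < 0" using p by (auto simp: zero_less_mult_iff)
qed

lemma equilibria_hyperbolic:
  "{p \<in> equilibria_at_infinity F. sgn (fst p) = \<sigma>} = {end_at \<sigma> k\<^sub>1, end_at \<sigma> k\<^sub>2}"
proof -
  have 1: "1 - k * a + k\<^sup>2 = (k - k\<^sub>1) * (k - k\<^sub>2)" for k
  proof -
    have "(k - k\<^sub>1) * (k - k\<^sub>2) = k\<^sup>2 - k * (k\<^sub>1 + k\<^sub>2) + k\<^sub>1 * k\<^sub>2"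
      by (simp add: power2_eq_square algebra_simps)
    then show ?thesis unfolding root_facts(2,3) by simp
  qed
  have "1 - k * a + k\<^sup>2 = 0 \<longleftrightarrow> k = k\<^sub>1 \<or> k = k\<^sub>2" for k
    unfolding 1 by (simp only: mult_eq_0_iff right_minus_eq)
  then have "{k. 1 - k * a + k\<^sup>2 = 0} = {k\<^sub>1, k\<^sub>2}" by blast
  then show ?thesis unfolding equilibria_eq by (simp only: image_insert image_empty)
qed

lemma hyperbolic_types:
  "a > 2 \<Longrightarrow> stable_node F (end_at \<sigma> k\<^sub>1) \<and> saddle F (end_at \<sigma> k\<^sub>2)"
  "a < -2 \<Longrightarrow> unstable_node F (end_at \<sigma> k\<^sub>2) \<and> saddle F (end_at \<sigma> k\<^sub>1)"
  by (rule node_saddle[OF root_facts] root_signs | assumption)+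

end

lemma equilibria_saddle_node:
  assumes a: "a = 2 * \<epsilon>" and \<epsilon>: "\<epsilon> = 1 \<or> \<epsilon> = -1"
  shows "{p \<in> equilibria_at_infinity F. sgn (fst p) = \<sigma>} = {end_at \<sigma> \<epsilon>}" "saddle_node F (end_at \<sigma> \<epsilon>)"
proof -
  have \<epsilon>2: "\<epsilon> * \<epsilon> = 1" using \<epsilon> by auto
  have "1 - k * a + k\<^sup>2 = (k - \<epsilon>)\<^sup>2" for k
    using \<epsilon>2 by (simp add: a power2_eq_square algebra_simps)
  then have "{k. 1 - k * a + k\<^sup>2 = 0} = {\<epsilon>}" by auto
  then show "{p \<in> equilibria_at_infinity F. sgn (fst p) = \<sigma>} = {end_at \<sigma> \<epsilon>}" unfolding equilibria_eq by simp
  have "has_normal_form F (end_at \<sigma> \<epsilon>) (\<lambda>(u, w). (u\<^sup>2, - \<epsilon> * w))"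
  proof (rule normal_form_end_at)
    show "locally_equivalent (affine_field_vz a b) (UNIV \<times> half_line \<sigma>) (\<epsilon>, 0)
        (\<lambda>(u, w). (u\<^sup>2, - \<epsilon> * w)) (UNIV \<times> {0..}) (0, 0)"
      unfolding a
      by (rule locally_equivalent_trans[OF affine_field_vz_saddle_node[OF \<epsilon> \<sigma>] saddle_node_normal_form[OF \<epsilon>]])
        (simp add: half_line_def)
    show "1 - \<epsilon> * a + \<epsilon>\<^sup>2 = 0" using \<epsilon>2 by (simp add: a power2_eq_square)
  qed
  then show "saddle_node F (end_at \<sigma> \<epsilon>)" using \<epsilon> unfolding saddle_node_def by auto
qed

lemma equilibria_none:
  assumes "\<bar>a\<bar> < 2" shows "{p \<in> equilibria_at_infinity F. sgn (fst p) = \<sigma>} = {}"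
proof -
  have 1: "1 - k * a + k\<^sup>2 = (k - a / 2)\<^sup>2 + (1 - (a / 2)\<^sup>2)" for k
    by (simp add: power2_eq_square field_simps)
  have "(a / 2)\<^sup>2 < 1" using assms abs_square_less_1[of "a / 2"] by simp
  then have "1 - k * a + k\<^sup>2 \<noteq> 0" for k
    unfolding 1 using zero_le_power2[of "k - a / 2"] by linarith
  then have "{k. 1 - k * a + k\<^sup>2 = 0} = {}" by blast
  then show ?thesis unfolding equilibria_eq by simp
qed

end

text \<open>For u = 0 the argument u/w of F is constantly 0, so w F(u/w) tends to 0 and u' =
  -1.\<close>

lemma no_equilibria_on_y_axis: "{p \<in> equilibria_at_infinity F. fst p = 0} = {}"
proof -
  have *: "field_uz F (snd p) (0, 0) \<noteq> 0" if "p \<in> sphere 0 1" "fst p = 0" for p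
  proof -
    have "p \<noteq> 0" using that by auto
    then have "snd p \<noteq> 0" using that(2) by (simp add: prod_eq_iff)
    moreover have "((\<lambda>w. w * F 0) \<longlongrightarrow> 0 * F 0) (at 0 within half_line (snd p))"
      by (intro tendsto_intros)
    then have "((\<lambda>w. w * F (0 / w)) \<longlongrightarrow> 0) (at 0 within half_line (snd p))" by simp
    ultimately have "scaled F (snd p) 0 0 = 0"
      using tendsto_Lim[OF at_within_half_line_neq_bot] by (simp add: scaled_def)
    then show ?thesis by (simp add: field_uz_def zero_prod_def)
  qed
  have False if "p \<in> equilibria_at_infinity F" "fst p = 0" for p
  proof -
    from that have "p \<in> sphere 0 1" "field_uz F (snd p) (0, 0) = 0"
      by (simp_all add: equilibria_at_infinity_def)
    with * that(2) show False by blast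
  qed
  then show ?thesis by blast
qed

section \<open>Trajectories\<close>

text \<open>Real induction: a closed property that extends a little to the right of each time up to
  which it holds reaches the end of the interval. It suits trajectories across switching lines,
  which are described only on a short interval after each time.\<close>

lemma real_interval_induct:
  fixes a b :: real
  assumes "a \<le> b" "Q a" and cl: "closed {t \<in> {a..b}. Q t}"
    and step: "\<And>t. a \<le> t \<Longrightarrow> t < b \<Longrightarrow> (\<And>r. r \<in> {a..t} \<Longrightarrow> Q r) \<Longrightarrow> \<exists>\<epsilon>>0. \<forall>s. t < s \<and> s < t + \<epsilon> \<and> s \<le> b \<longrightarrow> Q s"
    and t: "t \<in> {a..b}"
  shows "Q t"
proof -
  define S where "S = {t \<in> {a..b}. \<forall>r\<in>{a..t}. Q r}"
  define m where "m = Sup S"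
  have aS: "a \<in> S" using assms(1,2) by (simp add: S_def)
  have bdd: "bdd_above S" by (rule bdd_aboveI[of _ b]) (simp add: S_def)
  have m: "a \<le> m" "m \<le> b"
    unfolding m_def using aS bdd cSup_upper[OF aS bdd] by (auto intro!: cSup_least simp: S_def)
  have below: "Q r" if r: "a \<le> r" "r < m" for r
  proof -
    obtain u where "u \<in> S" "r < u" using less_cSupD[of S r] aS r(2) by (auto simp: m_def)
    then show ?thesis using r(1) by (simp add: S_def)
  qed
  have Qm: "Q m"
  proof (cases "m = a")
    case False
    have "m \<in> closure {a..<m}" using False m by simp
    also have "\<dots> \<subseteq> closure {t \<in> {a..b}. Q t}"
      by (rule closure_mono) (use below m in auto)
    finally show ?thesis using cl by simp
  qed (use assms in simp)
  have all: "Q r" if "r \<in> {a..m}" for r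
    using below[of r] Qm that by (cases "r = m") auto
  have "m = b"
  proof (rule ccontr)
    assume "m \<noteq> b"
    then have "m < b" using m by simp
    from step[OF m(1) this all] obtain \<epsilon> where \<epsilon>: "\<epsilon> > 0" "\<And>s. m < s \<Longrightarrow> s < m + \<epsilon> \<Longrightarrow> s \<le> b \<Longrightarrow> Q s" by blast
    define s where "s = min b (m + \<epsilon> / 2)"
    have s: "m < s" "s < m + \<epsilon>" "s \<le> b" using \<epsilon>(1) \<open>m < b\<close> by (auto simp: s_def min_def)
    have "Q r" if "r \<in> {a..s}" for r
      using that s \<epsilon>(2)[of r] all[of r] by (cases "r \<le> m") auto
    then have "s \<in> S" using s m by (simp add: S_def)
    then have "s \<le> m" unfolding m_def by (rule cSup_upper[OF _ bdd])
    then show False using s by simp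
  qed
  then show ?thesis using all t by simp
qed

lemma right_deriv_lower_bound:
  fixes f :: "real \<Rightarrow> real"
  assumes "a \<le> b" and cont: "continuous_on {a..b} f"
    and d: "\<And>t. a \<le> t \<Longrightarrow> t < b \<Longrightarrow>
      \<exists>\<epsilon>>0. \<forall>s. t < s \<and> s < t + \<epsilon> \<and> s < b \<longrightarrow> (\<exists>D\<ge>c. (f has_real_derivative D) (at s))"
  shows "f a + c * (b - a) \<le> f b"
proof -
  define Q where "Q t = (f a + c * (t - a) \<le> f t)" for t
  have "Q b"
  proof (rule real_interval_induct[where a = a and b = b])
    show "closed {t \<in> {a..b}. Q t}" unfolding Q_def
      by (rule continuous_on_closed_Collect_le) (intro continuous_intros cont, rule cont, simp)
    fix t assume t: "a \<le> t" "t < b" and Q: "\<And>r. r \<in> {a..t} \<Longrightarrow> Q r"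
    from d[OF t] obtain \<epsilon> where \<epsilon>: "\<epsilon> > 0"
      "\<And>s. t < s \<Longrightarrow> s < t + \<epsilon> \<Longrightarrow> s < b \<Longrightarrow> \<exists>D\<ge>c. (f has_real_derivative D) (at s)" by blast
    have "Q s" if s: "t < s" "s < t + \<epsilon>" "s \<le> b" for s
    proof -
      have "continuous_on {t..s} f" using cont by (rule continuous_on_subset) (use t s in auto)
      moreover have "f differentiable (at r)" if "t < r" "r < s" for r
        using \<epsilon>(2)[of r] that s real_differentiable_def by (meson less_trans less_le_trans)
      ultimately obtain l z where z: "t < z" "z < s" "DERIV f z :> l" "f s - f t = (s - t) * l"
        using MVT[OF s(1)] by blast
      obtain D where D: "D \<ge> c" "DERIV f z :> D" using \<epsilon>(2)[of z] z s by auto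
      have "l = D" using z(3) D(2) by (rule DERIV_unique)
      then have "f s - f t \<ge> (s - t) * c" using z(4) D(1) s(1) by simp
      moreover have "f a + c * (t - a) \<le> f t" using Q[of t] t by (simp add: Q_def)
      ultimately show ?thesis by (simp add: Q_def algebra_simps)
    qed
    then show "\<exists>\<epsilon>>0. \<forall>s. t < s \<and> s < t + \<epsilon> \<and> s \<le> b \<longrightarrow> Q s" using \<epsilon>(1) by blast
  qed (use assms(1) in \<open>auto simp: Q_def\<close>)
  then show ?thesis by (simp add: Q_def)
qed

lemma trajectory_continuous:
  assumes "trajectory F \<gamma>" shows "continuous_on UNIV \<gamma>"
proof -
  obtain g where g: "\<And>s t. s \<le> t \<Longrightarrow>
      ((\<lambda>\<tau>. (g \<tau> - snd (\<gamma> \<tau>), fst (\<gamma> \<tau>))) has_integral (\<gamma> t - \<gamma> s)) {s..t}"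
    using assms unfolding trajectory_def by blast
  define f where "f \<tau> = (g \<tau> - snd (\<gamma> \<tau>), fst (\<gamma> \<tau>))" for \<tau>
  have "isCont \<gamma> t" for t
  proof -
    have "f integrable_on {t - 1..t + 1}" using g[of "t - 1" "t + 1"] by (auto simp: f_def[abs_def])
    then have "continuous_on {t - 1..t + 1} (\<lambda>s. \<gamma> (t - 1) + integral {t - 1..s} f)"
      by (intro continuous_intros indefinite_integral_continuous_1)
    moreover have "\<gamma> (t - 1) + integral {t - 1..s} f = \<gamma> s" if "s \<in> {t - 1..t + 1}" for s
      using integral_unique[OF g[of "t - 1" s]] that by (simp add: f_def[abs_def])
    then have "continuous_on {t - 1..t + 1} (\<lambda>s. \<gamma> (t - 1) + integral {t - 1..s} f) \<longleftrightarrow>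
        continuous_on {t - 1..t + 1} \<gamma>" by (intro continuous_on_cong refl)
    ultimately have "continuous_on {t - 1..t + 1} \<gamma>" by simp
    then show ?thesis by (rule continuous_on_interior) simp
  qed
  then show ?thesis by (simp add: continuous_at_imp_continuous_on)
qed

lemma closed_segment_real_abs_le:
  fixes a b :: real
  assumes "\<bar>a\<bar> \<le> M" "\<bar>b\<bar> \<le> M" "g \<in> closed_segment a b" shows "\<bar>g\<bar> \<le> M"
proof -
  have "closed_segment a b \<subseteq> cball 0 M" using assms(1,2) by (intro closed_segment_subset) auto
  then show ?thesis using assms(3) by auto
qed

lemma tendsto_affine_at_side:
  assumes "\<forall>\<^sub>F u in at x within S. F u = p * u + (q :: real)"
  shows "(F \<longlongrightarrow> p * x + q) (at x within S)"
proof -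
  have "((\<lambda>u. p * u + q) \<longlongrightarrow> p * x + q) (at x within S)" by (intro tendsto_intros)
  moreover have "\<forall>\<^sub>F u in at x within S. p * u + q = F u" using assms by (rule eventually_mono) simp
  ultimately show ?thesis by (rule Lim_transform_eventually)
qed

lemma filippov_set_affine:
  assumes "\<forall>\<^sub>F u in at x. F u = p * u + (q :: real)"
  shows "filippov_set F x = {p * x + q}"
proof -
  have "Lim (at_left x) F = p * x + q" "Lim (at_right x) F = p * x + q"
    using assms by (auto intro!: tendsto_Lim tendsto_affine_at_side simp: eventually_at_split)
  then show ?thesis by (simp add: filippov_set_def)
qed

text \<open>Where F is affine near the curve, the Filippov set is a single point. The selection is
  then a continuous function of time, and the integral equation can be differentiated.\<close>

lemma trajectory_classical:
  assumes tr: "trajectory F \<gamma>"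
    and aff: "\<And>s. s \<in> {a<..<b} \<Longrightarrow> \<forall>\<^sub>F u in nhds (fst (\<gamma> s)). F u = p * u + q"
    and s: "s \<in> {a<..<b}"
  shows "(\<gamma> has_vector_derivative (F (fst (\<gamma> s)) - snd (\<gamma> s), fst (\<gamma> s))) (at s)"
proof -
  obtain g where g: "\<And>t. g t \<in> filippov_set F (fst (\<gamma> t))" "\<And>s t. s \<le> t \<Longrightarrow>
      ((\<lambda>\<tau>. (g \<tau> - snd (\<gamma> \<tau>), fst (\<gamma> \<tau>))) has_integral (\<gamma> t - \<gamma> s)) {s..t}"
    using tr unfolding trajectory_def by blast
  define h where "h \<tau> = (p * fst (\<gamma> \<tau>) + q - snd (\<gamma> \<tau>), fst (\<gamma> \<tau>))" for \<tau>
  obtain c where c: "a < c" "c < s" using s dense[of a s] by auto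
  obtain d where d: "s < d" "d < b" using s dense[of s b] by auto
  have gh: "(g \<tau> - snd (\<gamma> \<tau>), fst (\<gamma> \<tau>)) = h \<tau>" if "\<tau> \<in> {a<..<b}" for \<tau>
  proof -
    have "\<forall>\<^sub>F u in at (fst (\<gamma> \<tau>)). F u = p * u + q"
      using aff[OF that] by (simp add: eventually_nhds_conv_at)
    then show ?thesis using g(1)[of \<tau>] by (simp add: filippov_set_affine h_def)
  qed
  have hc: "continuous_on {c..d} h" unfolding h_def
    using continuous_on_subset[OF trajectory_continuous[OF tr]] by (intro continuous_intros) auto
  have "((\<lambda>u. \<gamma> c + integral {c..u} h) has_vector_derivative h s) (at s within {c..d})"
    using integral_has_vector_derivative[OF hc, of s] c d by (auto intro!: derivative_eq_intros)
  then have "(\<gamma> has_vector_derivative h s) (at s within {c..d})"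
  proof (rule has_vector_derivative_transform[rotated 2])
    show "s \<in> {c..d}" using c d by simp
    fix u assume u: "u \<in> {c..d}"
    have "integral {c..u} h = integral {c..u} (\<lambda>\<tau>. (g \<tau> - snd (\<gamma> \<tau>), fst (\<gamma> \<tau>)))"
      by (rule integral_cong) (use gh c d u in auto)
    also have "\<dots> = \<gamma> u - \<gamma> c" using integral_unique[OF g(2)[of c u]] u by simp
    finally show "\<gamma> u = \<gamma> c + integral {c..u} h" by simp
  qed
  moreover have "at s within {c..d} = at s" using c d by (simp add: at_within_Icc_at)
  moreover have "h s = (F (fst (\<gamma> s)) - snd (\<gamma> s), fst (\<gamma> s))"
    using eventually_nhds_x_imp_x[OF aff[OF s]] by (simp add: h_def)
  ultimately show ?thesis by simp
qed

lemma trajectory_shift: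
  assumes "trajectory F \<gamma>" shows "trajectory F (\<lambda>t. \<gamma> (t + c))"
proof -
  obtain g where g: "\<And>t. g t \<in> filippov_set F (fst (\<gamma> t))" "\<And>s t. s \<le> t \<Longrightarrow>
      ((\<lambda>\<tau>. (g \<tau> - snd (\<gamma> \<tau>), fst (\<gamma> \<tau>))) has_integral (\<gamma> t - \<gamma> s)) {s..t}"
    using assms unfolding trajectory_def by blast
  have "((\<lambda>\<tau>. (g (\<tau> + c) - snd (\<gamma> (\<tau> + c)), fst (\<gamma> (\<tau> + c)))) has_integral (\<gamma> (t + c) - \<gamma> (s + c))) {s..t}"
    if "s \<le> t" for s t
    using has_integral_shift_real_ivl[OF g(2)[of "s + c" "t + c"], of c] that by simp
  then show ?thesis unfolding trajectory_def using g(1) by (intro exI[of _ "\<lambda>t. g (t + c)"]) simp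
qed

section \<open>Time reversal\<close>

definition mirror :: "real \<times> real \<Rightarrow> real \<times> real" where
  "mirror p = (- fst p, snd p)"

lemma mirror_simps [simp]: "fst (mirror p) = - fst p" "snd (mirror p) = snd p" "mirror (mirror p) = p"
  "norm (mirror p) = norm p"
  by (cases p, simp add: mirror_def norm_Pair)+

lemma filippov_set_reflect: "filippov_set (\<lambda>x. F (- x)) (- x) = filippov_set F x"
proof -
  have "(((\<lambda>x. F (- x)) \<longlongrightarrow> l) (at_left (- x))) \<longleftrightarrow> ((F \<longlongrightarrow> l) (at_right x))" for l
    by (simp add: at_left_minus filterlim_filtermap)
  moreover have "(((\<lambda>x. F (- x)) \<longlongrightarrow> l) (at_right (- x))) \<longleftrightarrow> ((F \<longlongrightarrow> l) (at_left x))" for l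
    by (simp add: at_right_minus filterlim_filtermap)
  ultimately have "Lim (at_left (- x)) (\<lambda>x. F (- x)) = Lim (at_right x) F"
    "Lim (at_right (- x)) (\<lambda>x. F (- x)) = Lim (at_left x) F" by (simp_all add: Topological_Spaces.Lim_def)
  then show ?thesis by (simp add: filippov_set_def closed_segment_commute)
qed

text \<open>For (X, Y)(t) = (- x, y)(- t) one has X' = F(- X) - Y and Y' = X. For even F this is a
  symmetry of the system; in general it exchanges expanding and contracting behaviour at infinity,
  so only one of the two has to be analysed.\<close>

lemma trajectory_reflect:
  assumes "trajectory F \<gamma>" shows "trajectory (\<lambda>x. F (- x)) (\<lambda>t. mirror (\<gamma> (- t)))"
proof -
  obtain g where g: "\<And>t. g t \<in> filippov_set F (fst (\<gamma> t))" "\<And>s t. s \<le> t \<Longrightarrow>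
      ((\<lambda>\<tau>. (g \<tau> - snd (\<gamma> \<tau>), fst (\<gamma> \<tau>))) has_integral (\<gamma> t - \<gamma> s)) {s..t}"
    using assms unfolding trajectory_def by blast
  have "((\<lambda>\<tau>. (g (- \<tau>) - snd (\<gamma> (- \<tau>)), - fst (\<gamma> (- \<tau>)))) has_integral (mirror (\<gamma> (- t)) - mirror (\<gamma> (- s)))) {s..t}"
    if "s \<le> t" for s t
  proof -
    have lin: "bounded_linear (\<lambda>p :: real \<times> real. (fst p, - snd p))"
      by (intro bounded_linear_Pair bounded_linear_fst bounded_linear_minus bounded_linear_snd)
    have "((\<lambda>\<tau>. (g (- \<tau>) - snd (\<gamma> (- \<tau>)), fst (\<gamma> (- \<tau>)))) has_integral (\<gamma> (- s) - \<gamma> (- t))) {s..t}"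
      using g(2)[of "- t" "- s"] that
      by (subst has_integral_reflect_real[symmetric]) simp
    from has_integral_linear[OF this lin] show ?thesis
      by (simp add: o_def mirror_def minus_prod_def)
  qed
  moreover have "g (- t) \<in> filippov_set (\<lambda>x. F (- x)) (- fst (\<gamma> (- t)))" for t
    using g(1)[of "- t"] by (simp add: filippov_set_reflect)
  ultimately show ?thesis unfolding trajectory_def
    by (intro exI[of _ "\<lambda>t. g (- t)"]) simp
qed

text \<open>Besides the two tails, only one-sided affinity and a bound of slope 2 are retained from
  the piecewise linear form. The bound gives F x - y the sign of - y where |y| > K + 2 |x|. The
  assumptions are stable under x \<mapsto> - x, see \<open>planar_pwl_reflect\<close>.\<close>

locale planar_pwl =
  fixes F :: "real \<Rightarrow> real" and al bl ar br X K :: real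
  assumes X: "X > 0" and K: "K \<ge> 0"
    and affine_right: "\<exists>p q. \<forall>\<^sub>F u in at_right x. F u = p * u + q"
    and affine_left: "\<exists>p q. \<forall>\<^sub>F u in at_left x. F u = p * u + q"
    and tail_right: "x > X \<Longrightarrow> F x = ar * x + br"
    and tail_left: "x < - X \<Longrightarrow> F x = al * x + bl"
    and bound: "\<bar>F x\<bar> \<le> K + 2 * \<bar>x\<bar>"
    and slopes: "\<bar>al\<bar> < 2" "\<bar>ar\<bar> < 2"
begin

lemma filippov_bound:
  assumes "g \<in> filippov_set F x" shows "\<bar>g\<bar> \<le> K + 2 * \<bar>x\<bar>"
proof -
  have lim: "\<bar>Lim (at x within S) F\<bar> \<le> K + 2 * \<bar>x\<bar>"
    if ex: "\<exists>p q. \<forall>\<^sub>F u in at x within S. F u = p * u + q" and nb: "at x within S \<noteq> bot" for S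
  proof -
    obtain p q where "\<forall>\<^sub>F u in at x within S. F u = p * u + q" using ex by blast
    then have lim: "(F \<longlongrightarrow> p * x + q) (at x within S)" by (rule tendsto_affine_at_side)
    have "((\<lambda>u. K + 2 * \<bar>u\<bar>) \<longlongrightarrow> K + 2 * \<bar>x\<bar>) (at x within S)" by (intro tendsto_intros)
    moreover have "((\<lambda>u. \<bar>F u\<bar>) \<longlongrightarrow> \<bar>p * x + q\<bar>) (at x within S)" by (intro tendsto_intros lim)
    ultimately have "\<bar>p * x + q\<bar> \<le> K + 2 * \<bar>x\<bar>"
      by (rule tendsto_le[OF nb]) (simp add: bound)
    then show ?thesis using tendsto_Lim[OF nb lim] by simp
  qed
  show ?thesis using assms unfolding filippov_set_def
    by (rule closed_segment_real_abs_le[rotated 2]) (intro lim affine_left affine_right, simp)+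
qed

text \<open>Here the near future of a trajectory is determined: either F is affine nearby or x' has
  a strict sign. Outside this set |x| \<le> X and |y| \<le> K + 2 X, so |x| + |y| \<le> 3 X + K,
  which is the radius in \<open>far_norm\<close>.\<close>

definition far :: "(real \<times> real) set" where
  "far = {P. X < \<bar>fst P\<bar> \<or> K + 2 * \<bar>fst P\<bar> < \<bar>snd P\<bar>}"

lemma far_norm: "norm P > 3 * X + K \<Longrightarrow> P \<in> far"
  using norm_Pair_le[of "fst P" "snd P"] by (auto simp: far_def)

text \<open>\<open>s\<close> stands for the sign of y: for large positive y trajectories move to the
  left, so \<open>s = 1\<close> selects the branch to the left of \<open>x\<close>, and
  \<open>s = -1\<close> the one to the right.\<close>

lemma one_sided_affine:
  assumes "s = 1 \<or> s = (-1::real)"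
  shows "\<exists>p q. \<exists>d>0. \<forall>u. 0 < s * (x - u) \<and> s * (x - u) < d \<longrightarrow> F u = p * u + q"
proof (cases "s = 1")
  case True
  obtain p q b where "b < x" "\<And>u. u > b \<Longrightarrow> u < x \<Longrightarrow> F u = p * u + q"
    using affine_left[of x] unfolding eventually_at_left_field by blast
  then show ?thesis using True by (intro exI[of _ p] exI[of _ q] exI[of _ "x - b"]) auto
next
  case False
  obtain p q b where "b > x" "\<And>u. u > x \<Longrightarrow> u < b \<Longrightarrow> F u = p * u + q"
    using affine_right[of x] unfolding eventually_at_right_field by blast
  then show ?thesis using False assms by (intro exI[of _ p] exI[of _ q] exI[of _ "b - x"]) auto
qed

text \<open>
  Where \<open>\<bar>y\<bar>\<close> is large, a trajectory moves strictly in one \<open>x\<close>-direction, so it leaves a switching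
  line immediately; elsewhere in \<open>far\<close> the function \<open>F\<close> is affine anyway.  The branch of \<open>F\<close> that
  is followed depends only on the point.
\<close>

lemma strip_moves:
  assumes tr: "trajectory F \<gamma>" and s: "s = 1 \<or> s = (-1::real)"
    and y: "K + 2 * \<bar>fst (\<gamma> t)\<bar> < s * snd (\<gamma> t)" and "d > 0"
  shows "\<exists>\<epsilon>>0. \<forall>r. t < r \<and> r < t + \<epsilon> \<longrightarrow> 0 < s * (fst (\<gamma> t) - fst (\<gamma> r)) \<and> s * (fst (\<gamma> t) - fst (\<gamma> r)) < d"
proof -
  obtain g where g: "\<And>t. g t \<in> filippov_set F (fst (\<gamma> t))" "\<And>s t. s \<le> t \<Longrightarrow>
      ((\<lambda>\<tau>. (g \<tau> - snd (\<gamma> \<tau>), fst (\<gamma> \<tau>))) has_integral (\<gamma> t - \<gamma> s)) {s..t}"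
    using tr unfolding trajectory_def by blast
  have cont: "isCont \<gamma> t" using trajectory_continuous[OF tr] by (simp add: continuous_on_eq_continuous_at)
  \<comment> \<open>A margin in the assumed inequality for y. By continuity it persists for a short
    while, and integrating - s x' over {t..r} shows that x moves by at least \<eta> (r - t).\<close>
  obtain \<eta> where \<eta>: "\<eta> > 0" "\<eta> < s * snd (\<gamma> t) - (K + 2 * \<bar>fst (\<gamma> t)\<bar>)"
    using dense[of 0 "s * snd (\<gamma> t) - (K + 2 * \<bar>fst (\<gamma> t)\<bar>)"] y by auto
  have "((\<lambda>r. s * snd (\<gamma> r) - (K + 2 * \<bar>fst (\<gamma> r)\<bar>)) \<longlongrightarrow> s * snd (\<gamma> t) - (K + 2 * \<bar>fst (\<gamma> t)\<bar>)) (at t)"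
    using cont unfolding isCont_def by (intro tendsto_intros)
  from order_tendstoD(1)[OF this \<eta>(2)]
  obtain e1 where e1: "e1 > 0" "\<And>r. r \<noteq> t \<Longrightarrow> dist r t < e1 \<Longrightarrow> \<eta> < s * snd (\<gamma> r) - (K + 2 * \<bar>fst (\<gamma> r)\<bar>)"
    unfolding eventually_at by blast
  have "((\<lambda>r. s * (fst (\<gamma> t) - fst (\<gamma> r))) \<longlongrightarrow> s * (fst (\<gamma> t) - fst (\<gamma> t))) (at t)"
    using cont unfolding isCont_def by (intro tendsto_intros)
  then have "\<forall>\<^sub>F r in at t. s * (fst (\<gamma> t) - fst (\<gamma> r)) < d"
    by (rule order_tendstoD(2)) (use \<open>d > 0\<close> in simp)
  then obtain e2 where e2: "e2 > 0" "\<And>r. r \<noteq> t \<Longrightarrow> dist r t < e2 \<Longrightarrow> s * (fst (\<gamma> t) - fst (\<gamma> r)) < d"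
    unfolding eventually_at by blast
  have "0 < s * (fst (\<gamma> t) - fst (\<gamma> r)) \<and> s * (fst (\<gamma> t) - fst (\<gamma> r)) < d" if r: "t < r" "r < t + min e1 e2" for r
  proof
    have "((\<lambda>\<tau>. fst (g \<tau> - snd (\<gamma> \<tau>), fst (\<gamma> \<tau>))) has_integral fst (\<gamma> r - \<gamma> t)) {t..r}"
      using has_integral_linear[OF g(2)[of t r] bounded_linear_fst] r by (simp add: o_def)
    then have 1: "((\<lambda>\<tau>. - s * (g \<tau> - snd (\<gamma> \<tau>))) has_integral - s * (fst (\<gamma> r) - fst (\<gamma> t))) {t..r}"
      by (intro has_integral_mult_right) simp
    have 2: "((\<lambda>\<tau>. \<eta>) has_integral \<eta> * (r - t)) {t..r}"
      using has_integral_const_real[of \<eta> t r] r by (simp add: mult.commute)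
    have 3: "\<eta> \<le> - s * (g \<tau> - snd (\<gamma> \<tau>))" if \<tau>: "\<tau> \<in> {t..r}" for \<tau>
    proof -
      have "\<eta> < s * snd (\<gamma> \<tau>) - (K + 2 * \<bar>fst (\<gamma> \<tau>)\<bar>)"
        using \<eta>(2) e1(2)[of \<tau>] \<tau> r by (cases "\<tau> = t") (auto simp: dist_real_def)
      moreover have "\<bar>s * g \<tau>\<bar> \<le> K + 2 * \<bar>fst (\<gamma> \<tau>)\<bar>" using filippov_bound[OF g(1)[of \<tau>]] s by auto
      ultimately show ?thesis by (simp add: algebra_simps)
    qed
    have "\<eta> * (r - t) \<le> - s * (fst (\<gamma> r) - fst (\<gamma> t))"
      by (rule has_integral_le[OF 2 1 3])
    moreover have "\<eta> * (r - t) > 0" using \<eta>(1) r by simp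
    ultimately show "0 < s * (fst (\<gamma> t) - fst (\<gamma> r))" by (simp add: algebra_simps)
    show "s * (fst (\<gamma> t) - fst (\<gamma> r)) < d" using e2(2)[of r] r by (simp add: dist_real_def)
  qed
  then show ?thesis using e1(1) e2(1) by (intro exI[of _ "min e1 e2"]) auto
qed

text \<open>The y-axis is excluded because \<open>lyapunov\<close> changes its formula
  there.\<close>

definition classical_between :: "(real \<Rightarrow> real \<times> real) \<Rightarrow> real \<Rightarrow> real \<Rightarrow> real \<Rightarrow> real \<Rightarrow> bool" where
  "classical_between \<gamma> p q a b \<longleftrightarrow> (\<forall>s. a < s \<and> s < b \<longrightarrow> fst (\<gamma> s) \<noteq> 0 \<and> F (fst (\<gamma> s)) = p * fst (\<gamma> s) + q \<and>
     (\<gamma> has_vector_derivative (F (fst (\<gamma> s)) - snd (\<gamma> s), fst (\<gamma> s))) (at s))"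

lemma classical_betweenI:
  assumes tr: "trajectory F \<gamma>"
    and "\<And>s. a < s \<Longrightarrow> s < b \<Longrightarrow> fst (\<gamma> s) \<noteq> 0"
    and aff: "\<And>s. a < s \<Longrightarrow> s < b \<Longrightarrow> fst (\<gamma> s) \<in> U" "open U" "\<And>u. u \<in> U \<Longrightarrow> F u = p * u + q"
  shows "classical_between \<gamma> p q a b"
  unfolding classical_between_def
proof (intro allI impI conjI)
  fix s assume s: "a < s \<and> s < b"
  show "fst (\<gamma> s) \<noteq> 0" "F (fst (\<gamma> s)) = p * fst (\<gamma> s) + q" using assms s by simp_all
  show "(\<gamma> has_vector_derivative (F (fst (\<gamma> s)) - snd (\<gamma> s), fst (\<gamma> s))) (at s)"
  proof (rule trajectory_classical[OF tr])
    show "s \<in> {a<..<b}" using s by simp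
    fix r assume "r \<in> {a<..<b}"
    then show "\<forall>\<^sub>F u in nhds (fst (\<gamma> r)). F u = p * u + q"
      using aff by (intro eventually_nhds[THEN iffD2] exI[of _ U]) auto
  qed
qed

text \<open>The order of the quantifiers is the point: \<open>p\<close> and \<open>q\<close> are
  fixed by \<open>P\<close>, before any trajectory is chosen. Two trajectories through
  \<open>P\<close> therefore satisfy the same linear equation just afterwards.\<close>

lemma locally_classical:
  assumes "P \<in> far"
  obtains p q where "\<And>\<gamma> t. trajectory F \<gamma> \<Longrightarrow> \<gamma> t = P \<Longrightarrow> \<exists>\<epsilon>>0. classical_between \<gamma> p q t (t + \<epsilon>)"
proof -
  have tail: "\<exists>\<epsilon>>0. classical_between \<gamma> p q t (t + \<epsilon>)"
    if "trajectory F \<gamma>" "fst (\<gamma> t) \<in> U" "open U" "0 \<notin> U" "\<And>u. u \<in> U \<Longrightarrow> F u = p * u + q" for \<gamma> t U p q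
  proof -
    have "isCont (\<lambda>t. fst (\<gamma> t)) t"
      using trajectory_continuous[OF that(1)] by (intro continuous_intros) (simp add: continuous_on_eq_continuous_at)
    then have "\<forall>\<^sub>F r in at t. fst (\<gamma> r) \<in> U" unfolding isCont_def using that(3,2) by (rule topological_tendstoD)
    then obtain e where "e > 0" "\<And>r. r \<noteq> t \<Longrightarrow> dist r t < e \<Longrightarrow> fst (\<gamma> r) \<in> U" unfolding eventually_at by blast
    then have "e > 0" "\<And>r. t < r \<Longrightarrow> r < t + e \<Longrightarrow> fst (\<gamma> r) \<in> U" by (auto simp: dist_real_def)
    moreover from this have "\<And>r. t < r \<Longrightarrow> r < t + e \<Longrightarrow> fst (\<gamma> r) \<noteq> 0" using that(4) by force
    ultimately show ?thesis using that by (intro exI[of _ e] conjI classical_betweenI[where U = U]) auto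
  qed
  have strip: "\<exists>p q. \<forall>\<gamma> t. trajectory F \<gamma> \<and> \<gamma> t = P \<longrightarrow> (\<exists>\<epsilon>>0. classical_between \<gamma> p q t (t + \<epsilon>))"
    if s: "s = 1 \<or> s = (-1::real)" and y: "K + 2 * \<bar>fst P\<bar> < s * snd P" for s
  proof -
    obtain p q d where d: "d > 0" "\<And>u. 0 < s * (fst P - u) \<Longrightarrow> s * (fst P - u) < d \<Longrightarrow> F u = p * u + q"
      using one_sided_affine[OF s, of "fst P"] by blast
    \<comment> \<open>This keeps 0 out of \<open>U\<close>: if \<open>P\<close> is off the y-axis
      through the bound \<open>\<bar>fst P\<bar>\<close>, and if \<open>P\<close> is on it through
      the strict lower inequality in \<open>U\<close>.\<close>
    define d' where "d' = (if fst P = 0 then d else min d \<bar>fst P\<bar>)"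
    define U where "U = {u. 0 < s * (fst P - u) \<and> s * (fst P - u) < d'}"
    have "d' > 0" using d(1) by (simp add: d'_def)
    have U: "open U" unfolding U_def by (intro open_Collect_conj open_Collect_less continuous_intros)
    have U0: "0 \<notin> U" using s by (auto simp: U_def d'_def)
    have UF: "F u = p * u + q" if "u \<in> U" for u using that d(2)[of u] by (auto simp: U_def d'_def split: if_splits)
    have "\<exists>\<epsilon>>0. classical_between \<gamma> p q t (t + \<epsilon>)" if tr: "trajectory F \<gamma>" and P: "\<gamma> t = P" for \<gamma> t
    proof -
      from strip_moves[OF tr s _ \<open>d' > 0\<close>, of t] y P
      obtain \<epsilon> where \<epsilon>: "\<epsilon> > 0" "\<And>r. t < r \<Longrightarrow> r < t + \<epsilon> \<Longrightarrow> fst (\<gamma> r) \<in> U" by (auto simp: U_def)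
      have "fst (\<gamma> r) \<noteq> 0" if "t < r" "r < t + \<epsilon>" for r using \<epsilon>(2)[OF that] U0 by force
      then show ?thesis using \<epsilon> U UF tr by (intro exI[of _ \<epsilon>] conjI classical_betweenI[where U = U])
    qed
    then show ?thesis by blast
  qed
  consider "fst P > X" | "fst P < - X" | "K + 2 * \<bar>fst P\<bar> < 1 * snd P" | "K + 2 * \<bar>fst P\<bar> < (-1) * snd P"
    using assms by (fastforce simp: far_def)
  then show thesis
  proof cases
    case 1
    show ?thesis
    proof (rule that)
      fix \<gamma> t assume "trajectory F \<gamma>" "\<gamma> t = P"
      then show "\<exists>\<epsilon>>0. classical_between \<gamma> ar br t (t + \<epsilon>)"
        using 1 X tail_right by (intro tail[where U = "{X<..}"]) auto
    qed
  next
    case 2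
    show ?thesis
    proof (rule that)
      fix \<gamma> t assume "trajectory F \<gamma>" "\<gamma> t = P"
      then show "\<exists>\<epsilon>>0. classical_between \<gamma> al bl t (t + \<epsilon>)"
        using 2 X tail_left by (intro tail[where U = "{..<-X}"]) auto
    qed
  next
    case 3
    from strip[OF _ this] that show ?thesis by blast
  next
    case 4
    from strip[OF _ this] that show ?thesis by blast
  qed
qed

end

section \<open>Uniqueness and rotation near infinity\<close>

lemma first_exit:
  fixes f :: "real \<Rightarrow> real"
  assumes cont: "continuous_on {a..b} f" and a: "f a > R" and t: "t \<in> {a..b}" "f t \<le> R"
  obtains u where "a < u" "u \<le> t" "f u = R" "\<And>r. a \<le> r \<Longrightarrow> r < u \<Longrightarrow> f r > R"
proof -
  define S where "S = {t \<in> {a..b}. f t \<le> R}"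
  have "closed S" unfolding S_def
    by (rule continuous_on_closed_Collect_le) (intro continuous_intros cont, simp add: cont, simp)
  then have "compact S" by (auto simp: compact_eq_bounded_closed S_def intro: bounded_subset[of "{a..b}"])
  then obtain u where u: "u \<in> S" "\<And>s. s \<in> S \<Longrightarrow> u \<le> s"
    using compact_attains_inf[of S] t by (auto simp: S_def)
  have "continuous_on {a..u} f" using cont by (rule continuous_on_subset) (use u in \<open>auto simp: S_def\<close>)
  then obtain x where x: "a \<le> x" "x \<le> u" "f x = R"
    using IVT2'[of f u R a] u(1) a by (auto simp: S_def)
  have "x \<in> S" using x u(1) by (auto simp: S_def)
  then have "f u = R" using u(2)[of x] x by (cases "x = u") auto
  show thesis
  proof (rule that)
    show "a < u" using u(1) a \<open>f u = R\<close> by (cases "a = u") (auto simp: S_def)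
    show "u \<le> t" using u(2)[of t] t by (simp add: S_def)
    show "f r > R" if "a \<le> r" "r < u" for r
      using u(2)[of r] that u(1) by (fastforce simp: S_def)
  qed fact
qed

text \<open>Only continuity of the logarithm \<open>l\<close> is given. Near \<open>s\<close> it
  must coincide with l s + Ln (z r / z s), since the imaginary part of l r - l s stays below \<pi>
  in modulus, and that expression is differentiable.\<close>

lemma log_lift_derivative:
  fixes z l :: "real \<Rightarrow> complex"
  assumes z: "(z has_vector_derivative z') (at s)" and l: "isCont l s"
    and eq: "\<forall>\<^sub>F r in nhds s. exp (l r) = z r"
  shows "(l has_vector_derivative z' / z s) (at s)"
proof -
  have zs: "exp (l s) = z s" using eq by (rule eventually_nhds_x_imp_x)
  then have z0: "z s \<noteq> 0" by (metis exp_not_eq_zero)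
  have "((\<lambda>r. l s + Ln (z r / z s)) has_vector_derivative z' / z s * 1) (at s)"
  proof -
    have "((\<lambda>r. z r / z s) has_vector_derivative z' / z s) (at s)"
      using z by (rule has_vector_derivative_divide)
    moreover have "(Ln has_field_derivative 1) (at (z s / z s))"
      using has_field_derivative_Ln[of "1::complex"] z0 by simp
    ultimately have "((Ln \<circ> (\<lambda>r. z r / z s)) has_vector_derivative z' / z s * 1) (at s)"
      by (rule field_vector_diff_chain_at)
    then show ?thesis by (auto simp: o_def intro!: derivative_eq_intros)
  qed
  moreover have "\<forall>\<^sub>F r in nhds s. l s + Ln (z r / z s) = l r"
  proof -
    have "((\<lambda>r. Im (l r - l s)) \<longlongrightarrow> Im (l s - l s)) (nhds s)"
      using l unfolding isCont_def tendsto_at_iff_tendsto_nhds by (intro tendsto_intros)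
    then have "\<forall>\<^sub>F r in nhds s. dist (Im (l r - l s)) (Im (l s - l s)) < pi"
      by (rule tendstoD) simp
    with eq show ?thesis
    proof eventually_elim
      case (elim r)
      have "z r / z s = exp (l r - l s)" using elim(1) zs by (simp add: exp_diff)
      moreover have "Ln (exp (l r - l s)) = l r - l s"
        using elim(2) by (intro Ln_exp) (auto simp: dist_real_def abs_less_iff)
      ultimately show ?case by simp
    qed
  qed
  ultimately show ?thesis
    using has_vector_derivative_cong_ev[where S = UNIV and x = s and f' = "z' / z s"
        and f = "\<lambda>r. l s + Ln (z r / z s)" and g = l] z0 by simp
qed

section \<open>Forward uniqueness, then bounds for the polar coordinates\<close>

context planar_pwl
begin

lemma local_uniqueness:
  assumes tr: "trajectory F \<gamma>" "trajectory F \<delta>" and eq: "\<gamma> t = \<delta> t" and far: "\<gamma> t \<in> far"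
  shows "\<exists>\<epsilon>>0. \<forall>s. t < s \<and> s < t + \<epsilon> \<longrightarrow> \<gamma> s = \<delta> s"
proof -
  obtain p q where pq: "\<And>\<eta> r. trajectory F \<eta> \<Longrightarrow> \<eta> r = \<gamma> t \<Longrightarrow> \<exists>\<epsilon>>0. classical_between \<eta> p q r (r + \<epsilon>)"
    using locally_classical[OF far] by blast
  obtain e1 where e1: "e1 > 0" "classical_between \<gamma> p q t (t + e1)" using pq[OF tr(1) refl] by blast
  obtain e2 where e2: "e2 > 0" "classical_between \<delta> p q t (t + e2)" using pq[OF tr(2) eq[symmetric]] by blast
  define u where "u r = fst (\<gamma> r) - fst (\<delta> r)" for r
  define v where "v r = snd (\<gamma> r) - snd (\<delta> r)" for r
  \<comment> \<open>The difference satisfies u' = p u - v and v' = u, so (u^2 + v^2)' = 2 p u^2 is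
    at most 2 |p| (u^2 + v^2). The minus sign turns the resulting decay into the growth that
    \<open>right_deriv_lower_bound\<close> treats.\<close>
  define f where "f r = - (((u r)\<^sup>2 + (v r)\<^sup>2) * exp (- 2 * \<bar>p\<bar> * r))" for r
  have cont: "continuous_on A f" for A
    unfolding f_def u_def v_def
    using continuous_on_subset[OF trajectory_continuous[OF tr(1)], of A]
      continuous_on_subset[OF trajectory_continuous[OF tr(2)], of A]
    by (intro continuous_intros) auto
  have der: "\<exists>D\<ge>0. (f has_real_derivative D) (at r)" if r: "t < r" "r < t + min e1 e2" for r
  proof -
    have d1: "(\<gamma> has_vector_derivative (p * fst (\<gamma> r) + q - snd (\<gamma> r), fst (\<gamma> r))) (at r)"
      using e1(2) r unfolding classical_between_def by (metis less_le_trans min.cobounded1 add_le_cancel_left)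
    have d2: "(\<delta> has_vector_derivative (p * fst (\<delta> r) + q - snd (\<delta> r), fst (\<delta> r))) (at r)"
      using e2(2) r unfolding classical_between_def by (metis less_le_trans min.cobounded2 add_le_cancel_left)
    have du: "(u has_real_derivative p * u r - v r) (at r)"
      unfolding u_def[abs_def] v_def has_real_derivative_iff_has_vector_derivative
      using has_vector_derivative_diff[OF bounded_linear.has_vector_derivative[OF bounded_linear_fst d1]
          bounded_linear.has_vector_derivative[OF bounded_linear_fst d2]] by (simp add: algebra_simps)
    have dv: "(v has_real_derivative u r) (at r)"
      unfolding u_def v_def[abs_def] has_real_derivative_iff_has_vector_derivative
      using has_vector_derivative_diff[OF bounded_linear.has_vector_derivative[OF bounded_linear_snd d1]
          bounded_linear.has_vector_derivative[OF bounded_linear_snd d2]] by (simp add: algebra_simps)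
    have "(f has_real_derivative (2 * \<bar>p\<bar> * ((u r)\<^sup>2 + (v r)\<^sup>2) - 2 * p * (u r)\<^sup>2) * exp (- 2 * \<bar>p\<bar> * r)) (at r)"
      unfolding f_def[abs_def]
      by (rule derivative_eq_intros du dv refl)+ (simp add: algebra_simps power2_eq_square)
    moreover have "p * (u r)\<^sup>2 \<le> \<bar>p\<bar> * (u r)\<^sup>2" by (rule mult_right_mono) auto
    then have "2 * \<bar>p\<bar> * ((u r)\<^sup>2 + (v r)\<^sup>2) - 2 * p * (u r)\<^sup>2 \<ge> 0"
    proof -
      have "2 * \<bar>p\<bar> * ((u r)\<^sup>2 + (v r)\<^sup>2) - 2 * p * (u r)\<^sup>2 = 2 * (\<bar>p\<bar> * (u r)\<^sup>2 - p * (u r)\<^sup>2) + 2 * (\<bar>p\<bar> * (v r)\<^sup>2)"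
        by (simp add: algebra_simps)
      moreover have "2 * (\<bar>p\<bar> * (u r)\<^sup>2 - p * (u r)\<^sup>2) + 2 * (\<bar>p\<bar> * (v r)\<^sup>2) \<ge> 0"
        using \<open>p * (u r)\<^sup>2 \<le> \<bar>p\<bar> * (u r)\<^sup>2\<close> by (intro add_nonneg_nonneg mult_nonneg_nonneg) auto
      ultimately show ?thesis by (simp only:)
    qed
    ultimately show ?thesis by (meson exp_ge_zero mult_nonneg_nonneg)
  qed
  have "\<gamma> s = \<delta> s" if s: "t < s" "s < t + min e1 e2" for s
  proof -
    have "f t + 0 * (s - t) \<le> f s"
    proof (rule right_deriv_lower_bound[OF _ cont])
      fix r assume "t \<le> r" "r < s"
      then show "\<exists>\<epsilon>>0. \<forall>w. r < w \<and> w < r + \<epsilon> \<and> w < s \<longrightarrow> (\<exists>D\<ge>0. (f has_real_derivative D) (at w))"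
        using der s by (intro exI[of _ 1]) simp
    qed (use s in simp)
    moreover have "f t = 0" by (simp add: f_def u_def v_def eq)
    ultimately have "(u s)\<^sup>2 + (v s)\<^sup>2 \<le> 0" by (simp add: f_def mult_le_0_iff not_le)
    then have "u s = 0 \<and> v s = 0" by (simp add: sum_power2_le_zero_iff)
    then show ?thesis by (simp add: u_def v_def prod_eq_iff)
  qed
  then show ?thesis using e1(1) e2(1) by (intro exI[of _ "min e1 e2"]) simp
qed

lemma forward_uniqueness:
  assumes tr: "trajectory F \<gamma>" "trajectory F \<delta>" and eq: "\<gamma> a = \<delta> a"
    and far: "\<And>t. a \<le> t \<Longrightarrow> t < b \<Longrightarrow> \<gamma> t \<in> far" and t: "t \<in> {a..b}"
  shows "\<gamma> t = \<delta> t"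
proof (rule real_interval_induct[where a = a and b = b and Q = "\<lambda>t. \<gamma> t = \<delta> t"])
  have "closed {t \<in> {a..b}. dist (\<gamma> t) (\<delta> t) \<le> 0}"
    using continuous_on_subset[OF trajectory_continuous[OF tr(1)], of "{a..b}"]
      continuous_on_subset[OF trajectory_continuous[OF tr(2)], of "{a..b}"]
    by (intro continuous_on_closed_Collect_le continuous_intros) auto
  then show "closed {t \<in> {a..b}. \<gamma> t = \<delta> t}" by simp
  fix r assume r: "a \<le> r" "r < b" and Q: "\<And>s. s \<in> {a..r} \<Longrightarrow> \<gamma> s = \<delta> s"
  have "\<gamma> r = \<delta> r" using Q[of r] r by simp
  from local_uniqueness[OF tr this far[OF r]]
  show "\<exists>\<epsilon>>0. \<forall>s. r < s \<and> s < r + \<epsilon> \<and> s \<le> b \<longrightarrow> \<gamma> s = \<delta> s" by blast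
qed (use t eq in auto)

text \<open>Membership in \<open>far\<close> is given over one period only. The shifts of
  \<open>\<gamma>\<close> by multiples of \<open>T\<close> all pass through the same point at
  \<open>t0\<close>, and each agrees with \<open>\<gamma>\<close> over that period by forward
  uniqueness.\<close>

lemma periodic_forward:
  assumes tr: "trajectory F \<gamma>" and T: "T > 0" and per: "\<gamma> (t0 + T) = \<gamma> t0"
    and far: "\<And>t. t0 \<le> t \<Longrightarrow> t \<le> t0 + T \<Longrightarrow> \<gamma> t \<in> far" and t: "t \<ge> t0"
  shows "\<gamma> (t + T) = \<gamma> t"
proof -
  have *: "\<forall>s\<in>{t0..t0 + T}. \<gamma> (s + of_nat n * T) = \<gamma> s" for n
  proof (induction n)
    case (Suc n)
    have "\<gamma> (t0 + T + of_nat n * T) = \<gamma> (t0 + T)" using Suc T by simp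
    then have start: "\<gamma> t0 = \<gamma> (t0 + of_nat (Suc n) * T)" using per by (simp add: algebra_simps)
    have "\<gamma> s = \<gamma> (s + of_nat (Suc n) * T)" if "s \<in> {t0..t0 + T}" for s
      by (rule forward_uniqueness[OF tr trajectory_shift[OF tr] start far that]) auto
    then show ?case by simp
  qed simp
  define n where "n = nat \<lfloor>(t - t0) / T\<rfloor>"
  have "(t - t0) / T \<ge> 0" using t T by simp
  then have n: "of_nat n \<le> (t - t0) / T" "(t - t0) / T < of_nat n + 1"
    by (simp_all add: n_def)
  have s: "t - of_nat n * T \<in> {t0..t0 + T}"
    using n T by (simp add: field_simps)
  have "\<gamma> (t - of_nat n * T + of_nat (Suc n) * T) = \<gamma> (t - of_nat n * T + of_nat n * T)"
    using *[of n] *[of "Suc n"] s by metis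
  then show ?thesis by (simp add: algebra_simps)
qed

text \<open>The slope 2 in \<open>bound\<close> is the borderline case: x^2 - \<alpha> x y + y^2 is
  definite only for |\<alpha>| < 2. Here the slope is at most some A < 2, and everything else,
  including F on the strip, is a bounded remainder.\<close>

lemma slope_remainder:
  obtains A E where "0 \<le> A" "A < 2" "E \<ge> 0" "\<And>x. \<exists>\<alpha>. \<bar>\<alpha>\<bar> \<le> A \<and> \<bar>F x - \<alpha> * x\<bar> \<le> E"
proof (rule that[of "max \<bar>al\<bar> \<bar>ar\<bar>" "\<bar>bl\<bar> + \<bar>br\<bar> + K + 2 * X"])
  fix x
  consider "x > X" | "x < - X" | "\<bar>x\<bar> \<le> X" by linarith
  then show "\<exists>\<alpha>. \<bar>\<alpha>\<bar> \<le> max \<bar>al\<bar> \<bar>ar\<bar> \<and> \<bar>F x - \<alpha> * x\<bar> \<le> \<bar>bl\<bar> + \<bar>br\<bar> + K + 2 * X"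
  proof cases
    case 1 then show ?thesis using K X by (intro exI[of _ ar]) (simp add: tail_right)
  next
    case 2 then show ?thesis using K X by (intro exI[of _ al]) (simp add: tail_left)
  next
    case 3 then show ?thesis using bound[of x] X slopes
      by (intro exI[of _ 0]) (simp add: le_max_iff_disj)
  qed
qed (use slopes K X in \<open>simp_all add: le_max_iff_disj\<close>)

text \<open>The two expressions are x y' - y x' and x x' + y y', that is, r^2 times the angular
  speed and r^2 times the derivative of ln r.\<close>

lemma polar_bounds:
  obtains R c C where "R > 0" "c > 0" "C > 0"
    "\<And>x y. norm (x, y) > R \<Longrightarrow> (x, y) \<in> far"
    "\<And>x y. norm (x, y) > R \<Longrightarrow> x\<^sup>2 - y * (F x - y) \<ge> c * (x\<^sup>2 + y\<^sup>2)"
    "\<And>x y. norm (x, y) > R \<Longrightarrow> \<bar>x * F x\<bar> \<le> C * (x\<^sup>2 + y\<^sup>2)"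
proof -
  obtain A E where A: "0 \<le> A" "A < 2" and E: "E \<ge> 0" and AE: "\<And>x. \<exists>\<alpha>. \<bar>\<alpha>\<bar> \<le> A \<and> \<bar>F x - \<alpha> * x\<bar> \<le> E"
    by (rule slope_remainder) blast
  define m where "m = 1 - A / 2"
  have m: "m > 0" using A by (simp add: m_def)
  \<comment> \<open>For r \<ge> 2 E / m the remainder contributes at most E r \<le> (m/2) r^2. This
    is half of the margin m = 1 - A/2 that |x y| \<le> r^2/2 leaves.\<close>
  define R where "R = max (3 * X + K) (max 1 (2 * E / m))"
  show thesis
  proof (rule that[of R "m / 2" "K + 2"])
    show "R > 0" by (simp add: R_def)
    fix x y :: real assume r: "norm (x, y) > R"
    define r where "r = norm (x, y)"
    have r2: "r\<^sup>2 = x\<^sup>2 + y\<^sup>2" and rr: "r > 1" "r \<ge> 2 * E / m" "\<bar>x\<bar> \<le> r" "\<bar>y\<bar> \<le> r"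
      using r by (auto simp: r_def R_def norm_Pair)
    show "(x, y) \<in> far" using r by (intro far_norm) (simp add: R_def)
    obtain \<alpha> where \<alpha>: "\<bar>\<alpha>\<bar> \<le> A" "\<bar>F x - \<alpha> * x\<bar> \<le> E" using AE by blast
    have "\<bar>F x\<bar> \<le> A * \<bar>x\<bar> + E"
    proof -
      have "\<bar>\<alpha> * x\<bar> \<le> A * \<bar>x\<bar>" unfolding abs_mult using \<alpha>(1) by (rule mult_right_mono) simp
      then show ?thesis using \<alpha>(2) by linarith
    qed
    then have "\<bar>y * F x\<bar> \<le> \<bar>y\<bar> * (A * \<bar>x\<bar> + E)" unfolding abs_mult by (rule mult_left_mono) simp
    also have "\<dots> = A * (\<bar>x\<bar> * \<bar>y\<bar>) + E * \<bar>y\<bar>" by (simp add: algebra_simps)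
    also have "\<bar>x\<bar> * \<bar>y\<bar> \<le> r\<^sup>2 / 2"
      using zero_le_power2[of "\<bar>x\<bar> - \<bar>y\<bar>"] unfolding r2 by (simp add: power2_diff)
    then have "A * (\<bar>x\<bar> * \<bar>y\<bar>) + E * \<bar>y\<bar> \<le> A * (r\<^sup>2 / 2) + E * r"
      using A E rr by (intro add_mono mult_left_mono)
    finally have "\<bar>y * F x\<bar> \<le> A * (r\<^sup>2 / 2) + E * r" .
    moreover have "E * r \<le> m / 2 * r\<^sup>2"
    proof -
      have "E \<le> m / 2 * r" using rr(2) m by (simp add: field_simps)
      then have "E * r \<le> m / 2 * r * r" using rr(1) by (intro mult_right_mono) auto
      then show ?thesis by (simp add: power2_eq_square)
    qed
    ultimately have "\<bar>y * F x\<bar> \<le> (A / 2 + m / 2) * r\<^sup>2" by (simp add: algebra_simps)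
    also have "A / 2 + m / 2 = 1 - m / 2" by (simp add: m_def field_simps)
    finally have "y * F x \<le> (1 - m / 2) * r\<^sup>2" by simp
    moreover have "x\<^sup>2 - y * (F x - y) = r\<^sup>2 - y * F x" unfolding r2 by (simp add: power2_eq_square algebra_simps)
    ultimately have "x\<^sup>2 - y * (F x - y) \<ge> r\<^sup>2 - (1 - m / 2) * r\<^sup>2" by linarith
    also have "r\<^sup>2 - (1 - m / 2) * r\<^sup>2 = m / 2 * r\<^sup>2" by (simp add: algebra_simps)
    finally show "x\<^sup>2 - y * (F x - y) \<ge> m / 2 * (x\<^sup>2 + y\<^sup>2)" unfolding r2 .
    have "\<bar>x * F x\<bar> \<le> \<bar>x\<bar> * (K + 2 * \<bar>x\<bar>)" unfolding abs_mult by (intro mult_left_mono bound) simp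
    also have "\<dots> \<le> r * (K * r + 2 * r)"
    proof (intro mult_mono add_mono)
      show "K \<le> K * r" using K rr(1) by (simp add: mult_le_cancel_left1)
    qed (use rr K in auto)
    also have "\<dots> = (K + 2) * r\<^sup>2" by (simp add: power2_eq_square algebra_simps)
    finally show "\<bar>x * F x\<bar> \<le> (K + 2) * (x\<^sup>2 + y\<^sup>2)" unfolding r2 .
  qed (use m K in auto)
qed

definition radius_bounds :: "real \<Rightarrow> real \<Rightarrow> real \<Rightarrow> bool" where
  "radius_bounds R c C \<longleftrightarrow> R > 0 \<and> c > 0 \<and> C > 0 \<and>
    (\<forall>P. norm P > R \<longrightarrow> P \<in> far \<and>
      (fst P)\<^sup>2 - snd P * (F (fst P) - snd P) \<ge> c * (norm P)\<^sup>2 \<and> \<bar>fst P * F (fst P)\<bar> \<le> C * (norm P)\<^sup>2)"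

lemma radius_boundsD:
  assumes "radius_bounds R c C"
  shows "R > 0" "c > 0" "C > 0" "norm P > R \<Longrightarrow> P \<in> far"
    "norm P > R \<Longrightarrow> c * (norm P)\<^sup>2 \<le> (fst P)\<^sup>2 - snd P * (F (fst P) - snd P)"
    "norm P > R \<Longrightarrow> \<bar>fst P * F (fst P)\<bar> \<le> C * (norm P)\<^sup>2"
  using assms unfolding radius_bounds_def by blast+

lemma radius_bounds_exist: obtains R c C where "radius_bounds R c C"
proof -
  obtain R c C where "R > 0" "c > 0" "C > 0"
    "\<And>x y. norm (x, y) > R \<Longrightarrow> (x, y) \<in> far"
    "\<And>x y. norm (x, y) > R \<Longrightarrow> x\<^sup>2 - y * (F x - y) \<ge> c * (x\<^sup>2 + y\<^sup>2)"
    "\<And>x y. norm (x, y) > R \<Longrightarrow> \<bar>x * F x\<bar> \<le> C * (x\<^sup>2 + y\<^sup>2)"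
    by (rule polar_bounds) blast
  then have "radius_bounds R c C"
    unfolding radius_bounds_def by (simp add: norm_Pair split_paired_all)
  then show thesis by (rule that)
qed

lemma far_classical:
  assumes tr: "trajectory F \<gamma>" and far: "\<gamma> t \<in> far"
  obtains \<epsilon> where "\<epsilon> > 0" "\<forall>s. t < s \<and> s < t + \<epsilon> \<longrightarrow> fst (\<gamma> s) \<noteq> 0 \<and>
     (\<gamma> has_vector_derivative (F (fst (\<gamma> s)) - snd (\<gamma> s), fst (\<gamma> s))) (at s)"
proof -
  obtain p q \<epsilon> where "\<epsilon> > 0" "classical_between \<gamma> p q t (t + \<epsilon>)"
    by (rule locally_classical[OF far]) (use tr in blast)
  then show thesis unfolding classical_between_def by (intro that[of \<epsilon>]) blast+
qed

lemma norm_growth: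
  assumes RB: "radius_bounds R c C" and tr: "trajectory F \<gamma>" and ab: "a \<le> b"
    and far: "\<And>t. t \<in> {a..b} \<Longrightarrow> t < b \<Longrightarrow> norm (\<gamma> t) > R" and R: "norm (\<gamma> b) \<ge> R"
  shows "norm (\<gamma> b) \<ge> norm (\<gamma> a) * exp (- C * (b - a))"
proof -
  note R0 = radius_boundsD(1)[OF RB]
  have pos: "norm (\<gamma> t) > 0" if "t \<in> {a..b}" for t
    using far[OF that] R R0 that by (cases "t = b") auto
  have nz: "\<gamma> t \<noteq> 0" if "t \<in> {a..b}" for t using pos[OF that] by auto
  define f where "f t = ln ((fst (\<gamma> t))\<^sup>2 + (snd (\<gamma> t))\<^sup>2) / 2" for t
  have fn: "f t = ln (norm (\<gamma> t))" if "t \<in> {a..b}" for t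
  proof -
    have "(fst (\<gamma> t))\<^sup>2 + (snd (\<gamma> t))\<^sup>2 = (norm (\<gamma> t))\<^sup>2" by (cases "\<gamma> t") (simp add: norm_Pair)
    then show ?thesis by (simp add: f_def ln_realpow)
  qed
  have "f a + - C * (b - a) \<le> f b"
  proof (rule right_deriv_lower_bound[OF ab])
    have "continuous_on {a..b} (\<lambda>t. ln (norm (\<gamma> t)))"
      using continuous_on_subset[OF trajectory_continuous[OF tr], of "{a..b}"] nz
      by (intro continuous_intros) auto
    moreover have "continuous_on {a..b} f \<longleftrightarrow> continuous_on {a..b} (\<lambda>t. ln (norm (\<gamma> t)))"
      using fn by (intro continuous_on_cong refl)
    ultimately show "continuous_on {a..b} f" by simp
    fix t assume t: "a \<le> t" "t < b"
    have "\<gamma> t \<in> far" using radius_boundsD(4)[OF RB far[of t]] t by simp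
    then obtain \<epsilon> where "\<epsilon> > 0" and cl: "\<forall>s. t < s \<and> s < t + \<epsilon> \<longrightarrow> fst (\<gamma> s) \<noteq> 0 \<and>
        (\<gamma> has_vector_derivative (F (fst (\<gamma> s)) - snd (\<gamma> s), fst (\<gamma> s))) (at s)" by (rule far_classical[OF tr])
    have cl': "(\<gamma> has_vector_derivative (F (fst (\<gamma> s)) - snd (\<gamma> s), fst (\<gamma> s))) (at s)"
      if "t < s" "s < t + \<epsilon>" for s using cl that by simp
    have "\<exists>D\<ge>- C. (f has_real_derivative D) (at s)" if s: "t < s" "s < t + \<epsilon>" "s < b" for s
    proof -
      define x where "x = (\<lambda>s. fst (\<gamma> s))"
      define y where "y = (\<lambda>s. snd (\<gamma> s))"
      have dx: "(x has_real_derivative F (x s) - y s) (at s)" and dy: "(y has_real_derivative x s) (at s)"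
        using bounded_linear.has_vector_derivative[OF bounded_linear_fst cl'[OF s(1,2)]]
          bounded_linear.has_vector_derivative[OF bounded_linear_snd cl'[OF s(1,2)]]
        by (simp_all add: x_def y_def has_real_derivative_iff_has_vector_derivative)
      have r2: "(x s)\<^sup>2 + (y s)\<^sup>2 = (norm (\<gamma> s))\<^sup>2" by (cases "\<gamma> s") (simp add: x_def y_def norm_Pair)
      have n: "(norm (\<gamma> s))\<^sup>2 > 0" using pos[of s] s t by simp
      have d: "((\<lambda>t. (x t)\<^sup>2 + (y t)\<^sup>2) has_real_derivative 2 * (x s * F (x s))) (at s)"
        by (rule derivative_eq_intros dx dy refl)+ (simp add: algebra_simps)
      have "((\<lambda>t. ln ((x t)\<^sup>2 + (y t)\<^sup>2) / 2) has_real_derivative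
          1 / ((x s)\<^sup>2 + (y s)\<^sup>2) * (2 * (x s * F (x s))) / 2) (at s)"
        by (rule DERIV_cdivide[OF DERIV_chain2[OF DERIV_ln_divide d]]) (simp only: r2 n)
      moreover have "1 / ((x s)\<^sup>2 + (y s)\<^sup>2) * (2 * (x s * F (x s))) / 2 = x s * F (x s) / (norm (\<gamma> s))\<^sup>2"
        by (simp add: r2)
      moreover have "\<bar>x s * F (x s)\<bar> \<le> C * (norm (\<gamma> s))\<^sup>2"
        using radius_boundsD(6)[OF RB far[of s]] s t by (simp add: x_def)
      then have "x s * F (x s) / (norm (\<gamma> s))\<^sup>2 \<ge> - C" using n by (simp add: field_simps abs_le_iff)
      ultimately show ?thesis unfolding f_def[abs_def] x_def y_def by auto
    qed
    then show "\<exists>\<epsilon>>0. \<forall>s. t < s \<and> s < t + \<epsilon> \<and> s < b \<longrightarrow> (\<exists>D\<ge>- C. (f has_real_derivative D) (at s))"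
      using \<open>\<epsilon> > 0\<close> by blast
  qed
  then have "ln (norm (\<gamma> a)) + - C * (b - a) \<le> ln (norm (\<gamma> b))" using fn ab by simp
  then have "exp (ln (norm (\<gamma> a)) + - C * (b - a)) \<le> exp (ln (norm (\<gamma> b)))" by (simp only: exp_le_cancel_iff)
  moreover have "a \<in> {a..b}" "b \<in> {a..b}" using ab by auto
  ultimately show ?thesis using pos by (simp only: exp_add exp_ln)
qed

text \<open>An interval is contractible, so the curve, read in the complex plane and avoiding 0, has
  a continuous logarithm. Its imaginary part is the angle, and \<open>log_lift_derivative\<close>
  gives the angular speed wherever the curve is differentiable.\<close>

lemma angle_lift:
  assumes RB: "radius_bounds R c C" and tr: "trajectory F \<gamma>" and S: "is_interval S"
    and far: "\<And>t. t \<in> S \<Longrightarrow> norm (\<gamma> t) > R"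
  obtains \<theta> where "continuous_on S \<theta>"
    "\<And>t. t \<in> S \<Longrightarrow> \<gamma> t = norm (\<gamma> t) *\<^sub>R (cos (\<theta> t), sin (\<theta> t))"
    "\<And>s t. s \<in> S \<Longrightarrow> t \<in> S \<Longrightarrow> s \<le> t \<Longrightarrow> \<theta> s + c * (t - s) \<le> \<theta> t"
proof -
  note R0 = radius_boundsD(1)[OF RB]
  define z where "z t = Complex (fst (\<gamma> t)) (snd (\<gamma> t))" for t
  have nz: "cmod (z t) = norm (\<gamma> t)" for t by (cases "\<gamma> t") (simp add: z_def cmod_def norm_Pair)
  have z0: "z t \<noteq> 0" if "t \<in> S" for t using nz[of t] far[OF that] R0 by force
  have "continuous_on S z" unfolding z_def
    using continuous_on_subset[OF trajectory_continuous[OF tr], of S] by (intro continuous_intros) auto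
  moreover have "contractible S" using S by (simp add: is_interval_convex convex_imp_contractible)
  ultimately obtain l where l: "continuous_on S l" "\<And>t. t \<in> S \<Longrightarrow> z t = exp (l t)"
    by (rule continuous_logarithm_on_contractible) (use z0 in auto)
  define \<theta> where "\<theta> t = Im (l t)" for t
  have cont: "continuous_on S \<theta>" unfolding \<theta>_def by (intro continuous_intros l)
  show thesis
  proof (rule that)
    show "continuous_on S \<theta>" by (rule cont)
    show "\<gamma> t = norm (\<gamma> t) *\<^sub>R (cos (\<theta> t), sin (\<theta> t))" if "t \<in> S" for t
    proof -
      have "norm (\<gamma> t) = exp (Re (l t))" using l(2)[OF that] nz[of t] by simp
      moreover have "fst (\<gamma> t) = exp (Re (l t)) * cos (\<theta> t)" "snd (\<gamma> t) = exp (Re (l t)) * sin (\<theta> t)"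
        using l(2)[OF that] by (simp_all add: z_def \<theta>_def complex_eq_iff Re_exp Im_exp)
      ultimately show ?thesis by (simp add: prod_eq_iff)
    qed
    show "\<theta> s + c * (t - s) \<le> \<theta> t" if st: "s \<in> S" "t \<in> S" "s \<le> t" for s t
    proof (rule right_deriv_lower_bound[OF st(3)])
      have sub: "{s..t} \<subseteq> S" using mem_is_interval_1_I[OF S st(1,2)] by (simp add: subset_iff)
      show "continuous_on {s..t} \<theta>" using cont sub by (rule continuous_on_subset)
      fix r assume r: "s \<le> r" "r < t"
      have "r \<in> S" using sub r by (simp add: subset_iff)
      then have "\<gamma> r \<in> far" using radius_boundsD(4)[OF RB far] by simp
      then obtain \<epsilon> where "\<epsilon> > 0" and cl: "\<forall>s. r < s \<and> s < r + \<epsilon> \<longrightarrow> fst (\<gamma> s) \<noteq> 0 \<and>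
          (\<gamma> has_vector_derivative (F (fst (\<gamma> s)) - snd (\<gamma> s), fst (\<gamma> s))) (at s)" by (rule far_classical[OF tr])
      have cl': "(\<gamma> has_vector_derivative (F (fst (\<gamma> s)) - snd (\<gamma> s), fst (\<gamma> s))) (at s)"
        if "r < s" "s < r + \<epsilon>" for s using cl that by simp
      have "\<exists>D\<ge>c. (\<theta> has_real_derivative D) (at u)" if u: "r < u" "u < r + \<epsilon>" "u < t" for u
      proof -
        have nh: "\<forall>\<^sub>F v in nhds u. v \<in> {s<..<t}" using u r by (intro eventually_nhds_in_open) auto
        have uS: "u \<in> S" "u \<in> interior {s..t}" using sub u r by (auto simp: subset_iff)
        define x where "x = (\<lambda>s. fst (\<gamma> s))"
        define y where "y = (\<lambda>s. snd (\<gamma> s))"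
        have "(z has_vector_derivative Complex (F (x u) - y u) (x u)) (at u)"
        proof -
          have lin: "bounded_linear (\<lambda>p. Complex (fst p) (snd p))"
            unfolding Complex_eq
            by (intro bounded_linear_add bounded_linear_compose[OF bounded_linear_of_real] bounded_linear_fst
                bounded_linear_snd bounded_linear_compose[OF bounded_linear_mult_right])
          from bounded_linear.has_vector_derivative[OF lin cl'[OF u(1,2)]]
          show ?thesis by (simp add: z_def[abs_def] x_def y_def)
        qed
        moreover have "isCont l u"
          using continuous_on_subset[OF l(1) sub] uS(2) by (rule continuous_on_interior)
        moreover have "\<forall>\<^sub>F v in nhds u. exp (l v) = z v"
          using nh by (rule eventually_mono) (use sub l(2) in \<open>auto simp: subset_iff\<close>)
        ultimately have "(l has_vector_derivative Complex (F (x u) - y u) (x u) / z u) (at u)"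
          by (rule log_lift_derivative)
        from bounded_linear.has_vector_derivative[OF bounded_linear_Im this]
        have "(\<theta> has_real_derivative Im (Complex (F (x u) - y u) (x u) / z u)) (at u)"
          by (simp add: \<theta>_def[abs_def] has_real_derivative_iff_has_vector_derivative)
        moreover have "Im (Complex (F (x u) - y u) (x u) / z u) = ((x u)\<^sup>2 - y u * (F (x u) - y u)) / (norm (\<gamma> u))\<^sup>2"
        proof -
          have "(norm (\<gamma> u))\<^sup>2 = (x u)\<^sup>2 + (y u)\<^sup>2" by (cases "\<gamma> u") (simp add: x_def y_def norm_Pair)
          then show ?thesis by (simp add: Im_divide z_def power2_eq_square algebra_simps flip: x_def y_def)
            (simp add: x_def y_def)
        qed
        moreover have "c * (norm (\<gamma> u))\<^sup>2 \<le> (x u)\<^sup>2 - y u * (F (x u) - y u)"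
          using radius_boundsD(5)[OF RB far[OF uS(1)]] by (simp add: x_def y_def)
        then have "c \<le> ((x u)\<^sup>2 - y u * (F (x u) - y u)) / (norm (\<gamma> u))\<^sup>2"
        proof -
          have "norm (\<gamma> u) > 0" using far[OF uS(1)] R0 by linarith
          then have "(norm (\<gamma> u))\<^sup>2 > 0" by (rule zero_less_power)
          then show ?thesis using \<open>c * (norm (\<gamma> u))\<^sup>2 \<le> (x u)\<^sup>2 - y u * (F (x u) - y u)\<close>
            by (simp only: pos_le_divide_eq)
        qed
        ultimately show ?thesis by metis
      qed
      then show "\<exists>\<epsilon>>0. \<forall>u. r < u \<and> u < r + \<epsilon> \<and> u < t \<longrightarrow> (\<exists>D\<ge>c. (\<theta> has_real_derivative D) (at u))"
        using \<open>\<epsilon> > 0\<close> by blast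
    qed
  qed
qed

text \<open>In time 3 \<pi>/c the angle grows by at least 3 \<pi>, enough for two successive
  crossings of the y-axis. The initial radius is such that the orbit stays beyond \<open>R\<close>
  during this time, as the norm shrinks at most like exp(- C t).\<close>

lemma even_periodic:
  assumes even: "\<And>x. F (- x) = F x" and RB: "radius_bounds R c C"
    and tr: "trajectory F \<gamma>" and start: "norm (\<gamma> 0) > R * exp (C * (3 * pi / c))"
  shows "closed_orbit \<gamma>"
proof -
  note R0 = radius_boundsD(1)[OF RB] and c0 = radius_boundsD(2)[OF RB] and C0 = radius_boundsD(3)[OF RB]
  define L where "L = 3 * pi / c"
  have L: "L > 0" using c0 by (simp add: L_def)
  have cont: "continuous_on A (\<lambda>t. norm (\<gamma> t))" for A
    using continuous_on_subset[OF trajectory_continuous[OF tr], of A] by (intro continuous_intros) auto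
  have start': "norm (\<gamma> 0) > R"
  proof -
    have "R * 1 \<le> R * exp (C * L)" using R0 C0 L by (intro mult_left_mono) auto
    then show ?thesis using start by (simp add: L_def)
  qed
  have far: "norm (\<gamma> t) > R" if t: "t \<in> {0..L}" for t
  proof (rule ccontr)
    assume "\<not> norm (\<gamma> t) > R"
    then have "norm (\<gamma> t) \<le> R" by simp
    then obtain u where u: "0 < u" "u \<le> t" "norm (\<gamma> u) = R" "\<And>r. 0 \<le> r \<Longrightarrow> r < u \<Longrightarrow> norm (\<gamma> r) > R"
      using first_exit[OF cont start' t] by blast
    have "norm (\<gamma> 0) * exp (- C * (u - 0)) \<le> norm (\<gamma> u)"
      by (rule norm_growth[OF RB tr]) (use u in auto)
    then have "norm (\<gamma> 0) * exp (- C * u) * exp (C * u) \<le> R * exp (C * u)"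
      using u(3) by (intro mult_right_mono) auto
    then have "norm (\<gamma> 0) \<le> R * exp (C * u)" by (simp add: mult.assoc flip: exp_add)
    also have "\<dots> \<le> R * exp (C * L)" using u t C0 R0 by (intro mult_left_mono) auto
    finally show False using start by (simp add: L_def)
  qed
  obtain \<theta> where \<theta>: "continuous_on {0..L} \<theta>"
    "\<And>t. t \<in> {0..L} \<Longrightarrow> \<gamma> t = norm (\<gamma> t) *\<^sub>R (cos (\<theta> t), sin (\<theta> t))"
    "\<And>s t. s \<in> {0..L} \<Longrightarrow> t \<in> {0..L} \<Longrightarrow> s \<le> t \<Longrightarrow> \<theta> s + c * (t - s) \<le> \<theta> t"
    using angle_lift[OF RB tr is_interval_cc[of 0 L] far] by blast
  have \<theta>L: "\<theta> 0 + 3 * pi \<le> \<theta> L" using \<theta>(3)[of 0 L] L c0 by (simp add: L_def)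
  \<comment> \<open>\<open>v\<close> is the first angle of the form \<pi>/2 + k \<pi> that is not
    below \<theta> 0. Hence v + \<pi> < \<theta> 0 + 2 \<pi> is also attained before time
    \<open>L\<close>.\<close>
  define k where "k = \<lceil>(\<theta> 0 - pi / 2) / pi\<rceil>"
  define v where "v = pi / 2 + of_int k * pi"
  have "(\<theta> 0 - pi / 2) / pi \<le> of_int k" "of_int k < (\<theta> 0 - pi / 2) / pi + 1"
    unfolding k_def by linarith+
  then have v: "\<theta> 0 \<le> v" "v < \<theta> 0 + pi" by (simp_all add: v_def field_simps)
  obtain t0 where t0: "t0 \<in> {0..L}" "\<theta> t0 = v"
    using IVT'[of \<theta> 0 v L] v \<theta>L \<theta>(1) L pi_gt_zero by auto
  obtain t1 where t1: "t1 \<in> {0..L}" "\<theta> t1 = v + pi"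
    using IVT'[of \<theta> 0 "v + pi" L] v \<theta>L \<theta>(1) L pi_gt_zero by auto
  have t01: "t0 < t1"
  proof (rule ccontr)
    assume "\<not> t0 < t1"
    then have "c * (t0 - t1) \<ge> 0" using c0 by simp
    then show False using \<theta>(3)[OF t1(1) t0(1)] t0(2) t1(2) pi_gt_zero \<open>\<not> t0 < t1\<close> by simp
  qed
  have "cos v = 0" by (auto simp: v_def cos_add sin_zero_iff_int2)
  then have sin: "\<bar>sin v\<bar> = 1" using sin_cos_squared_add[of v] \<open>cos v = 0\<close> by (auto simp: power2_eq_1_iff)
  have P0: "fst (\<gamma> t0) = 0" "snd (\<gamma> t0) = norm (\<gamma> t0) * sin v"
    using arg_cong[OF \<theta>(2)[OF t0(1)], of fst] arg_cong[OF \<theta>(2)[OF t0(1)], of snd] t0(2) \<open>cos v = 0\<close> by simp_all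
  have P1: "fst (\<gamma> t1) = 0" "snd (\<gamma> t1) = - (norm (\<gamma> t1) * sin v)"
    using arg_cong[OF \<theta>(2)[OF t1(1)], of fst] arg_cong[OF \<theta>(2)[OF t1(1)], of snd] t1(2) \<open>cos v = 0\<close> by simp_all
  \<comment> \<open>The two crossings lie on opposite halves of the y-axis. So one of them differs
    from \<open>\<gamma> 0\<close>, which \<open>closed_orbit\<close> demands.\<close>
  have ne: "\<gamma> t0 \<noteq> \<gamma> t1"
  proof
    assume eq: "\<gamma> t0 = \<gamma> t1"
    then have "2 * (norm (\<gamma> t0) * sin v) = 0" using P0(2) P1(2) by simp
    then show False using far[OF t0(1)] R0 sin by auto
  qed
  have refl_tr: "trajectory F (\<lambda>t. mirror (\<gamma> (- t)))" using trajectory_reflect[OF tr] even by simp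
  \<comment> \<open>The reversal about time \<open>t1\<close> fixes \<open>\<gamma> t1\<close>, a
    point of the y-axis, and so agrees with \<open>\<gamma>\<close> after \<open>t1\<close>. At time
    2 t1 - t0 it is at the mirror image of \<open>\<gamma> t0\<close>, which is
    \<open>\<gamma> t0\<close> itself; this gives the period 2 (t1 - t0).\<close>
  define \<delta> where "\<delta> t = mirror (\<gamma> (2 * t1 - t))" for t
  have tr\<delta>: "trajectory F \<delta>"
    using trajectory_shift[OF refl_tr, of "- 2 * t1"] by (simp add: \<delta>_def[abs_def])
  have mir: "mirror P = P" if "fst P = 0" for P using that by (simp add: mirror_def prod_eq_iff)
  have \<delta>\<gamma>: "\<delta> t = \<gamma> t" if "t \<in> {t1..2 * t1 - t0}" for t
  proof (rule forward_uniqueness[OF tr\<delta> tr _ _ that])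
    show "\<delta> t1 = \<gamma> t1" using mir[OF P1(1)] by (simp add: \<delta>_def)
    fix s assume "t1 \<le> s" "s < 2 * t1 - t0"
    then have "norm (\<gamma> (2 * t1 - s)) > R" using t0(1) t1(1) by (intro far) auto
    then show "\<delta> s \<in> far" by (intro radius_boundsD(4)[OF RB]) (simp add: \<delta>_def)
  qed
  define T where "T = 2 * (t1 - t0)"
  have T: "T > 0" using t01 by (simp add: T_def)
  have per: "\<gamma> (t0 + T) = \<gamma> t0"
  proof -
    have "\<delta> (2 * t1 - t0) = \<gamma> (2 * t1 - t0)" by (rule \<delta>\<gamma>) (use t01 in simp)
    moreover have "t0 + T = 2 * t1 - t0" by (simp add: T_def)
    ultimately show ?thesis using mir[OF P0(1)] by (simp only: \<delta>_def) simp
  qed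
  have far': "norm (\<gamma> t) > R" if "t0 \<le> t" "t \<le> t0 + T" for t
  proof (cases "t \<le> t1")
    case True
    then show ?thesis using that t0(1) t1(1) by (intro far) auto
  next
    case False
    then have "\<gamma> t = mirror (\<gamma> (2 * t1 - t))" using \<delta>\<gamma>[of t] that by (simp add: \<delta>_def T_def)
    moreover have "norm (\<gamma> (2 * t1 - t)) > R" using that False t0(1) t1(1) by (intro far) (auto simp: T_def)
    ultimately show ?thesis by simp
  qed
  have fwd: "\<gamma> (t + T) = \<gamma> t" if "t \<ge> t0" for t
    by (rule periodic_forward[OF tr T per _ that]) (rule radius_boundsD(4)[OF RB far'])
  \<comment> \<open>Uniqueness has been established forward in time. The past of
    \<open>\<gamma>\<close> is treated as the future of the reversed orbit.\<close>
  have "mirror (\<gamma> (- (s + T))) = mirror (\<gamma> (- s))" if "s \<ge> - (t0 + T)" for s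
  proof (rule periodic_forward[OF refl_tr T _ _ that])
    show "mirror (\<gamma> (- (- (t0 + T) + T))) = mirror (\<gamma> (- (- (t0 + T))))" using per by (simp add: add.commute)
    fix t assume "- (t0 + T) \<le> t" "t \<le> - (t0 + T) + T"
    then show "mirror (\<gamma> (- t)) \<in> far" by (intro radius_boundsD(4)[OF RB]) (simp add: far')
  qed
  from arg_cong[OF this, of _ mirror] have bwd: "\<gamma> (- (s + T)) = \<gamma> (- s)" if "s \<ge> - (t0 + T)" for s
    using that by simp
  have "\<gamma> (t + T) = \<gamma> t" for t
  proof (cases "t \<ge> t0")
    case False
    then show ?thesis using bwd[of "- (t + T)"] by (simp add: add.commute)
  qed (rule fwd)
  moreover have "\<gamma> t0 \<noteq> \<gamma> 0 \<or> \<gamma> t1 \<noteq> \<gamma> 0" using ne by auto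
  ultimately show ?thesis unfolding closed_orbit_def using T by blast
qed

lemma even_near_infinity:
  assumes "\<And>x. F (- x) = F x" shows "near_infinity F closed_orbit"
proof -
  obtain R c C where RB: "radius_bounds R c C" by (rule radius_bounds_exist)
  then show ?thesis unfolding near_infinity_def
    using even_periodic[OF assms RB] radius_boundsD(1)[OF RB]
    by (intro exI[of _ "R * exp (C * (3 * pi / c))"]) simp
qed

end

section \<open>A Lyapunov function near infinity\<close>

text \<open>
  A half turn of a linear focus is followed by a complex coordinate \<open>w\<close> with \<open>w' = \<lambda> w\<close> that runs
  from the positive to the negative real axis through the upper half plane.  There \<open>half_angle\<close>
  is the argument of \<open>w\<close>, defined by a branch of the logarithm that is analytic near the closed
  half plane.
\<close>

definition half_angle :: "complex \<Rightarrow> real" where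
  "half_angle w = Im (Ln (- \<i> * w)) + pi / 2"

text \<open>The modulus enters through the real part of the logarithm, so that the single derivative
  w'/w of Ln governs modulus and angle together.\<close>

definition potential :: "real \<Rightarrow> real \<Rightarrow> complex \<Rightarrow> real" where
  "potential c A w = exp (Re (Ln (- \<i> * w)) + c * half_angle w) + A * half_angle w"

text \<open>The factor - i rotates the upper half plane to the right one. The cut of
  \<open>Ln\<close> then corresponds to the negative imaginary axis of \<open>w\<close>, away from
  the real axis, where the formulas of the two half planes are joined.\<close>

lemma upper_half_branch:
  assumes "Im w \<ge> 0" "w \<noteq> 0"
  shows "- \<i> * w \<notin> \<real>\<^sub>\<le>\<^sub>0" "0 \<le> half_angle w" "half_angle w \<le> pi"
    "potential c A w = cmod w * exp (c * half_angle w) + A * half_angle w"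
proof -
  show "- \<i> * w \<notin> \<real>\<^sub>\<le>\<^sub>0"
    using assms by (auto simp: complex_nonpos_Reals_iff complex_eq_iff)
  have "\<bar>Im (Ln (- \<i> * w))\<bar> \<le> pi / 2" using Re_Ln_pos_le[of "- \<i> * w"] assms by simp
  then show "0 \<le> half_angle w" "half_angle w \<le> pi" unfolding half_angle_def by linarith+
  have "Re (Ln (- \<i> * w)) = ln (cmod w)" using assms(2) by (simp add: norm_mult)
  then show "potential c A w = cmod w * exp (c * half_angle w) + A * half_angle w"
    using assms(2) by (simp add: potential_def exp_add)
qed

lemma half_angle_of_real:
  "r > 0 \<Longrightarrow> half_angle (of_real r) = 0" "r < 0 \<Longrightarrow> half_angle (of_real r) = pi"
proof -
  show "half_angle (of_real r) = 0" if "r > 0"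
  proof -
    have "- \<i> * complex_of_real r = of_real r * (- \<i>)" by simp
    then have "Ln (- \<i> * complex_of_real r) = of_real (ln r) + Ln (- \<i>)"
      using that Ln_times_of_real[of r "- \<i>"] by (simp only: Ln_of_real) simp
    then show ?thesis by (simp add: half_angle_def)
  qed
  show "half_angle (of_real r) = pi" if "r < 0"
  proof -
    have "- \<i> * complex_of_real r = of_real (- r) * \<i>" by simp
    then have "Ln (- \<i> * complex_of_real r) = of_real (ln (- r)) + Ln \<i>"
      using that Ln_times_of_real[of "- r" "\<i>"] by (simp only: Ln_of_real) simp
    then show ?thesis by (simp add: half_angle_def)
  qed
qed

lemma potential_of_real:
  "r > 0 \<Longrightarrow> potential c A (of_real r) = r"
  "r < 0 \<Longrightarrow> potential c A (of_real r) = - r * exp (c * pi) + A * pi"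
  using upper_half_branch(4)[of "of_real r" c A] half_angle_of_real[of r] by auto

lemma continuous_on_potential [continuous_intros]:
  assumes "continuous_on S w" "\<And>x. x \<in> S \<Longrightarrow> Im (w x) \<ge> 0 \<and> w x \<noteq> 0"
  shows "continuous_on S (\<lambda>x. potential c A (w x))"
  unfolding potential_def half_angle_def
  using assms upper_half_branch(1) by (intro continuous_intros) auto

lemma potential_derivative:
  assumes w: "(w has_vector_derivative w') (at s)" and up: "Im (w s) \<ge> 0" "w s \<noteq> 0"
  shows "((\<lambda>t. potential c A (w t)) has_real_derivative
     cmod (w s) * exp (c * half_angle (w s)) * (Re (w' / w s) + c * Im (w' / w s)) + A * Im (w' / w s)) (at s)"
proof -
  have "((\<lambda>t. - \<i> * w t) has_vector_derivative - \<i> * w') (at s)"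
    using w by (rule has_vector_derivative_mult_right)
  then have "((Ln \<circ> (\<lambda>t. - \<i> * w t)) has_vector_derivative - \<i> * w' * inverse (- \<i> * w s)) (at s)"
    by (rule field_vector_diff_chain_at) (intro has_field_derivative_Ln upper_half_branch(1) up)
  moreover have "- \<i> * w' * inverse (- \<i> * w s) = w' / w s" using up(2) by (simp add: field_simps)
  ultimately have d: "((\<lambda>t. Ln (- \<i> * w t)) has_vector_derivative w' / w s) (at s)" by (simp add: o_def)
  have dRe: "((\<lambda>t. Re (Ln (- \<i> * w t))) has_real_derivative Re (w' / w s)) (at s)"
    using bounded_linear.has_vector_derivative[OF bounded_linear_Re d]
    by (simp only: has_real_derivative_iff_has_vector_derivative)
  have dIm: "((\<lambda>t. half_angle (w t)) has_real_derivative Im (w' / w s)) (at s)"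
    using bounded_linear.has_vector_derivative[OF bounded_linear_Im d]
    unfolding half_angle_def has_real_derivative_iff_has_vector_derivative
    by (auto intro!: derivative_eq_intros)
  have e: "exp (Re (Ln (- \<i> * w s)) + c * half_angle (w s)) = cmod (w s) * exp (c * half_angle (w s))"
    using upper_half_branch(4)[OF up, of c 0] by (simp add: potential_def)
  have "((\<lambda>t. exp (Re (Ln (- \<i> * w t)) + c * half_angle (w t)) + A * half_angle (w t)) has_real_derivative
     exp (Re (Ln (- \<i> * w s)) + c * half_angle (w s)) * (Re (w' / w s) + c * Im (w' / w s)) + A * Im (w' / w s)) (at s)"
    by (rule derivative_eq_intros dRe dIm refl)+ simp
  then show ?thesis unfolding e by (simp add: potential_def)
qed

text \<open>\<open>eigenvalue a\<close> = a/2 + i \<omega> is a root of \<lambda>^2 - a \<lambda> +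
  1, the characteristic polynomial of x' = a x - y, y' = x. \<open>growth_per_angle\<close> is the
  quotient of its real and imaginary parts: under w' = \<lambda> w a half turn multiplies |w| by
  exp(\<pi> \<open>growth_per_angle a\<close>).\<close>

definition freq :: "real \<Rightarrow> real" where "freq a = sqrt (1 - (a / 2)\<^sup>2)"
definition eigenvalue :: "real \<Rightarrow> complex" where "eigenvalue a = Complex (a / 2) (freq a)"
definition growth_per_angle :: "real \<Rightarrow> real" where "growth_per_angle a = a / (2 * freq a)"

lemma freq_facts:
  assumes "\<bar>a\<bar> < 2"
  shows "freq a > 0" "freq a \<le> 1" "(freq a)\<^sup>2 = 1 - (a / 2)\<^sup>2" "cmod (eigenvalue a) = 1"
    "eigenvalue a * eigenvalue a = of_real a * eigenvalue a - 1" "growth_per_angle a * freq a = a / 2"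
proof -
  have "(a / 2)\<^sup>2 < 1" using assms abs_square_less_1[of "a / 2"] by simp
  then show f: "freq a > 0" "(freq a)\<^sup>2 = 1 - (a / 2)\<^sup>2" by (simp_all add: freq_def)
  show "freq a \<le> 1" by (simp add: freq_def)
  show "cmod (eigenvalue a) = 1" by (simp add: eigenvalue_def cmod_def f)
  show "eigenvalue a * eigenvalue a = of_real a * eigenvalue a - 1"
    using f(2) by (simp add: eigenvalue_def complex_eq_iff power2_eq_square field_simps)
  show "growth_per_angle a * freq a = a / 2" using f(1) by (simp add: growth_per_angle_def)
qed

text \<open>For a \<ge> 0 the numerator grows while the frequency falls; oddness gives the rest. It
  follows that the sum of the rates of the two half planes has the sign of al + ar.\<close>

lemma growth_per_angle_less:
  assumes "\<bar>a\<bar> < 2" "\<bar>b\<bar> < 2" "a < b" shows "growth_per_angle a < growth_per_angle b"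
proof -
  have nonneg: "growth_per_angle a < growth_per_angle b" if "0 \<le> a" "a < b" "b < 2" for a b
  proof -
    have f: "freq a > 0" "freq b > 0" using that by (auto intro: freq_facts)
    have "(a / 2)\<^sup>2 \<le> (b / 2)\<^sup>2" using that by (intro power_mono) auto
    then have "freq b \<le> freq a" by (simp add: freq_def)
    then have "a / (2 * freq a) \<le> a / (2 * freq b)" using f that by (intro divide_left_mono) auto
    also have "\<dots> < b / (2 * freq b)" using f that by (intro divide_strict_right_mono) auto
    finally show ?thesis by (simp add: growth_per_angle_def)
  qed
  have minus: "growth_per_angle (- a) = - growth_per_angle a" for a
    by (simp add: growth_per_angle_def freq_def)
  have pos: "growth_per_angle a > 0" if "0 < a" "a < 2" for a
    using nonneg[of 0 a] that by (simp add: growth_per_angle_def)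
  consider "0 \<le> a" | "a < 0" "0 \<le> b" | "b < 0" by linarith
  then show ?thesis
  proof cases
    case 1 then show ?thesis using nonneg assms by simp
  next
    case 2
    have "growth_per_angle b \<ge> 0" using 2 assms pos[of b] by (cases "b = 0") (auto simp: growth_per_angle_def)
    moreover have "growth_per_angle a < 0" using 2 assms pos[of "- a"] minus[of a] by simp
    ultimately show ?thesis by linarith
  next
    case 3 then show ?thesis using nonneg[of "- b" "- a"] assms minus by simp
  qed
qed

text \<open>
  \<open>D\<close> below is the derivative of \<open>potential c A w\<close> along \<open>w' = \<lambda> (w + e)\<close>.  Without the
  perturbation \<open>e\<close> it equals \<open>\<bar>w\<bar> exp (c \<psi>) g \<omega> + A \<omega>\<close>, where \<open>\<psi>\<close> is the half angle.  If \<open>g = 0\<close>,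
  the perturbation of the first summand is \<open>O(1/\<bar>w\<bar>)\<close> only because \<open>Im w\<close> is bounded where \<open>e \<noteq> 0\<close>.
\<close>

lemma potential_growth:
  assumes a: "\<bar>a\<bar> < 2" and g: "g = c + growth_per_angle a" "g > 0 \<or> g = 0 \<and> A > 0"
    and KJ: "K \<ge> 0" "J \<ge> 0"
  obtains W \<eta> where "W > 0" "\<eta> > 0"
    "\<And>w e D. cmod w \<ge> W \<Longrightarrow> Im w \<ge> 0 \<Longrightarrow> \<bar>e\<bar> \<le> K \<Longrightarrow> (e \<noteq> 0 \<Longrightarrow> Im w \<le> J) \<Longrightarrow>
       D = cmod w * exp (c * half_angle w) *
        (Re (eigenvalue a * (w + of_real e) / w) + c * Im (eigenvalue a * (w + of_real e) / w)) +
        A * Im (eigenvalue a * (w + of_real e) / w) \<Longrightarrow> \<eta> \<le> D"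
proof -
  note f = freq_facts[OF a]
  define \<omega> where "\<omega> = freq a"
  have \<omega>: "0 < \<omega>" "\<omega> \<le> 1" using f by (auto simp: \<omega>_def)
  define E where "E = exp (- (\<bar>c\<bar> * pi))"
  define E' where "E' = exp (\<bar>c\<bar> * pi)"
  have E: "E > 0" "E' > 0" by (simp_all add: E_def E'_def)
  have P: "E \<le> exp (c * half_angle w)" "exp (c * half_angle w) \<le> E'" if "Im w \<ge> 0" "w \<noteq> 0" for w
  proof -
    have "\<bar>c * half_angle w\<bar> \<le> \<bar>c\<bar> * pi"
      unfolding abs_mult using upper_half_branch(2,3)[OF that] by (intro mult_left_mono) auto
    then show "E \<le> exp (c * half_angle w)" "exp (c * half_angle w) \<le> E'" by (auto simp: E_def E'_def)
  qed
  \<comment> \<open>The relative perturbation: w'/w = \<lambda> + e \<lambda>/w.\<close>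
  define d where "d w e = of_real e * (eigenvalue a / w)" for w :: complex and e :: real
  have split: "Re (eigenvalue a * (w + of_real e) / w) = a / 2 + Re (d w e)"
    "Im (eigenvalue a * (w + of_real e) / w) = \<omega> + Im (d w e)" if "w \<noteq> 0" for w e
  proof -
    have "eigenvalue a * (w + of_real e) / w = eigenvalue a + d w e" using that by (simp add: d_def field_simps)
    then show "Re (eigenvalue a * (w + of_real e) / w) = a / 2 + Re (d w e)"
      "Im (eigenvalue a * (w + of_real e) / w) = \<omega> + Im (d w e)" by (simp_all add: eigenvalue_def \<omega>_def)
  qed
  have d: "\<bar>Re (d w e)\<bar> \<le> K / cmod w" "\<bar>Im (d w e)\<bar> \<le> K / cmod w" if "\<bar>e\<bar> \<le> K" for w e
  proof -
    have "cmod (d w e) \<le> K / cmod w"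
      using that by (simp add: d_def norm_mult norm_divide f(4) divide_right_mono)
    then show "\<bar>Re (d w e)\<bar> \<le> K / cmod w" "\<bar>Im (d w e)\<bar> \<le> K / cmod w"
      using abs_Re_le_cmod abs_Im_le_cmod order_trans by blast+
  qed
  have rate: "a / 2 + c * \<omega> = g * \<omega>" using f(6) by (simp add: g(1) \<omega>_def algebra_simps)
  show thesis
  proof (cases "g > 0")
    case True
    \<comment> \<open>\<open>Q\<close> collects what stays bounded: the perturbation of the leading
      term and the contribution of \<open>A\<close>, divided by the least weight \<open>E\<close>;
      the summand 1 leaves D \<ge> 1. The leading term g \<omega> |w| outweighs \<open>Q\<close>
      beyond \<open>W\<close>.\<close>
    define Q where "Q = K * (1 + \<bar>c\<bar>) + (\<bar>A\<bar> * (1 + K) + 1) / E"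
    define W where "W = max 1 (Q / (g * \<omega>))"
    have g\<omega>: "g * \<omega> > 0" using True \<omega> by simp
    show thesis
    proof (rule that[of W 1])
      fix w e D assume w: "cmod w \<ge> W" "Im w \<ge> 0" and e: "\<bar>e\<bar> \<le> K"
        and D: "D = cmod w * exp (c * half_angle w) *
          (Re (eigenvalue a * (w + of_real e) / w) + c * Im (eigenvalue a * (w + of_real e) / w)) +
          A * Im (eigenvalue a * (w + of_real e) / w)"
      have w1: "cmod w \<ge> 1" using w(1) by (simp add: W_def)
      then have w0: "w \<noteq> 0" by auto
      define p where "p = exp (c * half_angle w)"
      have p: "p \<ge> E" using P[OF w(2) w0] by (simp add: p_def)
      define x where "x = Re (d w e) + c * Im (d w e)"
      have "\<bar>c * Im (d w e)\<bar> \<le> \<bar>c\<bar> * (K / cmod w)" unfolding abs_mult using d(2)[OF e] by (rule mult_left_mono) simp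
      then have "\<bar>x\<bar> \<le> K * (1 + \<bar>c\<bar>) / cmod w"
        using d(1)[OF e, of w] by (simp add: x_def algebra_simps add_divide_distrib)
      then have "- x \<le> K * (1 + \<bar>c\<bar>) / cmod w" by linarith
      then have "- x * cmod w \<le> K * (1 + \<bar>c\<bar>)" using w1 by (subst (asm) pos_le_divide_eq) auto
      then have "cmod w * x \<ge> - (K * (1 + \<bar>c\<bar>))" by (simp add: mult.commute)
      moreover have "cmod w \<ge> Q / (g * \<omega>)" using w(1) by (simp add: W_def)
      then have "g * \<omega> * cmod w \<ge> Q" using g\<omega> by (simp add: pos_divide_le_eq mult.commute)
      ultimately have 0: "cmod w * (g * \<omega> + x) \<ge> (\<bar>A\<bar> * (1 + K) + 1) / E"
        by (simp add: Q_def algebra_simps)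
      have "p * (cmod w * (g * \<omega> + x)) \<ge> E * ((\<bar>A\<bar> * (1 + K) + 1) / E)"
      proof (rule mult_mono)
        show "0 \<le> (\<bar>A\<bar> * (1 + K) + 1) / E"
          using KJ E by (intro divide_nonneg_pos add_nonneg_nonneg mult_nonneg_nonneg) auto
        show "0 \<le> p" by (simp add: p_def)
      qed (rule p, rule 0)
      then have 1: "p * (cmod w * (g * \<omega> + x)) \<ge> \<bar>A\<bar> * (1 + K) + 1" using E by simp
      have "K / cmod w \<le> K" using divide_left_mono[of 1 "cmod w" K] w1 KJ w0 by simp
      then have "\<bar>\<omega> + Im (d w e)\<bar> \<le> 1 + K" using d(2)[OF e, of w] \<omega> by linarith
      then have "\<bar>A * (\<omega> + Im (d w e))\<bar> \<le> \<bar>A\<bar> * (1 + K)" unfolding abs_mult by (rule mult_left_mono) simp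
      moreover have "D = p * (cmod w * (g * \<omega> + x)) + A * (\<omega> + Im (d w e))"
        unfolding D split[OF w0] p_def[symmetric] x_def rate[symmetric] by (simp add: algebra_simps)
      ultimately show "1 \<le> D" using 1 by linarith
    qed (auto simp: W_def)
  next
    case False
    then have g0: "g = 0" and A: "A > 0" using g(2) by auto
    have c: "c = - growth_per_angle a" using g(1) g0 by simp
    \<comment> \<open>For this \<open>c\<close> the combination Re + c Im annihilates \<lambda>. In
      \<lambda>/w it cancels the terms with Re w and leaves \<mu> Im w/|w|^2. Where e is not 0 one
      has Im w \<le> J, so after multiplication by |w| the perturbation is still O(1/|w|).\<close>
    define \<mu> where "\<mu> = \<omega> + growth_per_angle a * (a / 2)"
    define Q where "Q = E' * (K * (\<bar>\<mu>\<bar> * J)) + A * K"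
    define W where "W = max 1 (2 * Q / (A * \<omega>))"
    have A\<omega>: "A * \<omega> > 0" using A \<omega> by simp
    show thesis
    proof (rule that[of W "A * \<omega> / 2"])
      fix w e D assume w: "cmod w \<ge> W" "Im w \<ge> 0" and e: "\<bar>e\<bar> \<le> K" "e \<noteq> 0 \<Longrightarrow> Im w \<le> J"
        and D: "D = cmod w * exp (c * half_angle w) *
          (Re (eigenvalue a * (w + of_real e) / w) + c * Im (eigenvalue a * (w + of_real e) / w)) +
          A * Im (eigenvalue a * (w + of_real e) / w)"
      have w1: "cmod w \<ge> 1" using w(1) by (simp add: W_def)
      then have w0: "w \<noteq> 0" by auto
      define p where "p = exp (c * half_angle w)"
      have p: "0 \<le> p" "p \<le> E'" using P[OF w(2) w0] by (simp_all add: p_def)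
      define x where "x = Re (d w e) + c * Im (d w e)"
      have "x = e * (\<mu> * Im w / (cmod w)\<^sup>2)"
      proof -
        have r: "Re (eigenvalue a / w) = (a / 2 * Re w + \<omega> * Im w) / (cmod w)\<^sup>2"
          "Im (eigenvalue a / w) = (\<omega> * Re w - a / 2 * Im w) / (cmod w)\<^sup>2"
          by (simp_all add: Re_divide Im_divide eigenvalue_def \<omega>_def cmod_power2)
        have G: "growth_per_angle a * (\<omega> * Re w) = a / 2 * Re w"
          unfolding \<omega>_def f(6)[symmetric] by (simp only: mult.assoc)
        have n: "(a / 2 * Re w + \<omega> * Im w) - growth_per_angle a * (\<omega> * Re w - a / 2 * Im w) = \<mu> * Im w"
          unfolding right_diff_distrib G \<mu>_def by (simp add: algebra_simps)
        have "x = e * (Re (eigenvalue a / w) - growth_per_angle a * Im (eigenvalue a / w))"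
          unfolding x_def d_def c times_complex.sel Re_complex_of_real Im_complex_of_real
          by (simp only: mult_zero_left diff_0_right add_0_right) (simp add: right_diff_distrib)
        also have "Re (eigenvalue a / w) - growth_per_angle a * Im (eigenvalue a / w) = \<mu> * Im w / (cmod w)\<^sup>2"
        proof -
          have "A / N - p * (B / N) = (A - p * B) / N" for A B N p :: real by (simp add: diff_divide_distrib)
          then show ?thesis unfolding r n[symmetric] .
        qed
        finally show ?thesis .
      qed
      then have "cmod w * x = e * (\<mu> * Im w) / cmod w" using w0 by (simp add: power2_eq_square)
      moreover have "\<bar>e * (\<mu> * Im w)\<bar> \<le> K * (\<bar>\<mu>\<bar> * J)"
      proof (cases "e = 0")
        case False
        then show ?thesis unfolding abs_mult using e w(2) KJ by (intro mult_mono) auto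
      qed (use KJ in simp)
      ultimately have "\<bar>cmod w * x\<bar> \<le> K * (\<bar>\<mu>\<bar> * J) / cmod w" by (simp add: abs_divide divide_right_mono)
      then have "\<bar>p * (cmod w * x)\<bar> \<le> E' * (K * (\<bar>\<mu>\<bar> * J) / cmod w)"
        unfolding abs_mult[of p] using p by (intro mult_mono) auto
      moreover have "\<bar>A * Im (d w e)\<bar> \<le> A * (K / cmod w)"
        unfolding abs_mult using d(2)[OF e(1)] A by (intro mult_mono) auto
      ultimately have "\<bar>p * (cmod w * x)\<bar> + \<bar>A * Im (d w e)\<bar> \<le> Q / cmod w"
        by (simp add: Q_def add_divide_distrib)
      also have "\<dots> \<le> A * \<omega> / 2"
      proof -
        have "cmod w \<ge> 2 * Q / (A * \<omega>)" using w(1) by (simp add: W_def)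
        then have "2 * Q \<le> cmod w * (A * \<omega>)" by (simp only: pos_divide_le_eq[OF A\<omega>])
        then have "Q \<le> A * \<omega> / 2 * cmod w" by (simp add: mult.commute)
        moreover have "cmod w > 0" using w1 by linarith
        ultimately show ?thesis by (simp only: pos_divide_le_eq)
      qed
      finally have "\<bar>p * (cmod w * x)\<bar> + \<bar>A * Im (d w e)\<bar> \<le> A * \<omega> / 2" .
      moreover have "D = p * (cmod w * (g * \<omega> + x)) + A * (\<omega> + Im (d w e))"
        unfolding D split[OF w0] p_def[symmetric] x_def rate[symmetric] by (simp add: algebra_simps)
      then have "D = p * (cmod w * x) + A * Im (d w e) + A * \<omega>" by (simp add: g0 algebra_simps)
      ultimately show "A * \<omega> / 2 \<le> D" by linarith
    qed (use A\<omega> in \<open>auto simp: W_def\<close>)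
  qed
qed

section \<open>Construction of the Lyapunov function and its estimates\<close>

context planar_pwl
begin

definition outward :: bool where
  "outward \<longleftrightarrow> al + ar > 0 \<or> al + ar = 0 \<and> br > bl"

text \<open>From \<lambda>^2 = al \<lambda> - 1 one finds w' = \<lambda> w for w = (y - bl) -
  \<lambda> x wherever F x = al x + bl. The sign makes x \<le> 0 correspond to Im w \<ge> 0; the
  right coordinate carries the opposite sign so that the same is true of x \<ge> 0.\<close>

definition left_coord :: "real \<times> real \<Rightarrow> complex" where
  "left_coord P = of_real (snd P - bl) - eigenvalue al * of_real (fst P)"

definition right_coord :: "real \<times> real \<Rightarrow> complex" where
  "right_coord P = of_real (br - snd P) + eigenvalue ar * of_real (fst P)"

definition rate :: real where
  "rate = (growth_per_angle al + growth_per_angle ar) / 2"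

definition left_exponent :: real where
  "left_exponent = rate - growth_per_angle al"

text \<open>With D = \<open>exp (left_exponent * pi)\<close> the two slopes solve the matching
  conditions D \<open>right_slope\<close> \<pi> = br - bl on the positive half of the y-axis and
  \<open>left_slope\<close> \<pi> = D (br - bl) on the negative half.\<close>

definition left_slope :: real where
  "left_slope = exp (left_exponent * pi) * (br - bl) / pi"

definition right_slope :: real where
  "right_slope = (br - bl) / pi / exp (left_exponent * pi)"

text \<open>
  In the half planes \<open>x \<le> 0\<close> and \<open>x \<ge> 0\<close> this is \<open>\<bar>w\<bar> exp (c \<psi>) + A \<psi>\<close> up to a factor.  The exponents
  \<open>c\<close> distribute the growth over a full turn evenly.  If there is none, the drift \<open>br - bl\<close> between
  the centres of the two linear foci decides, and the slopes \<open>A\<close> spread it over the turn.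
  The constants are fixed by continuity on both halves of the \<open>y\<close>-axis.
\<close>

definition lyapunov :: "real \<times> real \<Rightarrow> real" where
  "lyapunov P = (if fst P \<le> 0 then potential left_exponent left_slope (left_coord P)
     else exp (left_exponent * pi) * potential (- left_exponent) right_slope (right_coord P))"

lemma exponents:
  "rate = left_exponent + growth_per_angle al" "rate = - left_exponent + growth_per_angle ar"
  by (simp_all add: left_exponent_def rate_def field_simps)

lemma coord_Im:
  "Im (left_coord P) = - freq al * fst P" "Im (right_coord P) = freq ar * fst P"
  by (simp_all add: left_coord_def right_coord_def eigenvalue_def)

text \<open>The square of the modulus is the quadratic form x^2 - a x y + y^2, which is definite for
  |a| < 2.\<close>

lemma coord_norm:
  assumes "\<bar>a\<bar> < 2"
  shows "sqrt (1 - \<bar>a\<bar> / 2) * norm P \<le> cmod (of_real (snd P) - eigenvalue a * of_real (fst P))"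
    "cmod (of_real (snd P) - eigenvalue a * of_real (fst P)) \<le> 2 * norm P"
proof -
  obtain x y where P: "P = (x, y)" by fastforce
  have *: "(cmod (of_real y - eigenvalue a * of_real x))\<^sup>2 = (x\<^sup>2 + y\<^sup>2) - a * (x * y)"
  proof -
    have "(cmod (of_real y - eigenvalue a * of_real x))\<^sup>2 = (y - a / 2 * x)\<^sup>2 + (freq a)\<^sup>2 * x\<^sup>2"
      by (simp add: eigenvalue_def cmod_power2 power_mult_distrib)
    also have "\<dots> = (x\<^sup>2 + y\<^sup>2) - a * (x * y)"
      unfolding freq_facts(3)[OF assms] by (simp add: power2_eq_square algebra_simps)
    finally show ?thesis .
  qed
  have "\<bar>a * (x * y)\<bar> \<le> \<bar>a\<bar> * ((x\<^sup>2 + y\<^sup>2) / 2)"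
  proof -
    have "\<bar>x * y\<bar> \<le> (x\<^sup>2 + y\<^sup>2) / 2"
      using zero_le_power2[of "\<bar>x\<bar> - \<bar>y\<bar>"] by (simp add: power2_diff abs_mult)
    then show ?thesis unfolding abs_mult[of a] by (rule mult_left_mono) simp
  qed
  then have b: "(1 - \<bar>a\<bar> / 2) * (x\<^sup>2 + y\<^sup>2) \<le> (x\<^sup>2 + y\<^sup>2) - a * (x * y)"
    "(x\<^sup>2 + y\<^sup>2) - a * (x * y) \<le> (1 + \<bar>a\<bar> / 2) * (x\<^sup>2 + y\<^sup>2)"
    by (simp_all add: algebra_simps abs_le_iff)
  have r: "(norm P)\<^sup>2 = x\<^sup>2 + y\<^sup>2" by (simp add: P norm_Pair)
  have fs: "fst P = x" "snd P = y" by (simp_all add: P)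
  show "sqrt (1 - \<bar>a\<bar> / 2) * norm P \<le> cmod (of_real (snd P) - eigenvalue a * of_real (fst P))"
  proof (rule power2_le_imp_le)
    show "(sqrt (1 - \<bar>a\<bar> / 2) * norm P)\<^sup>2 \<le> (cmod (of_real (snd P) - eigenvalue a * of_real (fst P)))\<^sup>2"
      unfolding power_mult_distrib r fs * using b(1) assms by simp
  qed simp
  show "cmod (of_real (snd P) - eigenvalue a * of_real (fst P)) \<le> 2 * norm P"
  proof (rule power2_le_imp_le)
    have "(1 + \<bar>a\<bar> / 2) * (x\<^sup>2 + y\<^sup>2) \<le> 4 * (x\<^sup>2 + y\<^sup>2)"
      using assms by (intro mult_right_mono) auto
    then show "(cmod (of_real (snd P) - eigenvalue a * of_real (fst P)))\<^sup>2 \<le> (2 * norm P)\<^sup>2"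
      unfolding power_mult_distrib r fs * using b(2) by simp
  qed simp
qed

lemma coord_bounds:
  obtains m B where "m > 0" "B \<ge> 0"
    "\<And>P. m * norm P - B \<le> cmod (left_coord P) \<and> cmod (left_coord P) \<le> 2 * norm P + B"
    "\<And>P. m * norm P - B \<le> cmod (right_coord P) \<and> cmod (right_coord P) \<le> 2 * norm P + B"
proof -
  define m where "m = min (sqrt (1 - \<bar>al\<bar> / 2)) (sqrt (1 - \<bar>ar\<bar> / 2))"
  define B where "B = max \<bar>bl\<bar> \<bar>br\<bar>"
  show thesis
  proof (rule that[of m B])
    show "m > 0" using slopes by (simp add: m_def)
    show "B \<ge> 0" by (simp add: B_def)
    fix P :: "real \<times> real"
    let ?l = "of_real (snd P) - eigenvalue al * of_real (fst P)"
    let ?r = "of_real (snd P) - eigenvalue ar * of_real (fst P)"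
    have "left_coord P = ?l - of_real bl" by (simp add: left_coord_def)
    then have "\<bar>cmod (left_coord P) - cmod ?l\<bar> \<le> B"
      using norm_triangle_ineq3[of "left_coord P" ?l] by (simp add: B_def)
    moreover have "m * norm P \<le> cmod ?l"
      using coord_norm(1)[OF slopes(1), of P] mult_right_mono[of m "sqrt (1 - \<bar>al\<bar> / 2)" "norm P"]
      by (simp add: m_def)
    ultimately show "m * norm P - B \<le> cmod (left_coord P) \<and> cmod (left_coord P) \<le> 2 * norm P + B"
      using coord_norm(2)[OF slopes(1), of P] by linarith
    have "right_coord P = - (?r - of_real br)" by (simp add: right_coord_def)
    then have "cmod (right_coord P) = cmod (?r - of_real br)" by (simp only: norm_minus_cancel)
    then have "\<bar>cmod (right_coord P) - cmod ?r\<bar> \<le> B"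
      using norm_triangle_ineq3[of "?r - of_real br" ?r] by (simp add: B_def)
    moreover have "m * norm P \<le> cmod ?r"
      using coord_norm(1)[OF slopes(2), of P] mult_right_mono[of m "sqrt (1 - \<bar>ar\<bar> / 2)" "norm P"]
      by (simp add: m_def)
    ultimately show "m * norm P - B \<le> cmod (right_coord P) \<and> cmod (right_coord P) \<le> 2 * norm P + B"
      using coord_norm(2)[OF slopes(2), of P] by linarith
  qed
qed

lemma remainder_bounds:
  obtains E where "E \<ge> 0"
    "\<And>x. x \<le> 0 \<Longrightarrow> \<bar>F x - al * x - bl\<bar> \<le> E \<and> (F x - al * x - bl \<noteq> 0 \<longrightarrow> \<bar>x\<bar> \<le> X)"
    "\<And>x. x \<ge> 0 \<Longrightarrow> \<bar>F x - ar * x - br\<bar> \<le> E \<and> (F x - ar * x - br \<noteq> 0 \<longrightarrow> \<bar>x\<bar> \<le> X)"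
proof (rule that[of "K + 4 * X + \<bar>bl\<bar> + \<bar>br\<bar>"])
  have *: "\<bar>F x - a * x - b\<bar> \<le> K + 4 * X + \<bar>b\<bar>" if "\<bar>x\<bar> \<le> X" "\<bar>a\<bar> < 2" for x a b
  proof -
    have "\<bar>a * x\<bar> \<le> 2 * X" unfolding abs_mult using that by (intro mult_mono) auto
    then show ?thesis using bound[of x] that by linarith
  qed
  show "\<bar>F x - al * x - bl\<bar> \<le> K + 4 * X + \<bar>bl\<bar> + \<bar>br\<bar> \<and> (F x - al * x - bl \<noteq> 0 \<longrightarrow> \<bar>x\<bar> \<le> X)" if "x \<le> 0" for x
  proof (cases "x < - X")
    case True then show ?thesis using tail_left[OF True] K X by simp
  next
    case False then show ?thesis using *[of x al bl] that slopes by simp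
  qed
  show "\<bar>F x - ar * x - br\<bar> \<le> K + 4 * X + \<bar>bl\<bar> + \<bar>br\<bar> \<and> (F x - ar * x - br \<noteq> 0 \<longrightarrow> \<bar>x\<bar> \<le> X)" if "x \<ge> 0" for x
  proof (cases "x > X")
    case True then show ?thesis using tail_right[OF True] K X by simp
  next
    case False then show ?thesis using *[of x ar br] that slopes by simp
  qed
qed (use K X in simp)

lemma coord_derivative:
  assumes d: "(\<gamma> has_vector_derivative (F (fst (\<gamma> s)) - snd (\<gamma> s), fst (\<gamma> s))) (at s)"
  shows "((\<lambda>t. left_coord (\<gamma> t)) has_vector_derivative eigenvalue al *
      (left_coord (\<gamma> s) + of_real (- (F (fst (\<gamma> s)) - al * fst (\<gamma> s) - bl)))) (at s)"
    "((\<lambda>t. right_coord (\<gamma> t)) has_vector_derivative eigenvalue ar *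
      (right_coord (\<gamma> s) + of_real (F (fst (\<gamma> s)) - ar * fst (\<gamma> s) - br))) (at s)"
proof -
  define x where "x = fst (\<gamma> s)"
  define y where "y = snd (\<gamma> s)"
  have dx: "((\<lambda>t. complex_of_real (fst (\<gamma> t))) has_vector_derivative of_real (F x - y)) (at s)"
    and dy: "((\<lambda>t. complex_of_real (snd (\<gamma> t))) has_vector_derivative of_real x) (at s)"
    using bounded_linear.has_vector_derivative[OF bounded_linear_compose[OF bounded_linear_of_real bounded_linear_fst] d]
      bounded_linear.has_vector_derivative[OF bounded_linear_compose[OF bounded_linear_of_real bounded_linear_snd] d]
    by (simp_all add: x_def y_def)
  have dl: "((\<lambda>t. of_real (snd (\<gamma> t)) - eigenvalue a * of_real (fst (\<gamma> t))) has_vector_derivative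
      of_real x - eigenvalue a * of_real (F x - y)) (at s)" for a
    using has_vector_derivative_diff[OF dy has_vector_derivative_mult_right[OF dx, of "eigenvalue a"]] .
  have alg: "of_real x - eigenvalue a * of_real (F x - y) =
      eigenvalue a * (of_real (y - b) - eigenvalue a * of_real x + of_real (- (F x - a * x - b)))"
    if "\<bar>a\<bar> < 2" for a b
  proof -
    have "eigenvalue a * (of_real (y - b) - eigenvalue a * of_real x + of_real (- (F x - a * x - b)))
       = eigenvalue a * (of_real y - of_real (F x) + of_real a * of_real x) - eigenvalue a * eigenvalue a * of_real x"
      by (simp add: algebra_simps)
    also have "\<dots> = of_real x - eigenvalue a * of_real (F x - y)"
      unfolding freq_facts(5)[OF that] by (simp add: algebra_simps)
    finally show ?thesis by simp
  qed
  have L: "left_coord P = (of_real (snd P) - eigenvalue al * of_real (fst P)) - of_real bl" for P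
    by (simp add: left_coord_def)
  have "((\<lambda>t. left_coord (\<gamma> t)) has_vector_derivative of_real x - eigenvalue al * of_real (F x - y)) (at s)"
    unfolding L using has_vector_derivative_diff[OF dl has_vector_derivative_const] by simp
  moreover have "of_real x - eigenvalue al * of_real (F x - y) = eigenvalue al *
      (left_coord (\<gamma> s) + of_real (- (F (fst (\<gamma> s)) - al * fst (\<gamma> s) - bl)))"
    unfolding alg[OF slopes(1), of bl] by (simp only: left_coord_def x_def y_def)
  ultimately show "((\<lambda>t. left_coord (\<gamma> t)) has_vector_derivative eigenvalue al *
      (left_coord (\<gamma> s) + of_real (- (F (fst (\<gamma> s)) - al * fst (\<gamma> s) - bl)))) (at s)"
    by (simp only:)
  have R: "right_coord P = of_real br - (of_real (snd P) - eigenvalue ar * of_real (fst P))" for P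
    by (simp add: right_coord_def)
  have "((\<lambda>t. right_coord (\<gamma> t)) has_vector_derivative - (of_real x - eigenvalue ar * of_real (F x - y))) (at s)"
    unfolding R using has_vector_derivative_diff[OF has_vector_derivative_const dl] by simp
  moreover have "- (of_real x - eigenvalue ar * of_real (F x - y)) = eigenvalue ar *
      (right_coord (\<gamma> s) + of_real (F (fst (\<gamma> s)) - ar * fst (\<gamma> s) - br))"
    unfolding alg[OF slopes(2), of br] mult_minus_right[symmetric]
    by (rule arg_cong[where f = "(*) (eigenvalue ar)"]) (simp add: right_coord_def x_def y_def)
  ultimately show "((\<lambda>t. right_coord (\<gamma> t)) has_vector_derivative eigenvalue ar *
      (right_coord (\<gamma> s) + of_real (F (fst (\<gamma> s)) - ar * fst (\<gamma> s) - br))) (at s)"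
    by (simp only:)
qed

text \<open>Beyond |bl| + |br| the numbers y - bl and br - y have the signs of y and - y. So one
  coordinate is at the beginning of its half turn and the other at the end, with half angles 0 and
  \<pi>.\<close>

lemma lyapunov_on_axis:
  assumes "\<bar>y\<bar> > \<bar>bl\<bar> + \<bar>br\<bar>"
  shows "potential left_exponent left_slope (left_coord (0, y)) =
    exp (left_exponent * pi) * potential (- left_exponent) right_slope (right_coord (0, y))"
proof -
  let ?D = "exp (left_exponent * pi)"
  have l: "left_coord (0, y) = of_real (y - bl)" and r: "right_coord (0, y) = of_real (br - y)"
    by (simp_all add: left_coord_def right_coord_def)
  have D: "?D * exp (- left_exponent * pi) = 1" by (simp flip: exp_add)
  have s: "left_slope * pi = ?D * (br - bl)" "?D * (right_slope * pi) = br - bl"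
    by (simp_all add: left_slope_def right_slope_def)
  show ?thesis
  proof (cases "y > 0")
    case True
    then have "y - bl > 0" "br - y < 0" using assms by auto
    then have "potential left_exponent left_slope (left_coord (0, y)) = y - bl"
      "?D * potential (- left_exponent) right_slope (right_coord (0, y))
        = - (br - y) * (?D * exp (- left_exponent * pi)) + ?D * (right_slope * pi)"
      unfolding l r by (simp_all only: potential_of_real) (simp add: algebra_simps)
    then show ?thesis unfolding D s by simp
  next
    case False
    then have "y - bl < 0" "br - y > 0" using assms by auto
    then have "potential left_exponent left_slope (left_coord (0, y)) = - (y - bl) * ?D + left_slope * pi"
      "?D * potential (- left_exponent) right_slope (right_coord (0, y)) = ?D * (br - y)"
      unfolding l r by (simp_all only: potential_of_real)
    then show ?thesis unfolding s by (simp add: algebra_simps)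
  qed
qed

lemma outward_rate:
  assumes outward
  shows "rate > 0 \<or> rate = 0 \<and> left_slope > 0" "rate > 0 \<or> rate = 0 \<and> right_slope > 0"
proof -
  have minus: "growth_per_angle (- al) = - growth_per_angle al"
    by (simp add: growth_per_angle_def freq_def)
  have "rate > 0" if "al + ar > 0"
    using growth_per_angle_less[of "- al" ar] slopes that minus by (simp add: rate_def)
  moreover have "rate = 0" if "al + ar = 0"
  proof -
    have "ar = - al" using that by simp
    then show ?thesis unfolding rate_def using minus by simp
  qed
  moreover have "left_slope > 0 \<and> right_slope > 0" if "br > bl"
    using that by (simp add: left_slope_def right_slope_def)
  ultimately show "rate > 0 \<or> rate = 0 \<and> left_slope > 0" "rate > 0 \<or> rate = 0 \<and> right_slope > 0"
    using assms unfolding outward_def by blast+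
qed

lemma potential_bounds:
  assumes "Im w \<ge> 0" "w \<noteq> 0" "m * r - B \<le> cmod w" "cmod w \<le> 2 * r + B"
  shows "exp (- (\<bar>c\<bar> * pi)) * m * r - (exp (- (\<bar>c\<bar> * pi)) * B + \<bar>A\<bar> * pi) \<le> potential c A w"
    "potential c A w \<le> exp (\<bar>c\<bar> * pi) * 2 * r + (exp (\<bar>c\<bar> * pi) * B + \<bar>A\<bar> * pi)"
proof -
  have "\<bar>c * half_angle w\<bar> \<le> \<bar>c\<bar> * pi" "\<bar>A * half_angle w\<bar> \<le> \<bar>A\<bar> * pi"
    unfolding abs_mult using upper_half_branch(2,3)[OF assms(1,2)] by (auto intro!: mult_left_mono)
  then have p: "exp (- (\<bar>c\<bar> * pi)) \<le> exp (c * half_angle w)" "exp (c * half_angle w) \<le> exp (\<bar>c\<bar> * pi)"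
    and A: "- (\<bar>A\<bar> * pi) \<le> A * half_angle w" "A * half_angle w \<le> \<bar>A\<bar> * pi" by auto
  have "(m * r - B) * exp (- (\<bar>c\<bar> * pi)) \<le> cmod w * exp (- (\<bar>c\<bar> * pi))"
    using assms(3) by (rule mult_right_mono) simp
  also have "\<dots> \<le> cmod w * exp (c * half_angle w)" using p(1) by (rule mult_left_mono) simp
  finally show "exp (- (\<bar>c\<bar> * pi)) * m * r - (exp (- (\<bar>c\<bar> * pi)) * B + \<bar>A\<bar> * pi) \<le> potential c A w"
    using A(1) unfolding upper_half_branch(4)[OF assms(1,2)] by (simp add: algebra_simps)
  have "cmod w * exp (c * half_angle w) \<le> cmod w * exp (\<bar>c\<bar> * pi)" using p(2) by (rule mult_left_mono) simp
  also have "\<dots> \<le> (2 * r + B) * exp (\<bar>c\<bar> * pi)" using assms(4) by (rule mult_right_mono) simp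
  finally show "potential c A w \<le> exp (\<bar>c\<bar> * pi) * 2 * r + (exp (\<bar>c\<bar> * pi) * B + \<bar>A\<bar> * pi)"
    using A(2) unfolding upper_half_branch(4)[OF assms(1,2)] by (simp add: algebra_simps)
qed

text \<open>The growth clause leaves out the y-axis and asks for a rate \<open>\<eta>\<close> that
  does not depend on the point. A uniform rate is what drives orbits to infinity even when only the
  bounded drift acts.\<close>

definition lyapunov_bounds :: "real \<Rightarrow> real \<Rightarrow> real \<Rightarrow> real \<Rightarrow> real \<Rightarrow> bool" where
  "lyapunov_bounds R m M B \<eta> \<longleftrightarrow> R > 0 \<and> m > 0 \<and> M > 0 \<and> \<eta> > 0 \<and>
     continuous_on {P. norm P > R} lyapunov \<and>
     (\<forall>P. norm P > R \<longrightarrow> P \<in> far \<and> m * norm P - B \<le> lyapunov P \<and> lyapunov P \<le> M * norm P + B) \<and>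
     (\<forall>\<gamma> s. norm (\<gamma> s) > R \<longrightarrow> fst (\<gamma> s) \<noteq> 0 \<longrightarrow>
        (\<gamma> has_vector_derivative (F (fst (\<gamma> s)) - snd (\<gamma> s), fst (\<gamma> s))) (at s) \<longrightarrow>
        (\<exists>D\<ge>\<eta>. ((\<lambda>t. lyapunov (\<gamma> t)) has_real_derivative D) (at s)))"

lemma lyapunov_bounds_exist:
  assumes outward obtains R m M B \<eta> where "lyapunov_bounds R m M B \<eta>"
proof -
  define D where "D = exp (left_exponent * pi)"
  have D: "D > 0" by (simp add: D_def)
  obtain E where E: "E \<ge> 0"
    and El: "\<And>x. x \<le> 0 \<Longrightarrow> \<bar>F x - al * x - bl\<bar> \<le> E \<and> (F x - al * x - bl \<noteq> 0 \<longrightarrow> \<bar>x\<bar> \<le> X)"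
    and Er: "\<And>x. x \<ge> 0 \<Longrightarrow> \<bar>F x - ar * x - br\<bar> \<le> E \<and> (F x - ar * x - br \<noteq> 0 \<longrightarrow> \<bar>x\<bar> \<le> X)"
    using remainder_bounds by metis
  obtain Wl \<eta>l where Wl: "Wl > 0" "\<eta>l > 0"
    and gl: "\<And>w e D. cmod w \<ge> Wl \<Longrightarrow> Im w \<ge> 0 \<Longrightarrow> \<bar>e\<bar> \<le> E \<Longrightarrow> (e \<noteq> 0 \<Longrightarrow> Im w \<le> X) \<Longrightarrow>
       D = cmod w * exp (left_exponent * half_angle w) *
        (Re (eigenvalue al * (w + of_real e) / w) + left_exponent * Im (eigenvalue al * (w + of_real e) / w)) +
        left_slope * Im (eigenvalue al * (w + of_real e) / w) \<Longrightarrow> \<eta>l \<le> D"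
    using potential_growth[OF slopes(1) exponents(1) outward_rate(1)[OF assms] E less_imp_le[OF X]] by metis
  obtain Wr \<eta>r where Wr: "Wr > 0" "\<eta>r > 0"
    and gr: "\<And>w e D. cmod w \<ge> Wr \<Longrightarrow> Im w \<ge> 0 \<Longrightarrow> \<bar>e\<bar> \<le> E \<Longrightarrow> (e \<noteq> 0 \<Longrightarrow> Im w \<le> X) \<Longrightarrow>
       D = cmod w * exp (- left_exponent * half_angle w) *
        (Re (eigenvalue ar * (w + of_real e) / w) + - left_exponent * Im (eigenvalue ar * (w + of_real e) / w)) +
        right_slope * Im (eigenvalue ar * (w + of_real e) / w) \<Longrightarrow> \<eta>r \<le> D"
    using potential_growth[OF slopes(2) exponents(2) outward_rate(2)[OF assms] E less_imp_le[OF X]] by metis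
  obtain m B where m: "m > 0" "B \<ge> 0"
    and cl: "\<And>P. m * norm P - B \<le> cmod (left_coord P) \<and> cmod (left_coord P) \<le> 2 * norm P + B"
    and cr: "\<And>P. m * norm P - B \<le> cmod (right_coord P) \<and> cmod (right_coord P) \<le> 2 * norm P + B"
    using coord_bounds by metis
  \<comment> \<open>This secures membership in \<open>far\<close>, moduli of both coordinates beyond
    the thresholds of \<open>potential_growth\<close>, and the range in which
    \<open>lyapunov_on_axis\<close> applies.\<close>
  define R where "R = max (max (3 * X + K) ((max Wl Wr + B) / m)) (max 1 (\<bar>bl\<bar> + \<bar>br\<bar>))"
  have RW: "cmod (left_coord P) \<ge> Wl" "cmod (right_coord P) \<ge> Wr" if "norm P > R" for P
  proof -
    have "norm P \<ge> (max Wl Wr + B) / m" using that by (simp add: R_def)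
    then have "norm P * m \<ge> max Wl Wr + B" by (simp only: pos_divide_le_eq[OF m(1)])
    then have "max Wl Wr + B \<le> m * norm P" by (simp only: mult.commute)
    then show "cmod (left_coord P) \<ge> Wl" "cmod (right_coord P) \<ge> Wr"
      using cl[of P] cr[of P] max.cobounded1[of Wl Wr] max.cobounded2[of Wr Wl] by linarith+
  qed
  then have nz: "left_coord P \<noteq> 0" "right_coord P \<noteq> 0" if "norm P > R" for P
    using that Wl(1) Wr(1) by fastforce+
  have iml: "Im (left_coord P) \<ge> 0" if "fst P \<le> 0" for P
    using that freq_facts(1)[OF slopes(1)] by (simp add: coord_Im mult_nonneg_nonpos)
  have imr: "Im (right_coord P) \<ge> 0" if "fst P \<ge> 0" for P
    using that freq_facts(1)[OF slopes(2)] by (simp add: coord_Im)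
  define e where "e = exp (- (\<bar>left_exponent\<bar> * pi))"
  define e' where "e' = exp (\<bar>left_exponent\<bar> * pi)"
  \<comment> \<open>A common additive constant for both half planes, made of the offsets in
    \<open>potential_bounds\<close>; those of the right half carry the factor
    \<open>D\<close>.\<close>
  define C where "C = max (e * B + \<bar>left_slope\<bar> * pi) (e' * B + \<bar>left_slope\<bar> * pi) +
     D * max (e * B + \<bar>right_slope\<bar> * pi) (e' * B + \<bar>right_slope\<bar> * pi)"
  have ee: "e > 0" "e' > 0" by (simp_all add: e_def e'_def)
  have C1: "0 \<le> max (e * B + \<bar>left_slope\<bar> * pi) (e' * B + \<bar>left_slope\<bar> * pi)"
    "0 \<le> max (e * B + \<bar>right_slope\<bar> * pi) (e' * B + \<bar>right_slope\<bar> * pi)"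
    using ee m(2) by (simp_all add: le_max_iff_disj)
  then have C: "e * B + \<bar>left_slope\<bar> * pi \<le> C" "e' * B + \<bar>left_slope\<bar> * pi \<le> C"
    "D * (e * B + \<bar>right_slope\<bar> * pi) \<le> C" "D * (e' * B + \<bar>right_slope\<bar> * pi) \<le> C"
  proof -
    have "0 \<le> D * max (e * B + \<bar>right_slope\<bar> * pi) (e' * B + \<bar>right_slope\<bar> * pi)" using D C1 by simp
    then show "e * B + \<bar>left_slope\<bar> * pi \<le> C" "e' * B + \<bar>left_slope\<bar> * pi \<le> C" unfolding C_def by linarith+
    have "D * (e * B + \<bar>right_slope\<bar> * pi) \<le> D * max (e * B + \<bar>right_slope\<bar> * pi) (e' * B + \<bar>right_slope\<bar> * pi)"
      "D * (e' * B + \<bar>right_slope\<bar> * pi) \<le> D * max (e * B + \<bar>right_slope\<bar> * pi) (e' * B + \<bar>right_slope\<bar> * pi)"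
      using D by (intro mult_left_mono; simp)+
    then show "D * (e * B + \<bar>right_slope\<bar> * pi) \<le> C" "D * (e' * B + \<bar>right_slope\<bar> * pi) \<le> C"
      unfolding C_def using C1(1) by linarith+
  qed
  define m' where "m' = min (e * m) (D * (e * m))"
  define M where "M = max (e' * 2) (D * (e' * 2))"
  have "lyapunov_bounds R m' M C (min \<eta>l (D * \<eta>r))"
    unfolding lyapunov_bounds_def
  proof (intro conjI allI impI)
    show "R > 0" by (simp add: R_def)
    show "m' > 0" using ee m D by (simp add: m'_def)
    show "M > 0" using ee by (simp add: M_def less_max_iff_disj)
    show "min \<eta>l (D * \<eta>r) > 0" using Wl Wr D by simp
    show "continuous_on {P. norm P > R} lyapunov"
      unfolding lyapunov_def
    proof (rule continuous_on_cases_le)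
      show "continuous_on {P \<in> {P. norm P > R}. fst P \<le> 0} (\<lambda>P. potential left_exponent left_slope (left_coord P))"
        by (rule continuous_on_potential)
          (unfold left_coord_def, intro continuous_intros, use iml nz in \<open>simp add: left_coord_def\<close>)
      show "continuous_on {P \<in> {P. norm P > R}. 0 \<le> fst P}
          (\<lambda>P. exp (left_exponent * pi) * potential (- left_exponent) right_slope (right_coord P))"
        by (intro continuous_on_mult_left continuous_on_potential)
          (unfold right_coord_def, intro continuous_intros, use imr nz in \<open>simp add: right_coord_def\<close>)
      show "continuous_on {P. norm P > R} (fst :: real \<times> real \<Rightarrow> real)" by (intro continuous_intros)
      fix P :: "real \<times> real" assume P: "P \<in> {P. norm P > R}" "fst P = 0"
      have "P = (0, snd P)" using P(2) by (simp add: prod_eq_iff)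
      moreover have "norm P = \<bar>snd P\<bar>" using P(2) by (subst calculation) (simp add: norm_Pair)
      then have "\<bar>snd P\<bar> > \<bar>bl\<bar> + \<bar>br\<bar>" using P(1) by (simp add: R_def)
      from lyapunov_on_axis[OF this] calculation
      show "potential left_exponent left_slope (left_coord P) =
          exp (left_exponent * pi) * potential (- left_exponent) right_slope (right_coord P)" by simp
    qed
    fix P :: "real \<times> real" assume P: "norm P > R"
    show "P \<in> far" using P by (intro far_norm) (simp add: R_def)
    have mono: "m' * norm P \<le> e * m * norm P" "m' * norm P \<le> D * (e * m) * norm P"
      "e' * 2 * norm P \<le> M * norm P" "D * (e' * 2) * norm P \<le> M * norm P"
      by (intro mult_right_mono; simp add: m'_def M_def)+
    show "m' * norm P - C \<le> lyapunov P" "lyapunov P \<le> M * norm P + C"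
    proof -
      have "m' * norm P - C \<le> lyapunov P \<and> lyapunov P \<le> M * norm P + C"
      proof (cases "fst P \<le> 0")
        case True
        have "lyapunov P = potential left_exponent left_slope (left_coord P)" using True by (simp add: lyapunov_def)
        moreover note potential_bounds[OF iml[OF True] nz(1)[OF P] conjunct1[OF cl] conjunct2[OF cl],
            of left_exponent left_slope, folded e_def e'_def]
        ultimately show ?thesis using C(1,2) mono by linarith
      next
        case False
        have "lyapunov P = D * potential (- left_exponent) right_slope (right_coord P)"
          using False by (simp add: lyapunov_def D_def)
        moreover note pb = potential_bounds[OF imr nz(2)[OF P] conjunct1[OF cr] conjunct2[OF cr],
            of "- left_exponent" right_slope, unfolded abs_minus_cancel, folded e_def e'_def]
        have "D * (e * m * norm P - (e * B + \<bar>right_slope\<bar> * pi)) \<le> D * potential (- left_exponent) right_slope (right_coord P)"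
          "D * potential (- left_exponent) right_slope (right_coord P) \<le> D * (e' * 2 * norm P + (e' * B + \<bar>right_slope\<bar> * pi))"
          using pb False D by (intro mult_left_mono; simp)+
        then have "D * (e * m) * norm P - D * (e * B + \<bar>right_slope\<bar> * pi) \<le> D * potential (- left_exponent) right_slope (right_coord P)"
          "D * potential (- left_exponent) right_slope (right_coord P) \<le> D * (e' * 2) * norm P + D * (e' * B + \<bar>right_slope\<bar> * pi)"
          by (simp_all only: right_diff_distrib distrib_left mult.assoc)
        ultimately show ?thesis using C(3,4) mono by linarith
      qed
      then show "m' * norm P - C \<le> lyapunov P" "lyapunov P \<le> M * norm P + C" by simp_all
    qed
  next
    fix \<gamma> s assume n: "norm (\<gamma> s) > R" and x: "fst (\<gamma> s) \<noteq> 0"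
      and d: "(\<gamma> has_vector_derivative (F (fst (\<gamma> s)) - snd (\<gamma> s), fst (\<gamma> s))) (at s)"
    have "isCont \<gamma> s" using d by (rule has_vector_derivative_continuous)
    then have cont: "((\<lambda>t. fst (\<gamma> t)) \<longlongrightarrow> fst (\<gamma> s)) (nhds s)"
      unfolding isCont_def tendsto_at_iff_tendsto_nhds by (rule tendsto_fst)
    show "\<exists>D'\<ge>min \<eta>l (D * \<eta>r). ((\<lambda>t. lyapunov (\<gamma> t)) has_real_derivative D') (at s)"
    proof (cases "fst (\<gamma> s) < 0")
      case True
      let ?w = "left_coord (\<gamma> s)" and ?e = "- (F (fst (\<gamma> s)) - al * fst (\<gamma> s) - bl)"
      let ?q = "eigenvalue al * (?w + of_real ?e) / ?w"
      define G where "G = cmod ?w * exp (left_exponent * half_angle ?w) * (Re ?q + left_exponent * Im ?q) + left_slope * Im ?q"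
      have "\<eta>l \<le> G"
      proof (rule gl[OF RW(1)[OF n] iml _ _ G_def])
        show "fst (\<gamma> s) \<le> 0" using True by simp
        show "\<bar>?e\<bar> \<le> E" unfolding abs_minus_cancel using El[of "fst (\<gamma> s)"] True by simp
        show "Im ?w \<le> X" if "?e \<noteq> 0"
        proof -
          have "- fst (\<gamma> s) \<le> X" using El[of "fst (\<gamma> s)"] True that by simp
          \<comment> \<open>As the frequency is at most 1, the bound |x| \<le> X on the strip
            carries over to Im w.\<close>
          moreover have "freq al * (- fst (\<gamma> s)) \<le> 1 * (- fst (\<gamma> s))"
            using freq_facts(2)[OF slopes(1)] True by (intro mult_right_mono) auto
          ultimately show ?thesis by (simp add: coord_Im)
        qed
      qed
      moreover have der: "((\<lambda>t. potential left_exponent left_slope (left_coord (\<gamma> t))) has_real_derivative G) (at s)"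
        unfolding G_def by (rule potential_derivative[OF coord_derivative(1)[OF d] iml nz(1)[OF n]]) (use True in simp)
      have "\<forall>\<^sub>F t in nhds s. lyapunov (\<gamma> t) = potential left_exponent left_slope (left_coord (\<gamma> t))"
        using order_tendstoD(2)[OF cont True] by (rule eventually_mono) (simp add: lyapunov_def)
      from DERIV_cong_ev[OF refl this refl]
      have "((\<lambda>t. lyapunov (\<gamma> t)) has_real_derivative G) (at s)" using der by simp
      ultimately show ?thesis by (intro exI[of _ G]) (simp add: min_le_iff_disj)
    next
      case False
      then have pos: "fst (\<gamma> s) > 0" using x by simp
      let ?w = "right_coord (\<gamma> s)" and ?e = "F (fst (\<gamma> s)) - ar * fst (\<gamma> s) - br"
      let ?q = "eigenvalue ar * (?w + of_real ?e) / ?w"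
      define G where "G = cmod ?w * exp (- left_exponent * half_angle ?w) * (Re ?q + - left_exponent * Im ?q) + right_slope * Im ?q"
      have "\<eta>r \<le> G"
      proof (rule gr[OF RW(2)[OF n] imr _ _ G_def])
        show "fst (\<gamma> s) \<ge> 0" using pos by simp
        show "\<bar>?e\<bar> \<le> E" using Er[of "fst (\<gamma> s)"] pos by simp
        show "Im ?w \<le> X" if "?e \<noteq> 0"
        proof -
          have "fst (\<gamma> s) \<le> X" using Er[of "fst (\<gamma> s)"] pos that by simp
          moreover have "freq ar * fst (\<gamma> s) \<le> 1 * fst (\<gamma> s)"
            using freq_facts(2)[OF slopes(2)] pos by (intro mult_right_mono) auto
          ultimately show ?thesis by (simp add: coord_Im)
        qed
      qed
      then have "D * \<eta>r \<le> D * G" using D by (intro mult_left_mono) auto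
      moreover have "((\<lambda>t. potential (- left_exponent) right_slope (right_coord (\<gamma> t))) has_real_derivative G) (at s)"
        unfolding G_def by (rule potential_derivative[OF coord_derivative(2)[OF d] imr nz(2)[OF n]]) (use pos in simp)
      then have der: "((\<lambda>t. D * potential (- left_exponent) right_slope (right_coord (\<gamma> t))) has_real_derivative D * G) (at s)"
        by (rule DERIV_cmult)
      have "\<forall>\<^sub>F t in nhds s. lyapunov (\<gamma> t) = D * potential (- left_exponent) right_slope (right_coord (\<gamma> t))"
        using order_tendstoD(1)[OF cont pos] by (rule eventually_mono) (simp add: lyapunov_def D_def)
      from DERIV_cong_ev[OF refl this refl]
      have "((\<lambda>t. lyapunov (\<gamma> t)) has_real_derivative D * G) (at s)" using der by simp
      ultimately show ?thesis by (intro exI[of _ "D * G"]) (simp add: min_le_iff_disj)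
    qed
  qed
  then show thesis by (rule that)
qed

section \<open>Consequences for orbits: boundedness and spiralling\<close>

lemma lyapunov_boundsD:
  assumes "lyapunov_bounds R m M B \<eta>"
  shows "R > 0" "m > 0" "M > 0" "\<eta> > 0" "continuous_on {P. norm P > R} lyapunov"
    "norm P > R \<Longrightarrow> P \<in> far" "norm P > R \<Longrightarrow> m * norm P - B \<le> lyapunov P"
    "norm P > R \<Longrightarrow> lyapunov P \<le> M * norm P + B"
    "norm (\<gamma> s) > R \<Longrightarrow> fst (\<gamma> s) \<noteq> 0 \<Longrightarrow>
      (\<gamma> has_vector_derivative (F (fst (\<gamma> s)) - snd (\<gamma> s), fst (\<gamma> s))) (at s) \<Longrightarrow>
      \<exists>D\<ge>\<eta>. ((\<lambda>t. lyapunov (\<gamma> t)) has_real_derivative D) (at s)"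
  using assms unfolding lyapunov_bounds_def by blast+

lemma lyapunov_increase:
  assumes LB: "lyapunov_bounds R m M B \<eta>" and tr: "trajectory F \<gamma>" and ab: "a \<le> b"
    and far: "\<And>t. t \<in> {a..b} \<Longrightarrow> norm (\<gamma> t) > R"
  shows "lyapunov (\<gamma> a) + \<eta> * (b - a) \<le> lyapunov (\<gamma> b)"
proof (rule right_deriv_lower_bound[OF ab])
  show "continuous_on {a..b} (\<lambda>t. lyapunov (\<gamma> t))"
    by (rule continuous_on_compose2[OF lyapunov_boundsD(5)[OF LB] continuous_on_subset[OF trajectory_continuous[OF tr]]])
      (use far in auto)
  fix t assume t: "a \<le> t" "t < b"
  have "norm (\<gamma> t) > R" using far t by simp
  then have "\<gamma> t \<in> far" by (rule lyapunov_boundsD(6)[OF LB])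
  then obtain \<epsilon> where "\<epsilon> > 0" and cl: "\<forall>s. t < s \<and> s < t + \<epsilon> \<longrightarrow> fst (\<gamma> s) \<noteq> 0 \<and>
     (\<gamma> has_vector_derivative (F (fst (\<gamma> s)) - snd (\<gamma> s), fst (\<gamma> s))) (at s)"
    by (rule far_classical[OF tr])
  have "\<exists>D\<ge>\<eta>. ((\<lambda>t. lyapunov (\<gamma> t)) has_real_derivative D) (at s)" if s: "t < s" "s < t + \<epsilon>" "s < b" for s
    using cl s t by (intro lyapunov_boundsD(9)[OF LB] far) auto
  then show "\<exists>\<epsilon>>0. \<forall>s. t < s \<and> s < t + \<epsilon> \<and> s < b \<longrightarrow>
      (\<exists>D\<ge>\<eta>. ((\<lambda>t. lyapunov (\<gamma> t)) has_real_derivative D) (at s))" using \<open>\<epsilon> > 0\<close> by blast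
qed

text \<open>At a time before 0 with norm above R + 1, the Lyapunov value is at most the value at the
  next visit to the circle of radius R + 1, or at time 0 if there is no such visit before. Both are
  bounded in terms of \<open>R\<close> and \<open>norm (\<gamma> 0)\<close>.\<close>

lemma outward_negatively_bounded:
  assumes outward shows "near_infinity F negatively_bounded"
proof -
  obtain R m M B \<eta> where LB: "lyapunov_bounds R m M B \<eta>" using lyapunov_bounds_exist[OF assms] by metis
  note LD = lyapunov_boundsD[OF LB]
  have "negatively_bounded \<gamma>" if tr: "trajectory F \<gamma>" for \<gamma>
  proof -
    define N where "N = max (R + 1) ((max (M * (R + 1) + B) (M * norm (\<gamma> 0) + B) + B) / m)"
    have cont: "continuous_on A (\<lambda>t. norm (\<gamma> t))" for A
      using continuous_on_subset[OF trajectory_continuous[OF tr], of A] by (intro continuous_intros) auto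
    have "norm (\<gamma> t) \<le> N" if t: "t \<le> 0" for t
    proof (cases "norm (\<gamma> t) > R + 1")
      case True
      have "\<exists>u\<ge>t. (\<forall>r\<in>{t..u}. norm (\<gamma> r) > R) \<and> (norm (\<gamma> u) = R + 1 \<or> u = 0)"
      proof (cases "\<forall>r\<in>{t..0}. norm (\<gamma> r) > R + 1")
        case True
        then show ?thesis using t by (intro exI[of _ 0]) force
      next
        case False
        then obtain r where r: "r \<in> {t..0}" "norm (\<gamma> r) \<le> R + 1" by force
        obtain u where u: "t < u" "norm (\<gamma> u) = R + 1" "\<And>v. t \<le> v \<Longrightarrow> v < u \<Longrightarrow> norm (\<gamma> v) > R + 1"
          by (rule first_exit[OF cont True r]) blast
        have "norm (\<gamma> v) > R" if "v \<in> {t..u}" for v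
          using u(2) u(3)[of v] that by (cases "v = u") auto
        then show ?thesis using u(1,2) by (intro exI[of _ u]) auto
      qed
      then obtain u where u: "t \<le> u" "\<And>r. r \<in> {t..u} \<Longrightarrow> norm (\<gamma> r) > R" "norm (\<gamma> u) = R + 1 \<or> u = 0" by blast
      have "0 \<le> \<eta> * (u - t)" using LD(4) u(1) by simp
      then have "lyapunov (\<gamma> t) \<le> lyapunov (\<gamma> u)" using lyapunov_increase[OF LB tr u(1,2)] by linarith
      also have "\<dots> \<le> M * norm (\<gamma> u) + B" using u(1,2) by (intro LD(8)) simp
      also have "\<dots> \<le> max (M * (R + 1) + B) (M * norm (\<gamma> 0) + B)" using u(3) by auto
      finally have "m * norm (\<gamma> t) \<le> max (M * (R + 1) + B) (M * norm (\<gamma> 0) + B) + B"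
        using LD(7)[of "\<gamma> t"] True by linarith
      then have "norm (\<gamma> t) \<le> (max (M * (R + 1) + B) (M * norm (\<gamma> 0) + B) + B) / m"
        by (simp only: pos_le_divide_eq[OF LD(2)] mult.commute)
      then show ?thesis by (simp add: N_def le_max_iff_disj)
    qed (simp add: N_def le_max_iff_disj)
    then show ?thesis unfolding negatively_bounded_def by (intro boundedI[of _ N]) auto
  qed
  then show ?thesis unfolding near_infinity_def by (intro exI[of _ 1]) simp
qed

text \<open>Comparability with the norm turns the uniform growth of the Lyapunov function into
  growth of the norm that is at least linear in time. Rotation at a speed of at least
  \<open>c\<close> makes the angle diverge.\<close>

lemma outward_spirals:
  assumes outward shows "near_infinity F spirals_to_equator"
proof -
  obtain R m M B \<eta> where LB: "lyapunov_bounds R m M B \<eta>" using lyapunov_bounds_exist[OF assms] by metis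
  note LD = lyapunov_boundsD[OF LB]
  obtain R' c C where RB: "radius_bounds R' c C" by (rule radius_bounds_exist)
  define R1 where "R1 = max R R' + 1"
  have R1: "R1 > R" "R1 > R'" "R1 > 0" using LD(1) by (auto simp: R1_def)
  \<comment> \<open>Beyond \<open>R2\<close> the Lyapunov value at the start exceeds every value on
    the circle of radius \<open>R1\<close>, so the orbit can never return to that circle.\<close>
  define R2 where "R2 = max R1 ((M * R1 + B + B) / m)"
  have "spirals_to_equator \<gamma>" if tr: "trajectory F \<gamma>" and start: "norm (\<gamma> 0) > R2" for \<gamma>
  proof -
    have s1: "norm (\<gamma> 0) > R1" using start by (simp add: R2_def)
    have "norm (\<gamma> 0) > (M * R1 + B + B) / m" using start by (simp add: R2_def)
    then have s2: "M * R1 + B < m * norm (\<gamma> 0) - B"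
      using pos_divide_less_eq[OF LD(2), of "M * R1 + B + B" "norm (\<gamma> 0)"] by (simp add: mult.commute)
    have cont: "continuous_on A (\<lambda>t. norm (\<gamma> t))" for A
      using continuous_on_subset[OF trajectory_continuous[OF tr], of A] by (intro continuous_intros) auto
    have far: "norm (\<gamma> t) > R1" if t: "t \<ge> 0" for t
    proof (rule ccontr)
      assume "\<not> norm (\<gamma> t) > R1"
      then have t': "t \<in> {0..t}" "norm (\<gamma> t) \<le> R1" using t by auto
      obtain u where u: "0 < u" "norm (\<gamma> u) = R1" "\<And>v. 0 \<le> v \<Longrightarrow> v < u \<Longrightarrow> norm (\<gamma> v) > R1"
        by (rule first_exit[OF cont s1 t']) blast
      have uR: "norm (\<gamma> v) > R" if "v \<in> {0..u}" for v
        using u(2) u(3)[of v] that R1(1) by (cases "v = u") auto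
      have "0 \<le> \<eta> * (u - 0)" using LD(4) u(1) by simp
      then have "lyapunov (\<gamma> 0) \<le> lyapunov (\<gamma> u)"
        using lyapunov_increase[OF LB tr less_imp_le[OF u(1)] uR] by linarith
      also have "\<dots> \<le> M * R1 + B" using LD(8)[of "\<gamma> u"] u(2) R1(1) by simp
      finally show False using LD(7)[of "\<gamma> 0"] s1 s2 R1(1) by simp
    qed
    have lower: "(m * norm (\<gamma> 0) - B - B) / M + \<eta> / M * t \<le> norm (\<gamma> t)" if t: "t \<ge> 0" for t
    proof -
      have "norm (\<gamma> v) > R" if "v \<in> {0..t}" for v using far[of v] that R1(1) by simp
      then have "lyapunov (\<gamma> 0) + \<eta> * (t - 0) \<le> lyapunov (\<gamma> t)" by (intro lyapunov_increase[OF LB tr t])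
      then have "(m * norm (\<gamma> 0) - B - B) + \<eta> * t \<le> M * norm (\<gamma> t)"
        using LD(7)[of "\<gamma> 0"] LD(8)[of "\<gamma> t"] far[OF t] s1 R1(1) by simp
      then have "((m * norm (\<gamma> 0) - B - B) + \<eta> * t) / M \<le> norm (\<gamma> t)"
        by (simp only: pos_divide_le_eq[OF LD(3)] mult.commute)
      then show ?thesis by (simp add: add_divide_distrib)
    qed
    have lin: "filterlim (\<lambda>t::real. d + k * t) at_top at_top" if "k > 0" for d k :: real
      by (intro filterlim_tendsto_add_at_top[OF tendsto_const]
          filterlim_tendsto_pos_mult_at_top[OF tendsto_const that filterlim_ident])
    have norm_lim: "filterlim (\<lambda>t. norm (\<gamma> t)) at_top at_top"
    proof (rule filterlim_at_top_mono)
      show "filterlim (\<lambda>t. (m * norm (\<gamma> 0) - B - B) / M + \<eta> / M * t) at_top at_top"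
        using LD(3,4) by (intro lin) simp
      show "\<forall>\<^sub>F t in at_top. (m * norm (\<gamma> 0) - B - B) / M + \<eta> / M * t \<le> norm (\<gamma> t)"
        using eventually_ge_at_top[of 0] by (rule eventually_mono) (rule lower)
    qed
    have farR': "norm (\<gamma> t) > R'" if "t \<in> {0..}" for t using far[of t] that R1(2) by simp
    obtain \<theta> where \<theta>: "continuous_on {0..} \<theta>"
      "\<forall>t\<in>{0..}. \<gamma> t = norm (\<gamma> t) *\<^sub>R (cos (\<theta> t), sin (\<theta> t))"
      "\<forall>s\<in>{0..}. \<forall>t\<in>{0..}. s \<le> t \<longrightarrow> \<theta> s + c * (t - s) \<le> \<theta> t"
      using angle_lift[OF RB tr is_interval_ci farR'] by metis
    have "filterlim \<theta> at_top at_top"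
    proof (rule filterlim_at_top_mono)
      show "filterlim (\<lambda>t. \<theta> 0 + c * t) at_top at_top" using radius_boundsD(2)[OF RB] by (rule lin)
      show "\<forall>\<^sub>F t in at_top. \<theta> 0 + c * t \<le> \<theta> t"
        using eventually_ge_at_top[of 0] by (rule eventually_mono) (use \<theta>(3) in force)
    qed
    then show ?thesis unfolding spirals_to_equator_def using norm_lim \<theta>(1,2) by (intro conjI exI[of _ \<theta>] exI[of _ 0]) auto
  qed
  moreover have "R2 > 0" using R1(3) by (simp add: R2_def less_max_iff_disj)
  ultimately show ?thesis unfolding near_infinity_def by (intro exI[of _ R2]) simp
qed

text \<open>The tails are interchanged, with slopes negated and intercepts kept. Hence
  \<open>outward\<close> for the reversed system says al + ar < 0, or al + ar = 0 and br <
  bl.\<close>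

lemma planar_pwl_reflect: "planar_pwl (\<lambda>x. F (- x)) (- ar) br (- al) bl X K"
proof
  show "\<exists>p q. \<forall>\<^sub>F u in at_right x. F (- u) = p * u + q" for x
  proof -
    obtain p q where "\<forall>\<^sub>F u in at_left (- x). F u = p * u + q" using affine_left by blast
    then have "\<forall>\<^sub>F u in at_right x. F (- u) = - p * u + q"
      by (simp add: at_left_minus eventually_filtermap)
    then show ?thesis by blast
  qed
  show "\<exists>p q. \<forall>\<^sub>F u in at_left x. F (- u) = p * u + q" for x
  proof -
    obtain p q where "\<forall>\<^sub>F u in at_right (- x). F u = p * u + q" using affine_right by blast
    then have "\<forall>\<^sub>F u in at_left x. F (- u) = - p * u + q"
      by (simp add: at_right_minus eventually_filtermap)
    then show ?thesis by blast
  qed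
  show "F (- x) = - al * x + bl" if "X < x" for x using tail_left[of "- x"] that by simp
  show "F (- x) = - ar * x + br" if "x < - X" for x using tail_right[of "- x"] that by simp
  show "\<bar>F (- x)\<bar> \<le> K + 2 * \<bar>x\<bar>" for x using bound[of "- x"] by simp
qed (use X K slopes in simp_all)

end

lemma spirals_to_equator_mirror:
  assumes "spirals_to_equator (\<lambda>t. mirror (\<gamma> t))" shows "spirals_to_equator \<gamma>"
proof -
  obtain \<theta> T where \<theta>: "continuous_on {T..} \<theta>"
      "\<forall>t\<ge>T. mirror (\<gamma> t) = norm (\<gamma> t) *\<^sub>R (cos (\<theta> t), sin (\<theta> t))"
      "filterlim \<theta> at_top at_top \<or> filterlim \<theta> at_bot at_top"
    and n: "filterlim (\<lambda>t. norm (\<gamma> t)) at_top at_top"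
    using assms unfolding spirals_to_equator_def by auto
  have "\<gamma> t = norm (\<gamma> t) *\<^sub>R (cos (pi - \<theta> t), sin (pi - \<theta> t))" if "t \<ge> T" for t
    using arg_cong[OF \<theta>(2)[rule_format, OF that], of fst] arg_cong[OF \<theta>(2)[rule_format, OF that], of snd]
    by (simp add: prod_eq_iff)
  moreover have "continuous_on {T..} (\<lambda>t. pi - \<theta> t)" by (intro continuous_intros \<theta>)
  moreover have "filterlim (\<lambda>t. pi - \<theta> t) at_top at_top \<or> filterlim (\<lambda>t. pi - \<theta> t) at_bot at_top"
    using \<theta>(3)
  proof
    assume "filterlim \<theta> at_top at_top"
    then have "filterlim (\<lambda>t. - pi + \<theta> t) at_top at_top"
      by (rule filterlim_tendsto_add_at_top[OF tendsto_const])
    then have "filterlim (\<lambda>t. pi - \<theta> t) at_bot at_top" by (simp add: filterlim_uminus_at_bot)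
    then show ?thesis by simp
  next
    assume "filterlim \<theta> at_bot at_top"
    then have "filterlim (\<lambda>t. - \<theta> t) at_top at_top" by (simp add: filterlim_uminus_at_bot)
    then have "filterlim (\<lambda>t. pi + - \<theta> t) at_top at_top"
      by (rule filterlim_tendsto_add_at_top[OF tendsto_const])
    then show ?thesis by simp
  qed
  ultimately show ?thesis unfolding spirals_to_equator_def using n by blast
qed

text \<open>A periodic orbit is back at \<open>\<gamma> 0\<close> at arbitrarily late and
  arbitrarily early times, so its norm cannot diverge in either direction of time. \<open>s\<close>
  selects the direction.\<close>

lemma spiral_not_closed:
  assumes s: "s = 1 \<or> s = (-1::real)" and sp: "spirals_to_equator (\<lambda>t. \<gamma> (s * t))"
  shows "\<not> closed_orbit \<gamma>"
proof
  assume "closed_orbit \<gamma>"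
  then obtain T where T: "T > 0" "\<And>t. \<gamma> (t + T) = \<gamma> t" unfolding closed_orbit_def by blast
  have up: "\<gamma> (of_nat n * T) = \<gamma> 0" for n
    using T(2)[of "of_nat n * T" for n] by (induction n) (simp_all add: algebra_simps)
  have down: "\<gamma> (- (of_nat n * T)) = \<gamma> 0" for n
  proof (induction n)
    case (Suc n)
    then show ?case using T(2)[of "- (of_nat (Suc n) * T)"] by (simp add: algebra_simps)
  qed simp
  have per: "\<gamma> (s * (of_nat n * T)) = \<gamma> 0" for n using s up[of n] down[of n] by auto
  have "filterlim (\<lambda>t. norm (\<gamma> (s * t))) at_top at_top" using sp by (simp add: spirals_to_equator_def)
  then have "\<forall>\<^sub>F t in at_top. norm (\<gamma> (s * t)) > norm (\<gamma> 0)" by (simp add: filterlim_at_top_dense)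
  then obtain N where N: "\<And>t. t \<ge> N \<Longrightarrow> norm (\<gamma> (s * t)) > norm (\<gamma> 0)" unfolding eventually_at_top_linorder by blast
  obtain n :: nat where "of_nat n > N / T" using reals_Archimedean2 by blast
  then have "of_nat n * T \<ge> N" using T(1) by (simp add: field_simps)
  from N[OF this] show False using per by simp
qed

section \<open>Piecewise linear functions\<close>

context
  fixes F :: "real \<Rightarrow> real" and a b :: real and \<alpha> \<beta> \<xi> :: "nat \<Rightarrow> real" and n :: nat
  assumes F: "\<And>x. F x = a * x + b + (\<Sum>i=1..n. \<alpha> i * \<bar>x - \<xi> i\<bar>) + (\<Sum>i=1..n. \<beta> i * sgn (x - \<xi> i))"
begin

lemma pwl_tail_right:
  assumes "\<And>i. i \<in> {1..n} \<Longrightarrow> \<xi> i < x"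
  shows "F x = (a + (\<Sum>i=1..n. \<alpha> i)) * x + (b + (\<Sum>i=1..n. - \<alpha> i * \<xi> i + \<beta> i))"
proof -
  have "(\<Sum>i=1..n. \<alpha> i * \<bar>x - \<xi> i\<bar>) = (\<Sum>i=1..n. \<alpha> i * x - \<alpha> i * \<xi> i)"
    by (rule sum.cong[OF refl]) (simp add: assms less_imp_le abs_of_nonneg right_diff_distrib)
  also have "\<dots> = (\<Sum>i=1..n. \<alpha> i) * x - (\<Sum>i=1..n. \<alpha> i * \<xi> i)"
    by (simp only: sum_subtractf sum_distrib_right)
  finally have 1: "(\<Sum>i=1..n. \<alpha> i * \<bar>x - \<xi> i\<bar>) = (\<Sum>i=1..n. \<alpha> i) * x - (\<Sum>i=1..n. \<alpha> i * \<xi> i)" .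
  have 2: "(\<Sum>i=1..n. \<beta> i * sgn (x - \<xi> i)) = (\<Sum>i=1..n. \<beta> i)"
    by (rule sum.cong[OF refl]) (simp add: assms)
  have 3: "(\<Sum>i=1..n. - \<alpha> i * \<xi> i + \<beta> i) = - (\<Sum>i=1..n. \<alpha> i * \<xi> i) + (\<Sum>i=1..n. \<beta> i)"
    by (simp add: sum.distrib sum_negf sum_subtractf)
  show ?thesis unfolding F 1 2 3 by (simp add: algebra_simps)
qed

lemma pwl_tail_left:
  assumes "\<And>i. i \<in> {1..n} \<Longrightarrow> x < \<xi> i"
  shows "F x = (a - (\<Sum>i=1..n. \<alpha> i)) * x + (b + (\<Sum>i=1..n. \<alpha> i * \<xi> i - \<beta> i))"
proof -
  have "(\<Sum>i=1..n. \<alpha> i * \<bar>x - \<xi> i\<bar>) = (\<Sum>i=1..n. \<alpha> i * \<xi> i - \<alpha> i * x)"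
    by (rule sum.cong[OF refl]) (simp add: assms less_imp_le abs_of_nonpos right_diff_distrib)
  also have "\<dots> = (\<Sum>i=1..n. \<alpha> i * \<xi> i) - (\<Sum>i=1..n. \<alpha> i) * x"
    by (simp only: sum_subtractf sum_distrib_right)
  finally have 1: "(\<Sum>i=1..n. \<alpha> i * \<bar>x - \<xi> i\<bar>) = (\<Sum>i=1..n. \<alpha> i * \<xi> i) - (\<Sum>i=1..n. \<alpha> i) * x" .
  have "(\<Sum>i=1..n. \<beta> i * sgn (x - \<xi> i)) = (\<Sum>i=1..n. - \<beta> i)"
    by (rule sum.cong[OF refl]) (simp add: assms)
  then have 2: "(\<Sum>i=1..n. \<beta> i * sgn (x - \<xi> i)) = - (\<Sum>i=1..n. \<beta> i)"
    by (simp only: sum_negf)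
  show ?thesis unfolding F 1 2 sum_subtractf by (simp add: algebra_simps)
qed

text \<open>Sums of functions affine near \<open>x\<close> on one side are again of this kind. On
  one side of \<open>x\<close> and close to it the argument stays on one side of every knot,
  including a knot at \<open>x\<close> itself.\<close>

lemma pwl_one_sided_affine:
  assumes G: "G = at_left x \<or> G = at_right (x :: real)"
  shows "\<exists>p q. \<forall>\<^sub>F u in G. F u = p * u + q"
proof -
  define aff where "aff f \<longleftrightarrow> (\<exists>p q. \<forall>\<^sub>F u in G. f u = p * u + q)" for f :: "real \<Rightarrow> real"
  have add: "aff (\<lambda>u. f u + g u)" if f: "aff f" and g: "aff g" for f g
  proof -
    obtain p q where 1: "\<forall>\<^sub>F u in G. f u = p * u + q" using f unfolding aff_def by blast
    obtain p' q' where 2: "\<forall>\<^sub>F u in G. g u = p' * u + q'" using g unfolding aff_def by blast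
    have "\<forall>\<^sub>F u in G. f u + g u = (p + p') * u + (q + q')"
      using 1 2 by eventually_elim (simp add: algebra_simps)
    then show ?thesis unfolding aff_def by blast
  qed
  have sum: "aff (\<lambda>u. \<Sum>i\<in>A. f i u)" if "finite A" "\<And>i. i \<in> A \<Longrightarrow> aff (f i)" for A :: "nat set" and f
    using that
  proof (induction A rule: finite_induct)
    case empty
    show ?case unfolding aff_def by (intro exI[of _ 0]) simp
  qed (simp add: add)
  have side: "(\<forall>\<^sub>F u in G. u < c) \<or> (\<forall>\<^sub>F u in G. u > c)" for c
  proof -
    have lim: "((\<lambda>u. u) \<longlongrightarrow> x) G" using G by (auto intro: tendsto_ident_at)
    consider "x < c" | "c < x" | "c = x" by linarith
    then show ?thesis
    proof cases
      case 1 then show ?thesis using order_tendstoD(2)[OF lim] by blast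
    next
      case 2 then show ?thesis using order_tendstoD(1)[OF lim] by blast
    next
      case 3 then show ?thesis using G by (auto simp: eventually_at_filter)
    qed
  qed
  have abs: "aff (\<lambda>u. k * \<bar>u - c\<bar>)" for k c
    using side[of c]
  proof
    assume "\<forall>\<^sub>F u in G. u < c"
    then have "\<forall>\<^sub>F u in G. k * \<bar>u - c\<bar> = - k * u + k * c"
      by (rule eventually_mono) (simp add: abs_of_nonpos algebra_simps)
    then show ?thesis unfolding aff_def by blast
  next
    assume "\<forall>\<^sub>F u in G. u > c"
    then have "\<forall>\<^sub>F u in G. k * \<bar>u - c\<bar> = k * u + - k * c"
      by (rule eventually_mono) (simp add: abs_of_nonneg algebra_simps)
    then show ?thesis unfolding aff_def by blast
  qed
  have sg: "aff (\<lambda>u. k * sgn (u - c))" for k c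
    using side[of c]
  proof
    assume "\<forall>\<^sub>F u in G. u < c"
    then have "\<forall>\<^sub>F u in G. k * sgn (u - c) = 0 * u + - k" by (rule eventually_mono) simp
    then show ?thesis unfolding aff_def by blast
  next
    assume "\<forall>\<^sub>F u in G. u > c"
    then have "\<forall>\<^sub>F u in G. k * sgn (u - c) = 0 * u + k" by (rule eventually_mono) simp
    then show ?thesis unfolding aff_def by blast
  qed
  have "\<forall>\<^sub>F u in G. a * u + b = a * u + b" by simp
  then have A: "aff (\<lambda>u. a * u + b)" unfolding aff_def by blast
  have "aff (\<lambda>u. a * u + b + (\<Sum>i=1..n. \<alpha> i * \<bar>u - \<xi> i\<bar>) + (\<Sum>i=1..n. \<beta> i * sgn (u - \<xi> i)))"
    by (rule add[OF add[OF A sum] sum]) (simp_all add: abs sg)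
  then show ?thesis unfolding aff_def F[symmetric] .
qed

lemma pwl_bounded:
  obtains K where "K \<ge> 0" "\<And>x. \<bar>x\<bar> \<le> X \<Longrightarrow> \<bar>F x\<bar> \<le> K"
proof
  define K where "K = \<bar>a\<bar> * \<bar>X\<bar> + \<bar>b\<bar> + (\<Sum>i=1..n. \<bar>\<alpha> i\<bar> * (\<bar>X\<bar> + \<bar>\<xi> i\<bar>)) + (\<Sum>i=1..n. \<bar>\<beta> i\<bar>)"
  show "K \<ge> 0" unfolding K_def by (intro add_nonneg_nonneg sum_nonneg mult_nonneg_nonneg) auto
  fix x assume x: "\<bar>x\<bar> \<le> X"
  have "\<bar>a * x\<bar> \<le> \<bar>a\<bar> * \<bar>X\<bar>" unfolding abs_mult using x by (intro mult_left_mono) auto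
  moreover have "\<bar>\<Sum>i=1..n. \<alpha> i * \<bar>x - \<xi> i\<bar>\<bar> \<le> (\<Sum>i=1..n. \<bar>\<alpha> i\<bar> * (\<bar>X\<bar> + \<bar>\<xi> i\<bar>))"
    by (rule order_trans[OF sum_abs sum_mono]) (unfold abs_mult, intro mult_left_mono, use x in auto)
  moreover have "\<bar>\<Sum>i=1..n. \<beta> i * sgn (x - \<xi> i)\<bar> \<le> (\<Sum>i=1..n. \<bar>\<beta> i\<bar>)"
    by (rule order_trans[OF sum_abs sum_mono]) (simp add: abs_mult sgn_if)
  ultimately show "\<bar>F x\<bar> \<le> K" unfolding F K_def by linarith
qed

end

section \<open>Assembly: types of the equilibria, center and focus\<close>

theorem theorem1:
  fixes F :: "real \<Rightarrow> real" and a b al bl ar br :: real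
    and \<alpha> \<beta> \<xi> :: "nat \<Rightarrow> real" and n :: nat
  assumes n: "n \<ge> 1"
    and F: "\<And>x. F x = a * x + b + (\<Sum>i=1..n. \<alpha> i * \<bar>x - \<xi> i\<bar>) + (\<Sum>i=1..n. \<beta> i * sgn (x - \<xi> i))"
    and nonzero: "\<And>i. i \<in> {1..n} \<Longrightarrow> ((\<alpha> i)\<^sup>2 + (\<beta> i)\<^sup>2) * \<xi> i \<noteq> 0"
    and ordered: "strict_mono_on {1..n} \<xi>"
    and al: "al = a - (\<Sum>i=1..n. \<alpha> i)"
    and bl: "bl = b + (\<Sum>i=1..n. \<alpha> i * \<xi> i - \<beta> i)"
    and ar: "ar = a + (\<Sum>i=1..n. \<alpha> i)"
    and br: "br = b + (\<Sum>i=1..n. - \<alpha> i * \<xi> i + \<beta> i)"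
    and ar_nonneg: "ar \<ge> 0"
  shows
    "(\<not> (0 \<le> ar \<and> ar < 2 \<and> - 2 < al \<and> al < 2) \<longrightarrow>
        \<comment> \<open>right half plane\<close>
        (ar > 2 \<longrightarrow>
           {p \<in> equilibria_at_infinity F. fst p > 0} =
             {right_end ((ar - sqrt (ar\<^sup>2 - 4)) / 2), right_end ((ar + sqrt (ar\<^sup>2 - 4)) / 2)} \<and>
           stable_node F (right_end ((ar - sqrt (ar\<^sup>2 - 4)) / 2)) \<and>
           saddle F (right_end ((ar + sqrt (ar\<^sup>2 - 4)) / 2))) \<and>
        (ar = 2 \<longrightarrow>
           {p \<in> equilibria_at_infinity F. fst p > 0} = {right_end 1} \<and>
           saddle_node F (right_end 1)) \<and>
        (0 \<le> ar \<and> ar < 2 \<longrightarrow> {p \<in> equilibria_at_infinity F. fst p > 0} = {}) \<and>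
        \<comment> \<open>left half plane\<close>
        (al > 2 \<longrightarrow>
           {p \<in> equilibria_at_infinity F. fst p < 0} =
             {left_end ((al - sqrt (al\<^sup>2 - 4)) / 2), left_end ((al + sqrt (al\<^sup>2 - 4)) / 2)} \<and>
           stable_node F (left_end ((al - sqrt (al\<^sup>2 - 4)) / 2)) \<and>
           saddle F (left_end ((al + sqrt (al\<^sup>2 - 4)) / 2))) \<and>
        (al = 2 \<longrightarrow>
           {p \<in> equilibria_at_infinity F. fst p < 0} = {left_end 1} \<and>
           saddle_node F (left_end 1)) \<and>
        (- 2 < al \<and> al < 2 \<longrightarrow> {p \<in> equilibria_at_infinity F. fst p < 0} = {}) \<and>
        (al = - 2 \<longrightarrow>
           {p \<in> equilibria_at_infinity F. fst p < 0} = {left_end (- 1)} \<and>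
           saddle_node F (left_end (- 1))) \<and>
        (al < - 2 \<longrightarrow>
           {p \<in> equilibria_at_infinity F. fst p < 0} =
             {left_end ((al + sqrt (al\<^sup>2 - 4)) / 2), left_end ((al - sqrt (al\<^sup>2 - 4)) / 2)} \<and>
           unstable_node F (left_end ((al + sqrt (al\<^sup>2 - 4)) / 2)) \<and>
           saddle F (left_end ((al - sqrt (al\<^sup>2 - 4)) / 2))) \<and>
        \<comment> \<open>ends of the \<open>y\<close>-axis\<close>
        {p \<in> equilibria_at_infinity F. fst p = 0} = {}) \<and>
     (0 \<le> ar \<and> ar < 2 \<and> - 2 < al \<and> al < 2 \<longrightarrow>
        equilibria_at_infinity F = {} \<and>
        ((\<forall>x>0. F x = F (- x)) \<longrightarrow> center_at_infinity F) \<and>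
        (\<not> (\<forall>x>0. F x = F (- x)) \<and> \<not> (\<forall>x > max \<bar>\<xi> 1\<bar> \<bar>\<xi> n\<bar>. F x = F (- x)) \<longrightarrow>
           focus_at_infinity F \<and>
           (al + ar < 0 \<or> al + ar = 0 \<and> br < bl \<longrightarrow> near_infinity F positively_bounded) \<and>
           (al + ar > 0 \<or> al + ar = 0 \<and> br > bl \<longrightarrow> near_infinity F negatively_bounded)))"
proof -
  \<comment> \<open>Exceeds every \<open>\<bar>\<xi> i\<bar>\<close> by at least 1, so both tails
    begin at \<open>X\<close>.\<close>
  define X where "X = (\<Sum>i=1..n. \<bar>\<xi> i\<bar>) + 1"
  have \<xi>X: "\<bar>\<xi> i\<bar> < X" if "i \<in> {1..n}" for i
    using member_le_sum[OF that, of "\<lambda>i. \<bar>\<xi> i\<bar>"] by (simp add: X_def)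
  have X: "X > 0" unfolding X_def by (rule add_nonneg_pos) (auto intro: sum_nonneg)
  have right: "F x = ar * x + br" if "\<And>i. i \<in> {1..n} \<Longrightarrow> \<xi> i < x" for x
    unfolding ar br by (rule pwl_tail_right[OF F that])
  have left: "F x = al * x + bl" if "\<And>i. i \<in> {1..n} \<Longrightarrow> x < \<xi> i" for x
    unfolding al bl by (rule pwl_tail_left[OF F that])
  have tail_right: "F x = ar * x + br" if "x > X" for x
  proof (rule right)
    show "\<xi> i < x" if "i \<in> {1..n}" for i using \<xi>X[OF that] \<open>x > X\<close> by linarith
  qed
  have tail_left: "F x = al * x + bl" if "x < - X" for x
  proof (rule left)
    show "x < \<xi> i" if "i \<in> {1..n}" for i using \<xi>X[OF that] \<open>x < - X\<close> by linarith
  qed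
  have R: "affine_tail F 1 ar br X" and L: "affine_tail F (-1) al bl X"
    by unfold_locales (use X tail_right tail_left in simp_all)
  have eR: "{p \<in> equilibria_at_infinity F. fst p > 0} = {p \<in> equilibria_at_infinity F. sgn (fst p) = 1}"
    and eL: "{p \<in> equilibria_at_infinity F. fst p < 0} = {p \<in> equilibria_at_infinity F. sgn (fst p) = -1}"
    by (simp_all only: sgn_1_pos sgn_1_neg)
  have R_hyp: "{p \<in> equilibria_at_infinity F. fst p > 0} =
             {right_end ((ar - sqrt (ar\<^sup>2 - 4)) / 2), right_end ((ar + sqrt (ar\<^sup>2 - 4)) / 2)} \<and>
           stable_node F (right_end ((ar - sqrt (ar\<^sup>2 - 4)) / 2)) \<and>
           saddle F (right_end ((ar + sqrt (ar\<^sup>2 - 4)) / 2))" if "ar > 2"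
    using affine_tail.equilibria_hyperbolic[OF R] affine_tail.hyperbolic_types(1)[OF R] that
    unfolding eR end_at_eqs by simp
  have R_sn: "{p \<in> equilibria_at_infinity F. fst p > 0} = {right_end 1} \<and> saddle_node F (right_end 1)" if "ar = 2"
    using affine_tail.equilibria_saddle_node[OF R, of 1] that unfolding eR end_at_eqs by simp
  have R_none: "{p \<in> equilibria_at_infinity F. fst p > 0} = {}" if "0 \<le> ar \<and> ar < 2"
    using affine_tail.equilibria_none[OF R] that unfolding eR by simp
  have L_hyp1: "{p \<in> equilibria_at_infinity F. fst p < 0} =
             {left_end ((al - sqrt (al\<^sup>2 - 4)) / 2), left_end ((al + sqrt (al\<^sup>2 - 4)) / 2)} \<and>
           stable_node F (left_end ((al - sqrt (al\<^sup>2 - 4)) / 2)) \<and>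
           saddle F (left_end ((al + sqrt (al\<^sup>2 - 4)) / 2))" if "al > 2"
    using affine_tail.equilibria_hyperbolic[OF L] affine_tail.hyperbolic_types(1)[OF L] that
    unfolding eL end_at_eqs by simp
  have L_sn1: "{p \<in> equilibria_at_infinity F. fst p < 0} = {left_end 1} \<and> saddle_node F (left_end 1)" if "al = 2"
    using affine_tail.equilibria_saddle_node[OF L, of 1] that unfolding eL end_at_eqs by simp
  have L_none: "{p \<in> equilibria_at_infinity F. fst p < 0} = {}" if "- 2 < al \<and> al < 2"
    using affine_tail.equilibria_none[OF L] that unfolding eL by (simp add: abs_less_iff)
  have L_sn2: "{p \<in> equilibria_at_infinity F. fst p < 0} = {left_end (- 1)} \<and> saddle_node F (left_end (- 1))" if "al = - 2"
    using affine_tail.equilibria_saddle_node[OF L, of "-1"] that unfolding eL end_at_eqs by simp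
  have L_hyp2: "{p \<in> equilibria_at_infinity F. fst p < 0} =
             {left_end ((al + sqrt (al\<^sup>2 - 4)) / 2), left_end ((al - sqrt (al\<^sup>2 - 4)) / 2)} \<and>
           unstable_node F (left_end ((al + sqrt (al\<^sup>2 - 4)) / 2)) \<and>
           saddle F (left_end ((al - sqrt (al\<^sup>2 - 4)) / 2))" if "al < - 2"
    using affine_tail.equilibria_hyperbolic[OF L] affine_tail.hyperbolic_types(2)[OF L] that
    unfolding eL end_at_eqs by (simp add: insert_commute)
  have part_B: "equilibria_at_infinity F = {} \<and>
        ((\<forall>x>0. F x = F (- x)) \<longrightarrow> center_at_infinity F) \<and>
        (\<not> (\<forall>x>0. F x = F (- x)) \<and> \<not> (\<forall>x > max \<bar>\<xi> 1\<bar> \<bar>\<xi> n\<bar>. F x = F (- x)) \<longrightarrow>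
           focus_at_infinity F \<and>
           (al + ar < 0 \<or> al + ar = 0 \<and> br < bl \<longrightarrow> near_infinity F positively_bounded) \<and>
           (al + ar > 0 \<or> al + ar = 0 \<and> br > bl \<longrightarrow> near_infinity F negatively_bounded))"
    if small: "0 \<le> ar \<and> ar < 2 \<and> - 2 < al \<and> al < 2"
  proof -
    obtain K0 where K0: "K0 \<ge> 0" "\<And>x. \<bar>x\<bar> \<le> X \<Longrightarrow> \<bar>F x\<bar> \<le> K0" using pwl_bounded[OF F] by metis
    \<comment> \<open>On the strip F is bounded by \<open>K0\<close>; outside it |F x| is at most 2
      |x| plus the modulus of an intercept.\<close>
    define K where "K = K0 + \<bar>bl\<bar> + \<bar>br\<bar>"
    have bound: "\<bar>F x\<bar> \<le> K + 2 * \<bar>x\<bar>" for x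
    proof -
      have *: "\<bar>c * x\<bar> \<le> 2 * \<bar>x\<bar>" if "\<bar>c\<bar> \<le> 2" for c unfolding abs_mult using that by (rule mult_right_mono) simp
      have "\<bar>ar * x\<bar> \<le> 2 * \<bar>x\<bar>" "\<bar>al * x\<bar> \<le> 2 * \<bar>x\<bar>" by (intro *; use small in linarith)+
      then show ?thesis
        using tail_right[of x] tail_left[of x] K0(1) K0(2)[of x] unfolding K_def by linarith
    qed
    have one_sided: "\<exists>p q. \<forall>\<^sub>F u in at_right x. F u = p * u + q" "\<exists>p q. \<forall>\<^sub>F u in at_left x. F u = p * u + q" for x
      using pwl_one_sided_affine[OF F, of "at_right x" x] pwl_one_sided_affine[OF F, of "at_left x" x] by simp_all
    interpret planar_pwl F al bl ar br X K
    proof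
      show "\<exists>p q. \<forall>\<^sub>F u in at_right x. F u = p * u + q" for x by (rule one_sided)
      show "\<exists>p q. \<forall>\<^sub>F u in at_left x. F u = p * u + q" for x by (rule one_sided)
      show "\<bar>F x\<bar> \<le> K + 2 * \<bar>x\<bar>" for x by (rule bound)
      show "K \<ge> 0" using K0(1) by (simp add: K_def)
      show "\<bar>al\<bar> < 2" "\<bar>ar\<bar> < 2" using small by (simp_all add: abs_less_iff)
      show "X > 0" by (rule X)
      show "F x = ar * x + br" if "X < x" for x using that by (rule tail_right)
      show "F x = al * x + bl" if "x < - X" for x using that by (rule tail_left)
    qed
    interpret rev: planar_pwl "\<lambda>x. F (- x)" "- ar" br "- al" bl X K by (rule planar_pwl_reflect)
    have empty: "equilibria_at_infinity F = {}"
    proof -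
      have "p \<notin> equilibria_at_infinity F" for p
      proof
        assume p: "p \<in> equilibria_at_infinity F"
        consider "fst p > 0" | "fst p < 0" | "fst p = 0" by linarith
        then have "p \<in> {p \<in> equilibria_at_infinity F. fst p > 0} \<or> p \<in> {p \<in> equilibria_at_infinity F. fst p < 0} \<or>
            p \<in> {p \<in> equilibria_at_infinity F. fst p = 0}" by cases (simp_all only: p mem_Collect_eq simp_thms)
        moreover have s: "0 \<le> ar \<and> ar < 2" "- 2 < al \<and> al < 2" using small by simp_all
        ultimately show False unfolding R_none[OF s(1)] L_none[OF s(2)] no_equilibria_on_y_axis by simp
      qed
      then show ?thesis by (metis equals0I)
    qed
    then have loop: "equator_closed_or_loop F" by (simp add: equator_closed_or_loop_def)
    have center: "center_at_infinity F" if even: "\<forall>x>0. F x = F (- x)"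
    proof -
      have "F (- x) = F x" for x
        using even[rule_format, of x] even[rule_format, of "- x"] by (cases x "0::real" rule: linorder_cases) auto
      then show ?thesis unfolding center_at_infinity_def using loop even_near_infinity by simp
    qed
    have rev_traj: "trajectory (\<lambda>x. F (- x)) (\<lambda>t. mirror (\<gamma> (- t)))" if "trajectory F \<gamma>" for \<gamma>
      using that by (rule trajectory_reflect)
    have pos: "near_infinity F positively_bounded" if out: "rev.outward"
    proof -
      obtain R where R: "R > 0" "\<forall>\<gamma>. trajectory (\<lambda>x. F (- x)) \<gamma> \<and> norm (\<gamma> 0) > R \<longrightarrow> negatively_bounded \<gamma>"
        using rev.outward_negatively_bounded[OF out] unfolding near_infinity_def by (elim exE conjE) (rule that)
      have "positively_bounded \<gamma>" if \<gamma>: "trajectory F \<gamma> \<and> norm (\<gamma> 0) > R" for \<gamma>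
      proof -
        have "negatively_bounded (\<lambda>t. mirror (\<gamma> (- t)))"
          using R(2)[rule_format, of "\<lambda>t. mirror (\<gamma> (- t))"] rev_traj \<gamma> by simp
        then obtain N where N: "\<forall>t\<in>{..0}. norm (mirror (\<gamma> (- t))) \<le> N"
          unfolding negatively_bounded_def bounded_iff by auto
        have "norm (\<gamma> t) \<le> N" if "t \<ge> 0" for t using N[rule_format, of "- t"] that by simp
        then show ?thesis unfolding positively_bounded_def by (intro boundedI[of _ N]) auto
      qed
      then show ?thesis unfolding near_infinity_def using R(1) by (intro exI[of _ R] conjI allI impI)
    qed
    have rev_spiral: "near_infinity F (\<lambda>\<gamma>. spirals_to_equator (\<lambda>t. \<gamma> (- t)))" if out: "rev.outward"
    proof -
      obtain R where R: "R > 0" "\<forall>\<gamma>. trajectory (\<lambda>x. F (- x)) \<gamma> \<and> norm (\<gamma> 0) > R \<longrightarrow> spirals_to_equator \<gamma>"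
        using rev.outward_spirals[OF out] unfolding near_infinity_def by (elim exE conjE) (rule that)
      have "spirals_to_equator (\<lambda>t. \<gamma> (- t))" if \<gamma>: "trajectory F \<gamma> \<and> norm (\<gamma> 0) > R" for \<gamma>
      proof (rule spirals_to_equator_mirror)
        show "spirals_to_equator (\<lambda>t. mirror (\<gamma> (- t)))"
          using R(2)[rule_format, of "\<lambda>t. mirror (\<gamma> (- t))"] rev_traj \<gamma> by simp
      qed
      then show ?thesis unfolding near_infinity_def using R(1) by (intro exI[of _ R] conjI allI impI)
    qed
    \<comment> \<open>\<open>s\<close> is the direction of time in which orbits approach the
      equator: 1 if the system is \<open>outward\<close>, -1 if its reversal is.\<close>
    have focusI: "focus_at_infinity F"
      if "near_infinity F (\<lambda>\<gamma>. spirals_to_equator (\<lambda>t. \<gamma> (s * t)))" and s: "s = 1 \<or> s = (-1::real)" for s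
    proof -
      obtain R where R: "R > 0" "\<forall>\<gamma>. trajectory F \<gamma> \<and> norm (\<gamma> 0) > R \<longrightarrow> spirals_to_equator (\<lambda>t. \<gamma> (s * t))"
        using \<open>near_infinity F (\<lambda>\<gamma>. spirals_to_equator (\<lambda>t. \<gamma> (s * t)))\<close>
        unfolding near_infinity_def by (elim exE conjE) (rule that)
      have P: "\<not> closed_orbit \<gamma> \<and> (spirals_to_equator \<gamma> \<or> spirals_to_equator (\<lambda>t. \<gamma> (- t)))"
        if "trajectory F \<gamma> \<and> norm (\<gamma> 0) > R" for \<gamma>
        using R(2)[rule_format, OF that] spiral_not_closed[OF s] s by auto
      have "near_infinity F (\<lambda>\<gamma>. \<not> closed_orbit \<gamma> \<and>
          (spirals_to_equator \<gamma> \<or> spirals_to_equator (\<lambda>t. \<gamma> (- t))))"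
        unfolding near_infinity_def
        by (rule exI[of _ R], rule conjI, rule R(1), rule allI, rule impI, rule P)
      with loop show ?thesis unfolding focus_at_infinity_def by (rule conjI)
    qed
    have focus: "focus_at_infinity F" if "outward \<or> rev.outward"
      using that outward_spirals rev_spiral focusI[of 1] focusI[of "-1"] by auto
    \<comment> \<open>If neither condition holds, then al = - ar and bl = br. The tails of F are
      then mirror images of each other, which is the excepted case.\<close>
    have not_balanced: "outward \<or> rev.outward" if "\<not> (\<forall>x > max \<bar>\<xi> 1\<bar> \<bar>\<xi> n\<bar>. F x = F (- x))"
    proof (rule ccontr)
      assume "\<not> (outward \<or> rev.outward)"
      then have bal: "al = - ar" "bl = br" unfolding outward_def rev.outward_def by auto
      have "F x = F (- x)" if x: "x > max \<bar>\<xi> 1\<bar> \<bar>\<xi> n\<bar>" for x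
      proof -
        \<comment> \<open>As the knots increase, the two outermost ones bound all the others, so x
          and - x lie in the two tails.\<close>
        have "\<bar>\<xi> i\<bar> < x" if i: "i \<in> {1..n}" for i
        proof -
          have "1 \<in> {1..n}" "n \<in> {1..n}" using n by auto
          then have "\<xi> 1 \<le> \<xi> i" "\<xi> i \<le> \<xi> n"
            using strict_mono_on_leD[OF ordered] i by auto
          then show ?thesis using x by (simp add: abs_if split: if_splits)
        qed
        then have "F x = ar * x + br" "F (- x) = al * (- x) + bl"
          by (intro right left; fastforce simp: abs_less_iff)+
        then show ?thesis using bal by simp
      qed
      with that show False by blast
    qed
    have "al + ar < 0 \<or> al + ar = 0 \<and> br < bl \<longleftrightarrow> rev.outward"
      "al + ar > 0 \<or> al + ar = 0 \<and> br > bl \<longleftrightarrow> outward"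
      unfolding outward_def rev.outward_def by auto
    then show ?thesis
      using empty center focus not_balanced pos outward_negatively_bounded by blast
  qed
  show ?thesis
    by (rule conjI, rule impI,
        rule conjI, rule impI, erule R_hyp, rule conjI, rule impI, erule R_sn, rule conjI, rule impI, erule R_none,
        rule conjI, rule impI, erule L_hyp1, rule conjI, rule impI, erule L_sn1, rule conjI, rule impI, erule L_none,
        rule conjI, rule impI, erule L_sn2, rule conjI, rule impI, erule L_hyp2, rule no_equilibria_on_y_axis,
        rule impI, erule part_B)
qed

end
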